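(* Let $f$ be a modular form of integer weight $k\ge2$ for a congruence subgroup $\Gamma\subset\mathrm{SL}_2(\mathbb{Z})$, and let $x=r/p$ with coprime integers $r\in\mathbb{Z}$, $p\in\mathbb{Z}_{>0}$. For any $\gamma=\begin{pmatrix}a&b\\c&d\end{pmatrix}\in\Gamma$ with $c\ne0$ and $cx+d\neq0$, $$(cx+d)^{k-2}S_f\left(\frac{ax+b}{cx+d}\right)-S_f(x)=R_{f,\gamma}(x)-\frac{a_0^{(x)}}{p^k}\,\frac{c}{cx+d}.$$
   Context: Write $\mathbf{e}(z)=e^{2\pi i z}$. Let $N\ge1$ be an integer with $\Gamma(N)\subset\Gamma$ and write $f(\tau)=\sum_{n\ge0}a_n\mathbf{e}(n\tau/N)$. For $y\in\mathbb{Q}$ and $\mathrm{Re}(s)>k$ put $$\widehat L_f(s;y)=-\left(\frac{N}{2\pi}\right)^s\mathbf{e}\left(-\frac s4\right)\Gamma(s)\sum_{n=1}^\infty\frac{a_n}{n^s}\mathbf{e}\left(\frac{ny}{N}\right);$$ this extends holomorphically to $s\in\mathbb{C}\smallsetminus\{0,k\}$. The generalized Dedekind sum associated with $f$ is $S_f(y)=\widehat L_f(k-1;y)$ for $y\in\mathbb{Q}$. For $x=r/p$ in lowest terms with $p>0$, the constant $a_0^{(x)}\in\mathbb{C}$ is defined by $(p\tau+p')^{-k}f\left(\frac{r\tau+r'}{p\tau+p'}\right)=a_0^{(x)}+O(\mathbf{e}(\tau/N_x))$ as $\mathrm{Im}\,\tau\to\infty$, for some $\begin{pmatrix} r & r'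 \\ p & p' \end{pmatrix}\in\mathrm{SL}_2(\mathbb{Z})$ and some positive integer $N_x$. For $\gamma=\begin{pmatrix}a&b\\c&d\end{pmatrix}\in\Gamma$ with $c\ne0$ the regularized period polynomial is $$R_{f,\gamma}(X)=-\sum_{j=0}^{k-2}\binom{k-2}{j}\widehat L_f\left(j+1;-\frac dc\right)\left(\frac{cX+d}{c}\right)^{k-j-2}-\frac{a_0}{k-1}\left(\left(\frac{cX+d}{c}\right)^{k-1}-\frac{1}{(-c)^{k-1}(cX+d)}\right)\in\frac{1}{cX+d}\mathbb{C}[X].$$ *)

theory Defs
  imports
    "HOL-Complex_Analysis.Complex_Analysis"
    "HOL-Algebra.Group"
    "HOL-Number_Theory.Cong"
    "HOL-Library.Landau_Symbols"
begin

definition e2pi :: "complex \<Rightarrow> complex" where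
  "e2pi z = exp (2 * of_real pi * \<i> * z)"

definition SL2Z :: "(int ^ 2 ^ 2) monoid" where
  "SL2Z = \<lparr>carrier = {A. det A = 1}, mult = (**), one = mat 1\<rparr>"

definition principal_subgroup :: "nat \<Rightarrow> (int ^ 2 ^ 2) set" where
  "principal_subgroup N =
     {A \<in> carrier SL2Z. \<forall>i j. [A $ i $ j = mat 1 $ i $ j] (mod int N)}"

definition congruence_subgroup :: "(int ^ 2 ^ 2) set \<Rightarrow> bool" where
  "congruence_subgroup \<Gamma> \<longleftrightarrow>
     subgroup \<Gamma> SL2Z \<and> (\<exists>N\<ge>1. principal_subgroup N \<subseteq> \<Gamma>)"

definition slash :: "nat \<Rightarrow> (complex \<Rightarrow> complex) \<Rightarrow> int ^ 2 ^ 2 \<Rightarrow> complex \<Rightarrow> complex" where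
  "slash k f A \<tau> =
     inverse ((of_int (A $ 2 $ 1) * \<tau> + of_int (A $ 2 $ 2)) ^ k) *
     f ((of_int (A $ 1 $ 1) * \<tau> + of_int (A $ 1 $ 2)) /
        (of_int (A $ 2 $ 1) * \<tau> + of_int (A $ 2 $ 2)))"

definition fourier_expansion :: "nat \<Rightarrow> (complex \<Rightarrow> complex) \<Rightarrow> (nat \<Rightarrow> complex) \<Rightarrow> bool" where
  "fourier_expansion N f a \<longleftrightarrow>
     (\<forall>\<tau>. Im \<tau> > 0 \<longrightarrow> (\<lambda>n. a n * e2pi (of_nat n * \<tau> / of_nat N)) sums f \<tau>)"

text \<open>
  Modular forms are functions on all of \<open>complex\<close>, of which only the values on the upper half
  plane matter. The last clause is holomorphy at all cusps.
\<close>

definition modular_form :: "nat \<Rightarrow> (int ^ 2 ^ 2) set \<Rightarrow> (complex \<Rightarrow> complex) \<Rightarrow> bool" where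
  "modular_form k \<Gamma> f \<longleftrightarrow>
     f holomorphic_on {\<tau>. Im \<tau> > 0} \<and>
     (\<forall>A\<in>\<Gamma>. \<forall>\<tau>. Im \<tau> > 0 \<longrightarrow> slash k f A \<tau> = f \<tau>) \<and>
     (\<forall>A\<in>carrier SL2Z. \<exists>M\<ge>1. \<exists>a. fourier_expansion M (slash k f A) a)"

definition fourier_coeff :: "nat \<Rightarrow> (complex \<Rightarrow> complex) \<Rightarrow> nat \<Rightarrow> complex" where
  "fourier_coeff N f = (THE a. fourier_expansion N f a)"

definition hatL_series :: "nat \<Rightarrow> (complex \<Rightarrow> complex) \<Rightarrow> rat \<Rightarrow> complex \<Rightarrow> complex" where
  "hatL_series N f y s =
     - (of_real (real N / (2 * pi)) powr s * e2pi (- s / 4) * Gamma s *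
        (\<Sum>m. let n = Suc m in
           fourier_coeff N f n / of_nat n powr s * e2pi (of_nat n * of_rat y / of_nat N)))"

text \<open>
  The holomorphic continuation of the series from \<open>Re s > k\<close> to the connected set
  \<open>- {0, k}\<close> is unique there; the values of \<open>hatL\<close> at \<open>0\<close> and \<open>k\<close> are unspecified.
\<close>

definition hatL :: "nat \<Rightarrow> nat \<Rightarrow> (complex \<Rightarrow> complex) \<Rightarrow> rat \<Rightarrow> complex \<Rightarrow> complex" where
  "hatL k N f y =
     (SOME F. F holomorphic_on (- {0, of_nat k}) \<and>
              (\<forall>s. Re s > real k \<longrightarrow> F s = hatL_series N f y s))"

definition dedekind_sum :: "nat \<Rightarrow> nat \<Rightarrow> (complex \<Rightarrow> complex) \<Rightarrow> rat \<Rightarrow> complex" where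
  "dedekind_sum k N f y = hatL k N f y (of_nat (k - 1))"

text \<open>
  The constant term at the cusp \<open>r/p\<close>. Since \<open>r\<close> and \<open>p\<close> fix the first column of the matrix,
  the matrix is unique up to \<open>\<tau> \<mapsto> \<tau> + n\<close>, so the constant does not depend on it.
\<close>

definition cusp_const :: "nat \<Rightarrow> (complex \<Rightarrow> complex) \<Rightarrow> int \<Rightarrow> int \<Rightarrow> complex" where
  "cusp_const k f r p =
     (THE a0. \<exists>A\<in>carrier SL2Z. \<exists>M\<ge>1. A $ 1 $ 1 = r \<and> A $ 2 $ 1 = p \<and>
        (\<lambda>\<tau>. slash k f A \<tau> - a0) \<in> O[filtercomap Im at_top](\<lambda>\<tau>. e2pi (\<tau> / of_nat (M::nat))))"

definition period_poly ::
    "nat \<Rightarrow> nat \<Rightarrow> (complex \<Rightarrow> complex) \<Rightarrow> int ^ 2 ^ 2 \<Rightarrow> complex \<Rightarrow> complex" where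
  "period_poly k N f A X =
     (let c = A $ 2 $ 1; d = A $ 2 $ 2; u = of_int c * X + of_int d in
      - (\<Sum>j=0..k-2. of_nat ((k - 2) choose j) *
           hatL k N f (- of_int d / of_int c) (of_nat (j + 1)) * (u / of_int c) ^ (k - j - 2))
      - fourier_coeff N f 0 / of_nat (k - 1) *
          ((u / of_int c) ^ (k - 1) - 1 / ((- of_int c) ^ (k - 1) * u)))"

end

theory Submission imports Defs begin

text \<open>
  Up to regularisation, \<open>hatL\<close> at \<open>j + 1\<close> is the Eichler integral of \<open>f(\<tau>) (y - \<tau>)^j d\<tau>\<close> from the cusp \<open>y\<close>
  to \<open>\<i>\<infinity>\<close>, and \<open>S_f(y)\<close> is the case \<open>j = k - 2\<close>. Write \<open>w0 = c x + d\<close> and \<open>y0 = - d / c\<close>. Since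
  \<open>\<gamma>x - \<gamma>w = (x - w) / (w0 (c w + d))\<close>, the substitution \<open>\<tau> = \<gamma>w\<close> turns \<open>w0^(k-2) S_f(\<gamma>x)\<close> into the
  integral of \<open>f(w) (x - w)^(k-2) dw\<close> from \<open>x\<close> to \<open>\<gamma>\<^sup>-\<^sup>1\<infinity> = y0\<close>. Subtracting \<open>S_f(x)\<close> leaves minus the
  integral from \<open>y0\<close> to \<open>\<i>\<infinity>\<close>, and expanding \<open>(x - w)^(k-2)\<close> around \<open>y0\<close> gives the sum over \<open>j\<close> in
  the period polynomial.

  All these integrals diverge at cusps with a nonzero constant term, and the remaining terms of the
  formula are the price of regularising them. The proof therefore avoids integrals from cusp to
  cusp. A primitive \<open>G\<close> of \<open>f(\<tau>) (x - \<tau>)^(k-2)\<close> on the upper half plane has a finite part at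
  every cusp, namely its limit after an explicit elementary function has been subtracted, and each
  value of \<open>hatL\<close> is a difference of two finite parts (\<open>hatL_boundary_values\<close>). The function
  \<open>H(\<gamma>w) = G(w) / w0^(k-2)\<close> is a primitive of \<open>f(\<tau>) (\<gamma>x - \<tau>)^(k-2)\<close>, so the finite parts of \<open>G\<close> and
  \<open>H\<close> are the same limits, except that different elementary functions are subtracted. The
  differences of these functions are constants: \<open>pole_value_at_infinity\<close> and
  \<open>pole_value_at_pole\<close> account for the two terms with \<open>a\<^sub>0\<close> in the period polynomial, and
  \<open>source_image_values\<close> for the term with the constant of \<open>f\<close> at the cusp \<open>x\<close>. Finite parts may be
  computed along any vertical line in the coordinate of the cusp, because the regularised
  primitive has a derivative that decays towards the cusp.

  The definition of \<open>hatL\<close> also demands that the Dirichlet series converges for all \<open>Re s > k\<close>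
  and that it continues. Convergence needs \<open>a_n = O(n^(k-1+\<epsilon>))\<close>, which follows by averaging \<open>|f|\<close>
  over a horizontal segment at height about \<open>1/n\<close> (\<open>coeff_bound\<close>). For the continuation, the
  Mellin transform of \<open>f\<close> along the vertical line over \<open>y\<close> is split at \<open>1\<close>; once the
  leading terms at both ends are removed, it is an entire function
  (\<open>mellin_transform_entire\<close>), and the leading terms contribute simple poles at \<open>0\<close> and \<open>k\<close>.
\<close>

section \<open>Fractional linear action of the modular group\<close>

(* Indexing of matrices is written with the same symbol as coefficients of power series. *)
no_notation fps_nth (infixl \<open>$\<close> 75)

text \<open>
  The factor of automorphy.
\<close>

definition den :: "int ^ 2 ^ 2 \<Rightarrow> complex \<Rightarrow> complex" where
  "den A \<tau> = of_int (A $ 2 $ 1) * \<tau> + of_int (A $ 2 $ 2)"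

definition moebius_act :: "int ^ 2 ^ 2 \<Rightarrow> complex \<Rightarrow> complex" where
  "moebius_act A \<tau> = (of_int (A $ 1 $ 1) * \<tau> + of_int (A $ 1 $ 2)) / den A \<tau>"

definition mat2 :: "int \<Rightarrow> int \<Rightarrow> int \<Rightarrow> int \<Rightarrow> int ^ 2 ^ 2" where
  "mat2 a b c d = vector [vector [a, b], vector [c, d]]"

lemma mat2_nth [simp]:
  "mat2 a b c d $ 1 $ 1 = a" "mat2 a b c d $ 1 $ 2 = b"
  "mat2 a b c d $ 2 $ 1 = c" "mat2 a b c d $ 2 $ 2 = d"
  by (simp_all add: mat2_def vector_2)

lemma SL2Z_carrier_iff: "A \<in> carrier SL2Z \<longleftrightarrow> A $ 1 $ 1 * A $ 2 $ 2 - A $ 1 $ 2 * A $ 2 $ 1 = 1"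
  by (simp add: SL2Z_def det_2)

lemma SL2Z_det:
  assumes "A \<in> carrier SL2Z"
  shows "of_int (A $ 1 $ 1) * of_int (A $ 2 $ 2) - of_int (A $ 1 $ 2) * of_int (A $ 2 $ 1) = (1 :: 'a :: comm_ring_1)"
  using arg_cong[OF assms[unfolded SL2Z_carrier_iff], of "of_int :: int \<Rightarrow> 'a"] by simp

lemma mult2_nth:
  fixes A B :: "int ^ 2 ^ 2"
  shows "(A ** B) $ i $ j = A $ i $ 1 * B $ 1 $ j + A $ i $ 2 * B $ 2 $ j"
  by (simp add: matrix_matrix_mult_def sum_2)

lemma mat2_eqI:
  fixes A B :: "int ^ 2 ^ 2"
  assumes "A $ 1 $ 1 = B $ 1 $ 1" "A $ 1 $ 2 = B $ 1 $ 2" "A $ 2 $ 1 = B $ 2 $ 1" "A $ 2 $ 2 = B $ 2 $ 2"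
  shows "A = B"
  using assms by (simp add: vec_eq_iff forall_2)

lemma SL2Z_mult: "A \<in> carrier SL2Z \<Longrightarrow> B \<in> carrier SL2Z \<Longrightarrow> A ** B \<in> carrier SL2Z"
  by (simp add: SL2Z_def det_mul)

lemma SL2Z_adjugate:
  assumes "A \<in> carrier SL2Z"
  defines "A' \<equiv> mat2 (A $ 2 $ 2) (- (A $ 1 $ 2)) (- (A $ 2 $ 1)) (A $ 1 $ 1)"
  shows "A' \<in> carrier SL2Z" "A ** A' = mat 1" "A' ** A = mat 1"
  using assms(1) unfolding A'_def
  by (auto simp: SL2Z_carrier_iff mult2_nth mat_def algebra_simps intro!: mat2_eqI)

lemma den_nonzero:
  assumes "A \<in> carrier SL2Z" "Im \<tau> > 0"
  shows "den A \<tau> \<noteq> 0"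
proof
  assume *: "den A \<tau> = 0"
  hence "of_int (A $ 2 $ 1) * Im \<tau> = 0"
    by (simp add: den_def complex_eq_iff)
  with assms have "A $ 2 $ 1 = 0" by simp
  moreover from this * have "A $ 2 $ 2 = 0" by (simp add: den_def)
  ultimately show False using assms(1) by (simp add: SL2Z_carrier_iff)
qed

lemma Im_moebius:
  assumes "A \<in> carrier SL2Z" "Im \<tau> > 0"
  shows "Im (moebius_act A \<tau>) = Im \<tau> / norm (den A \<tau>) ^ 2"
proof -
  have det: "real_of_int (A $ 1 $ 1) * real_of_int (A $ 2 $ 2)
      - real_of_int (A $ 1 $ 2) * real_of_int (A $ 2 $ 1) = 1"
    by (rule SL2Z_det[OF assms(1)])
  have "Im (moebius_act A \<tau>) =
     (Im \<tau> * (real_of_int (A $ 1 $ 1) * real_of_int (A $ 2 $ 2)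
      - real_of_int (A $ 1 $ 2) * real_of_int (A $ 2 $ 1))) / norm (den A \<tau>) ^ 2"
    unfolding moebius_act_def Im_divide cmod_power2 [of "den A \<tau>"]
    by (rule arg_cong2 [where f="(/)"]) (simp_all add: den_def algebra_simps)
  thus ?thesis by (simp add: det)
qed

lemma Im_moebius_pos: "A \<in> carrier SL2Z \<Longrightarrow> Im \<tau> > 0 \<Longrightarrow> Im (moebius_act A \<tau>) > 0"
  by (simp add: Im_moebius den_nonzero)

lemma den_mult:
  assumes "B \<in> carrier SL2Z" "Im \<tau> > 0"
  shows "den (A ** B) \<tau> = den A (moebius_act B \<tau>) * den B \<tau>"
  using den_nonzero[OF assms]
  by (simp add: den_def moebius_act_def mult2_nth field_simps)

lemma moebius_mult:
  assumes "A \<in> carrier SL2Z" "B \<in> carrier SL2Z" "Im \<tau> > 0"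
  shows "moebius_act (A ** B) \<tau> = moebius_act A (moebius_act B \<tau>)"
proof -
  note nz = den_nonzero[OF assms(2,3)] den_nonzero[OF assms(1) Im_moebius_pos[OF assms(2,3)]]
  have "of_int ((A ** B) $ 1 $ 1) * \<tau> + of_int ((A ** B) $ 1 $ 2) =
      (of_int (A $ 1 $ 1) * moebius_act B \<tau> + of_int (A $ 1 $ 2)) * den B \<tau>"
    using nz(1) by (simp add: moebius_act_def mult2_nth field_simps) (simp add: den_def algebra_simps)
  thus ?thesis
    using nz by (simp add: moebius_act_def [of "A ** B"] moebius_act_def [of A] den_mult [OF assms(2,3)])
qed

lemma moebius_adjugate:
  assumes "A \<in> carrier SL2Z" "Im \<tau> > 0"
  defines "A' \<equiv> mat2 (A $ 2 $ 2) (- (A $ 1 $ 2)) (- (A $ 2 $ 1)) (A $ 1 $ 1)"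
  shows "moebius_act A (moebius_act A' \<tau>) = \<tau>" "moebius_act A' (moebius_act A \<tau>) = \<tau>"
    "den A (moebius_act A' \<tau>) * den A' \<tau> = 1"
proof -
  note adj = SL2Z_adjugate[OF assms(1), folded A'_def]
  have id: "moebius_act (mat 1) \<tau> = \<tau>" "den (mat 1) \<tau> = 1"
    by (simp_all add: moebius_act_def den_def mat_def)
  show "moebius_act A (moebius_act A' \<tau>) = \<tau>" "moebius_act A' (moebius_act A \<tau>) = \<tau>"
    using moebius_mult[OF assms(1) adj(1) assms(2)] moebius_mult[OF adj(1) assms(1) assms(2)] id adj
    by simp_all
  show "den A (moebius_act A' \<tau>) * den A' \<tau> = 1"
    using den_mult[OF adj(1) assms(2), of A] id adj by simp
qed

lemma slash_eq: "slash k f A \<tau> = inverse (den A \<tau> ^ k) * f (moebius_act A \<tau>)"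
  by (simp add: slash_def den_def moebius_act_def)

lemma slash_mult:
  assumes "A \<in> carrier SL2Z" "B \<in> carrier SL2Z" "Im \<tau> > 0"
  shows "slash k f (A ** B) \<tau> = inverse (den B \<tau> ^ k) * slash k f A (moebius_act B \<tau>)"
  by (simp add: slash_eq moebius_mult[OF assms] den_mult[OF assms(2,3)] power_mult_distrib)

lemma SL2Z_with_first_column:
  assumes "coprime r p"
  obtains A where "A \<in> carrier SL2Z" "A $ 1 $ 1 = r" "A $ 2 $ 1 = p"
proof -
  obtain u v where "u * r + v * p = 1"
    using assms bezout_int [of r p] by (auto simp: coprime_iff_gcd_eq_1)
  thus ?thesis by (intro that[of "mat2 r (- v) p u"]) (auto simp: SL2Z_carrier_iff algebra_simps)
qed

lemma moebius_has_field_derivative: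
  assumes "A \<in> carrier SL2Z" "Im \<tau> > 0"
  shows "(moebius_act A has_field_derivative 1 / den A \<tau> ^ 2) (at \<tau>)"
proof -
  have det: "complex_of_int (A $ 1 $ 1) * of_int (A $ 2 $ 2) - of_int (A $ 1 $ 2) * of_int (A $ 2 $ 1) = 1"
    by (rule SL2Z_det[OF assms(1)])
  have nz: "of_int (A $ 2 $ 1) * \<tau> + of_int (A $ 2 $ 2) \<noteq> 0"
    using den_nonzero[OF assms] by (simp add: den_def)
  have "(moebius_act A has_field_derivative
      (of_int (A $ 1 $ 1) * den A \<tau> - (of_int (A $ 1 $ 1) * \<tau> + of_int (A $ 1 $ 2)) * of_int (A $ 2 $ 1))
       / den A \<tau> ^ 2) (at \<tau>)"
    unfolding moebius_act_def den_def using nz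
    by (auto intro!: derivative_eq_intros simp: power2_eq_square)
  also have "of_int (A $ 1 $ 1) * den A \<tau> - (of_int (A $ 1 $ 1) * \<tau> + of_int (A $ 1 $ 2)) * of_int (A $ 2 $ 1)
      = (1 :: complex)"
    using det by (simp add: den_def algebra_simps)
  finally show ?thesis .
qed

text \<open>
  The points \<open>u\<close> and \<open>v\<close> range over the whole plane: \<open>u\<close> will be a rational cusp and \<open>v\<close> a point of the
  upper half plane.
\<close>

lemma moebius_diff:
  assumes "A \<in> carrier SL2Z" "den A u \<noteq> 0" "den A v \<noteq> 0"
  shows "moebius_act A u - moebius_act A v = (u - v) / (den A u * den A v)"
proof -
  have det: "complex_of_int (A $ 1 $ 1) * of_int (A $ 2 $ 2) = 1 + of_int (A $ 1 $ 2) * of_int (A $ 2 $ 1)"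
    using SL2Z_det[OF assms(1), where 'a=complex] by (simp add: algebra_simps)
  have "(of_int (A $ 1 $ 1) * u + of_int (A $ 1 $ 2)) * den A v
      - (of_int (A $ 1 $ 1) * v + of_int (A $ 1 $ 2)) * den A u
     = (u - v) * (of_int (A $ 1 $ 1) * of_int (A $ 2 $ 2) - of_int (A $ 1 $ 2) * of_int (A $ 2 $ 1))"
    by (simp add: den_def algebra_simps)
  thus ?thesis using assms(2,3) det by (simp add: moebius_act_def diff_frac_eq)
qed

section \<open>Fourier expansions\<close>

lemma e2pi_add: "e2pi (z + w) = e2pi z * e2pi w"
  by (simp add: e2pi_def exp_add distrib_left)

lemma norm_e2pi: "norm (e2pi z) = exp (- 2 * pi * Im z)"
  by (simp add: e2pi_def)

lemma e2pi_0 [simp]: "e2pi 0 = 1"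
  by (simp add: e2pi_def)

lemma e2pi_of_nat_mult: "e2pi (of_nat n * z) = e2pi z ^ n"
  by (simp add: e2pi_def flip: exp_of_nat_mult) (simp add: mult_ac)

lemma e2pi_of_nat_mult_divide: "e2pi (of_nat n * z / w) = e2pi (z / w) ^ n"
  by (simp flip: e2pi_of_nat_mult)

lemma e2pi_of_int [simp]: "e2pi (of_int n) = 1"
  using exp_integer_2pi[of "of_int n"] by (simp add: e2pi_def mult_ac)

lemma e2pi_eq_1_iff: "e2pi z = 1 \<longleftrightarrow> z \<in> \<int>"
proof
  assume "e2pi z = 1"
  then obtain n :: int where "Re (2 * complex_of_real pi * \<i> * z) = 0"
     "Im (2 * complex_of_real pi * \<i> * z) = of_int (2 * n) * pi"
    unfolding e2pi_def exp_eq_1 by blast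
  hence "z = of_int n" by (auto simp: complex_eq_iff)
  thus "z \<in> \<int>" by simp
qed (auto elim!: Ints_cases)

text \<open>
  A power series in \<open>e2pi (\<tau> / M)\<close> that converges at height \<open>h/2\<close> converges absolutely at height \<open>h\<close>,
  where the variable is smaller.
\<close>

lemma fourier_expansion_norm_summable:
  assumes "fourier_expansion M g a" "M \<ge> 1" "h > 0"
  shows "summable (\<lambda>n. norm (a n) * exp (- 2 * pi * h / real M) ^ n)"
proof -
  let ?q = "\<lambda>h. e2pi (\<i> * complex_of_real h / of_nat M)"
  have "summable (\<lambda>n. a n * ?q (h/2) ^ n)"
    using assms unfolding fourier_expansion_def
    by (auto simp: sums_iff e2pi_of_nat_mult_divide dest!: spec[of _ "\<i> * complex_of_real (h/2)"])
  moreover have "norm (?q h) < norm (?q (h/2))"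
    using assms by (simp add: norm_e2pi divide_simps)
  ultimately have "summable (\<lambda>n. norm (a n * ?q h ^ n))"
    by (rule powser_insidea)
  thus ?thesis by (simp add: norm_mult norm_power norm_e2pi)
qed

text \<open>
  Every term after the constant one contains the factor \<open>e2pi (\<tau> / M)\<close>, and the cofactor is bounded
  uniformly in the real part of \<open>\<tau>\<close>.
\<close>

lemma fourier_expansion_decay:
  assumes "fourier_expansion M g a" "M \<ge> 1" "h > 0"
  obtains C where "C \<ge> 0"
    "\<And>\<tau>. Im \<tau> \<ge> h \<Longrightarrow> norm (g \<tau> - a 0) \<le> C * exp (- 2 * pi * Im \<tau> / real M)"
proof
  define q where "q = exp (- 2 * pi * h / real M)"
  define C where "C = (\<Sum>n. norm (a (Suc n)) * q ^ n)"
  have sm: "summable (\<lambda>n. norm (a (Suc n)) * q ^ n)"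
  proof -
    have "summable (\<lambda>n. norm (a (Suc n)) * q ^ Suc n / q)"
      using fourier_expansion_norm_summable[OF assms]
      by (intro summable_divide) (subst summable_Suc_iff, simp add: q_def)
    thus ?thesis by (simp add: q_def)
  qed
  show "C \<ge> 0" unfolding C_def
    by (intro suminf_nonneg sm) (simp add: q_def)
  fix \<tau> assume \<tau>: "Im \<tau> \<ge> h"
  define w where "w = e2pi (\<tau> / of_nat M)"
  have nw: "norm w = exp (- 2 * pi * Im \<tau> / real M)" "norm w \<le> q"
    using \<tau> assms by (simp_all add: w_def q_def norm_e2pi divide_simps)
  have "(\<lambda>n. a n * w ^ n) sums g \<tau>"
    using assms \<tau> by (auto simp: fourier_expansion_def w_def e2pi_of_nat_mult_divide)
  hence s: "(\<lambda>n. a (Suc n) * w ^ Suc n) sums (g \<tau> - a 0)"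
    by (subst sums_Suc_iff) simp
  have le: "norm (a (Suc n) * w ^ Suc n) \<le> norm w * (norm (a (Suc n)) * q ^ n)" for n
  proof -
    have "norm w * (norm (a (Suc n)) * norm w ^ n) \<le> norm w * (norm (a (Suc n)) * q ^ n)"
      using nw by (intro mult_left_mono power_mono) auto
    thus ?thesis by (simp add: norm_mult norm_power mult_ac)
  qed
  have "norm (g \<tau> - a 0) \<le> (\<Sum>n. norm w * (norm (a (Suc n)) * q ^ n))"
    unfolding sums_unique[OF s]
    by (intro norm_suminf_le summable_mult sm le)
  also have "\<dots> = C * norm w"
    unfolding C_def by (subst suminf_mult[OF sm]) (simp add: mult.commute)
  finally show "norm (g \<tau> - a 0) \<le> C * exp (- 2 * pi * Im \<tau> / real M)"
    by (simp add: nw)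
qed

lemma fourier_expansion_bounded:
  assumes "fourier_expansion M g a" "M \<ge> 1" "h > 0"
  obtains C where "\<And>\<tau>. Im \<tau> \<ge> h \<Longrightarrow> norm (g \<tau>) \<le> C"
proof -
  obtain C where C: "C \<ge> 0"
    "\<And>\<tau>. Im \<tau> \<ge> h \<Longrightarrow> norm (g \<tau> - a 0) \<le> C * exp (- 2 * pi * Im \<tau> / real M)"
    using fourier_expansion_decay[OF assms] by metis
  have "norm (g \<tau>) \<le> C + norm (a 0)" if "Im \<tau> \<ge> h" for \<tau>
  proof -
    have "norm (g \<tau>) \<le> norm (g \<tau> - a 0) + norm (a 0)" by norm
    also have "norm (g \<tau> - a 0) \<le> C * 1"
      using that assms by (intro order.trans[OF C(2)] mult_left_mono C(1)) auto
    finally show ?thesis by simp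
  qed
  thus ?thesis by (rule that)
qed

lemma e2pi_has_integral_period:
  assumes "M \<ge> 1"
  shows "((\<lambda>x. e2pi (of_int n * of_real x / of_nat M)) has_integral
          (if n = 0 then of_nat M else 0)) {0..real M}"
proof (cases "n = 0")
  case True
  thus ?thesis using has_integral_const_real[of "1::complex" 0 "real M"] by (simp add: scaleR_conv_of_real)
next
  case False
  define c :: complex where "c = 2 * of_real pi * \<i> * of_int n / of_nat M"
  have c: "c \<noteq> 0" using False assms by (simp add: c_def)
  have "((\<lambda>x. exp (c * of_real x)) has_integral
       exp (c * of_real (real M)) / c - exp (c * of_real 0) / c) {0..real M}"
  proof (rule fundamental_theorem_of_calculus)
    fix x :: real
    show "((\<lambda>x. exp (c * of_real x) / c) has_vector_derivative exp (c * of_real x))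
            (at x within {0..real M})"
      unfolding has_vector_derivative_def has_field_derivative_def[symmetric] using c
      by (auto intro!: derivative_eq_intros has_vector_derivative_real_field simp: has_vector_derivative_def[symmetric])
  qed simp
  moreover have "exp (c * of_real (real M)) = 1"
    using e2pi_of_int[of n] assms by (simp add: c_def e2pi_def)
  moreover have "exp (c * of_real x) = e2pi (of_int n * of_real x / of_nat M)" for x
    by (simp add: c_def e2pi_def mult_ac)
  ultimately show ?thesis using False by simp
qed

text \<open>
  Orthogonality of characters on a horizontal segment. It shows that the coefficients are unique, and
  it bounds them by the mean of \<open>norm g\<close> at any chosen height.
\<close>

lemma fourier_coeff_integral:
  assumes "fourier_expansion M g a" "M \<ge> 1" "y > 0"
  shows "((\<lambda>x. g (Complex x y) * e2pi (- of_nat n * of_real x / of_nat M)) has_integral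
           of_nat M * a n * of_real (exp (- 2 * pi * y / real M) ^ n)) {0..real M}"
proof -
  define q where "q = exp (- 2 * pi * y / real M)"
  define t where "t = (\<lambda>m x. a m * of_real (q ^ m) * e2pi (of_int (int m - int n) * of_real x / of_nat M))"
  have trm: "a m * e2pi (of_nat m * Complex x y / of_nat M) * e2pi (- of_nat n * of_real x / of_nat M)
              = t m x" for m x
  proof -
    have "complex_of_real q ^ m = e2pi (of_nat m * (\<i> * of_real y / of_nat M))"
    proof -
      have "e2pi (of_nat m * (\<i> * of_real y / of_nat M))
            = exp ((\<i> * \<i>) * (of_nat m * (2 * of_real pi * of_real y)) / of_nat M)"
        unfolding e2pi_def
        by (rule arg_cong[where f = exp]) (simp only: mult_ac times_divide_eq_right times_divide_eq_left)
      thus ?thesis by (simp add: q_def flip: exp_of_nat_mult exp_of_real)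
    qed
    moreover have "of_nat m * Complex x y / of_nat M + (- of_nat n * of_real x / of_nat M)
       = of_nat m * (\<i> * of_real y / of_nat M) + of_int (int m - int n) * of_real x / of_nat M"
      by (simp add: Complex_eq algebra_simps add_divide_distrib diff_divide_distrib)
    ultimately show ?thesis
      by (simp add: t_def mult.assoc flip: e2pi_add)
  qed
  have sums: "(\<lambda>m. t m x) sums (g (Complex x y) * e2pi (- of_nat n * of_real x / of_nat M))" for x
    using assms unfolding fourier_expansion_def
    by (auto simp flip: trm intro!: sums_mult2)
  have "uniform_limit {0..real M} (\<lambda>K x. \<Sum>m<K. t m x) (\<lambda>x. suminf (\<lambda>m. t m x)) sequentially"
  proof (rule Weierstrass_m_test)
    show "summable (\<lambda>m. norm (a m) * q ^ m)"
      unfolding q_def by (rule fourier_expansion_norm_summable[OF assms])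
    show "norm (t m x) \<le> norm (a m) * q ^ m" for m x
      by (simp add: t_def norm_mult norm_power norm_e2pi q_def)
  qed
  hence lim: "uniform_limit {0..real M} (\<lambda>K x. \<Sum>m<K. t m x)
      (\<lambda>x. g (Complex x y) * e2pi (- of_nat n * of_real x / of_nat M)) sequentially"
    using sums by (simp add: sums_iff)
  have hasint: "(t m has_integral (if m = n then of_nat M * a n * of_real (q ^ n) else 0)) {0..real M}" for m
    unfolding t_def
    using has_integral_mult_right[OF e2pi_has_integral_period[OF assms(2), of "int m - int n"],
       of "a m * of_real (q ^ m)"]
    by (auto simp: mult_ac)
  obtain I J where IJ: "\<And>K. ((\<lambda>x. \<Sum>m<K. t m x) has_integral I K) {0..real M}"
      "((\<lambda>x. g (Complex x y) * e2pi (- of_nat n * of_real x / of_nat M)) has_integral J) {0..real M}"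
      "I \<longlonglongrightarrow> J"
  proof (rule uniform_limit_integral[OF lim])
    show "continuous_on {0..real M} (\<lambda>x. \<Sum>m<K. t m x)" for K
      unfolding t_def e2pi_def using assms(2) by (intro continuous_intros) auto
  qed auto
  have "I K = (\<Sum>m<K. (if m = n then of_nat M * a n * of_real (q ^ n) else 0))" for K
    by (rule has_integral_unique[OF IJ(1)]) (intro has_integral_sum hasint, simp)
  hence "I K = of_nat M * a n * of_real (q ^ n)" if "K > n" for K
    using that by simp
  hence "I \<longlonglongrightarrow> of_nat M * a n * of_real (q ^ n)"
    by (intro tendsto_eventually eventually_mono[OF eventually_gt_at_top[of n]])
  with IJ(3) have "J = of_nat M * a n * of_real (q ^ n)"
    using LIMSEQ_unique by blast
  with IJ(2) show ?thesis by (simp add: q_def)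
qed

lemma fourier_expansion_unique:
  assumes "fourier_expansion M g a" "fourier_expansion M g b" "M \<ge> 1"
  shows "a = b"
proof
  fix n
  have "of_nat M * a n * of_real (exp (- 2 * pi * 1 / real M) ^ n)
      = of_nat M * b n * of_real (exp (- 2 * pi * 1 / real M) ^ n)"
    by (rule has_integral_unique[OF fourier_coeff_integral[OF assms(1,3)]
          fourier_coeff_integral[OF assms(2,3)]]) auto
  thus "a n = b n" using assms(3) by simp
qed

lemma fourier_coeff_eqI:
  assumes "fourier_expansion N f a" "N \<ge> 1"
  shows "fourier_coeff N f = a"
  unfolding fourier_coeff_def using assms fourier_expansion_unique by blast

text \<open>
  Averaging \<open>f\<close> over translates by multiples of \<open>N\<close> does not change it, but removes all terms whose
  frequency \<open>n / M\<close> is not a multiple of \<open>1 / N\<close>. The surviving terms are renumbered through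
  \<open>gcd M N\<close>.
\<close>

lemma fourier_expansion_change_period:
  assumes f: "fourier_expansion M f a" and M: "M \<ge> 1" and N: "N \<ge> 1"
    and per: "\<And>\<tau>. Im \<tau> > 0 \<Longrightarrow> f (\<tau> + of_nat N) = f \<tau>"
  shows "\<exists>b. fourier_expansion N f b"
proof -
  define g where "g = gcd M N"
  define M' where "M' = M div g"
  define N' where "N' = N div g"
  have g: "g > 0" using M by (simp add: g_def)
  have MN: "M = g * M'" "N = g * N'" by (simp_all add: M'_def N'_def g_def)
  have M': "M' > 0" and N': "N' > 0" using MN M N by (auto intro: Nat.gr0I)
  have cop: "coprime M' N'"
    unfolding M'_def N'_def g_def using M by (intro div_gcd_coprime) simp
  \<comment> \<open>The factor by which the average over \<open>M\<close> translates multiplies the \<open>n\<close>-th term.\<close>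
  define ch where "ch = (\<lambda>n. (\<Sum>l<M. e2pi (of_nat n * (of_nat l * of_nat N) / of_nat M)) / of_nat M)"
  have chi: "ch n = (if M' dvd n then 1 else 0)" for n
  proof -
    define z where "z = e2pi (of_nat (n * N) / of_nat M)"
    have pow: "e2pi (of_nat n * (of_nat l * of_nat N) / of_nat M) = z ^ l" for l
      unfolding z_def e2pi_of_nat_mult[symmetric] by (simp add: mult_ac)
    have zM: "z ^ M = 1"
      unfolding z_def e2pi_of_nat_mult[symmetric] using M e2pi_of_int[of "int (n * N)"] by simp
    have z1: "z = 1 \<longleftrightarrow> M' dvd n"
    proof -
      have "z = 1 \<longleftrightarrow> of_nat (n * N) / (of_nat M :: complex) \<in> \<int>"
        by (simp add: z_def e2pi_eq_1_iff)
      also have "\<dots> \<longleftrightarrow> M dvd n * N"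
      proof
        assume "of_nat (n * N) / (of_nat M :: complex) \<in> \<int>"
        then obtain i where "of_nat (n * N) / (of_nat M :: complex) = of_int i" by (auto elim: Ints_cases)
        hence "(of_int (int (n * N)) :: complex) = of_int (i * int M)"
          using M by (simp add: field_simps)
        hence "int (n * N) = i * int M" unfolding of_int_eq_iff .
        hence "int M dvd int (n * N)" by simp
        thus "M dvd n * N" unfolding of_nat_dvd_iff .
      next
        assume "M dvd n * N"
        then obtain j where "n * N = M * j" by (elim dvdE)
        hence "of_nat (n * N) / (of_nat M :: complex) = of_nat j" using M by simp
        thus "of_nat (n * N) / (of_nat M :: complex) \<in> \<int>" by simp
      qed
      also have "\<dots> \<longleftrightarrow> g * M' dvd g * (n * N')" by (simp add: MN mult_ac)
      also have "\<dots> \<longleftrightarrow> M' dvd n" using g cop by (simp add: coprime_dvd_mult_left_iff)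
      finally show ?thesis .
    qed
    show ?thesis
    proof (cases "z = 1")
      case True
      thus ?thesis using z1 M by (simp add: ch_def pow)
    next
      case False
      hence "(\<Sum>l<M. z ^ l) = 0" using geometric_sum[OF False, of M] zM by simp
      thus ?thesis using False z1 by (simp add: ch_def pow)
    qed
  qed
  have *: "(\<lambda>m. a (m * M') * e2pi (of_nat (m * N') * \<tau> / of_nat N)) sums f \<tau>" if \<tau>: "Im \<tau> > 0" for \<tau>
  proof -
    have shift: "f (\<tau> + of_nat l * of_nat N) = f \<tau>" for l
    proof (induction l)
      case (Suc l)
      have "f (\<tau> + of_nat l * of_nat N + of_nat N) = f (\<tau> + of_nat l * of_nat N)"
        using \<tau> by (intro per) simp
      thus ?case using Suc by (simp add: algebra_simps)
    qed simp
    have "(\<lambda>n. a n * e2pi (of_nat n * (\<tau> + of_nat l * of_nat N) / of_nat M)) sums f \<tau>" for l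
      using f \<tau> shift[of l] unfolding fourier_expansion_def
      by (auto dest!: spec[of _ "\<tau> + of_nat l * of_nat N"])
    hence "(\<lambda>n. (\<Sum>l<M. a n * e2pi (of_nat n * (\<tau> + of_nat l * of_nat N) / of_nat M)) / of_nat M)
             sums ((\<Sum>l<M. f \<tau>) / of_nat M)"
      by (intro sums_divide sums_sum)
    also have "(\<lambda>n. (\<Sum>l<M. a n * e2pi (of_nat n * (\<tau> + of_nat l * of_nat N) / of_nat M)) / of_nat M)
       = (\<lambda>n. a n * e2pi (of_nat n * \<tau> / of_nat M) * ch n)"
      by (simp add: ch_def distrib_left add_divide_distrib e2pi_add sum_distrib_left mult.assoc)
    also have "(\<Sum>l<M. f \<tau>) / of_nat M = f \<tau>" using M by simp
    finally have s: "(\<lambda>n. a n * e2pi (of_nat n * \<tau> / of_nat M) * ch n) sums f \<tau>" .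
    have "strict_mono (\<lambda>m. m * M')" using M' by (simp add: strict_mono_def)
    moreover have "a n * e2pi (of_nat n * \<tau> / of_nat M) * ch n = 0" if "n \<notin> range (\<lambda>m. m * M')" for n
      using that by (auto simp: chi elim!: dvdE)
    ultimately have "(\<lambda>m. a (m * M') * e2pi (of_nat (m * M') * \<tau> / of_nat M) * ch (m * M')) sums f \<tau>"
      using sums_mono_reindex[of "\<lambda>m. m * M'" "\<lambda>n. a n * e2pi (of_nat n * \<tau> / of_nat M) * ch n" "f \<tau>"] s
      by blast
    also have "(\<lambda>m. a (m * M') * e2pi (of_nat (m * M') * \<tau> / of_nat M) * ch (m * M')) =
        (\<lambda>m. a (m * M') * e2pi (of_nat (m * N') * \<tau> / of_nat N))"
      using g M' N' by (simp add: chi MN)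
    finally show ?thesis .
  qed
  define b where "b = (\<lambda>n. if N' dvd n then a (n div N' * M') else 0)"
  have "(\<lambda>n. b n * e2pi (of_nat n * \<tau> / of_nat N)) sums f \<tau>" if \<tau>: "Im \<tau> > 0" for \<tau>
  proof -
    have "strict_mono (\<lambda>m. m * N')" using N' by (simp add: strict_mono_def)
    moreover have "b n = 0" if "n \<notin> range (\<lambda>m. m * N')" for n
      using that by (auto simp: b_def elim!: dvdE)
    moreover have "b (m * N') = a (m * M')" for m using N' by (simp add: b_def)
    ultimately show ?thesis
      using sums_mono_reindex[of "\<lambda>m. m * N'" "\<lambda>n. b n * e2pi (of_nat n * \<tau> / of_nat N)" "f \<tau>"] *[OF \<tau>]
      by simp
  qed
  thus ?thesis unfolding fourier_expansion_def by blast
qed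

section \<open>Regularised Mellin transforms\<close>

lemma set_integrable_lborelI:
  fixes f :: "real \<Rightarrow> 'a :: euclidean_space"
  assumes "set_integrable lebesgue S f" "set_borel_measurable borel S f"
  shows "set_integrable lborel S f"
  using assms by (simp add: set_integrable_def set_borel_measurable_def integrable_completion)

lemma set_integrable_inverse_square:
  "set_integrable lborel {1<..} (\<lambda>t::real. 1 / t ^ 2)"
proof (rule set_integrable_lborelI)
  have "(\<lambda>t::real. t powr (-2)) integrable_on {1..}"
    using has_integral_powr_to_inf[of "-2" 1] unfolding integrable_on_def by auto
  hence "(\<lambda>t::real. t powr (-2)) absolutely_integrable_on {1..}"
    by (intro nonnegative_absolutely_integrable_1) auto
  hence "set_integrable lebesgue {1<..} (\<lambda>t::real. t powr (-2))"
    by (rule set_integrable_subset) auto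
  thus "set_integrable lebesgue {1<..} (\<lambda>t::real. 1 / t ^ 2)"
    by (rule set_integrable_cong[THEN iffD1, rotated 3]) (auto simp: powr_minus powr_numeral divide_simps)
  show "set_borel_measurable borel {1<..} (\<lambda>t::real. 1 / t ^ 2)"
    by (rule set_measurable_continuous_on) (auto intro!: continuous_intros)
qed

lemma powr_of_real_pos:
  assumes "t > 0"
  shows "of_real t powr s = exp (s * complex_of_real (ln t))"
  using assms by (simp add: powr_def Ln_of_real)

lemma norm_powr_of_real_pos:
  assumes "t > 0"
  shows "norm (of_real t powr (s :: complex)) = t powr Re s"
  using assms by (simp add: powr_of_real_pos powr_def)

text \<open>
  Expand \<open>t powr (s - 1) = exp ((s - 1) * ln t)\<close> in powers of \<open>s - 1\<close> and integrate termwise. The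
  absolute values of the terms add up to at most \<open>t powr \<bar>s - 1\<bar> + t powr (- \<bar>s - 1\<bar>)\<close>, which is
  integrable against \<open>\<psi>\<close>, so the resulting power series in \<open>s - 1\<close> converges everywhere.
\<close>

lemma mellin_transform_entire:
  fixes \<psi> :: "real \<Rightarrow> complex"
  assumes int: "\<And>\<sigma>::real. set_integrable lborel {0<..} (\<lambda>t. \<psi> t * of_real (t powr \<sigma>))"
  shows "(\<lambda>s. LINT t:{0<..}|lborel. \<psi> t * of_real t powr (s - 1)) holomorphic_on UNIV"
    and "set_integrable lborel {0<..} (\<lambda>t. \<psi> t * of_real t powr (s - 1))"
proof -
  define \<Psi> where "\<Psi> = (\<lambda>t. indicator {0<..} t *\<^sub>R \<psi> t)"
  have int': "integrable lborel (\<lambda>t. norm (\<Psi> t) * t powr \<sigma>)" for \<sigma> :: real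
  proof -
    have "integrable lborel (\<lambda>t. norm (indicator {0<..} t *\<^sub>R (\<psi> t * of_real (t powr \<sigma>))))"
      using int[of \<sigma>] unfolding set_integrable_def by (rule integrable_norm)
    thus ?thesis by (simp add: \<Psi>_def norm_mult mult_ac)
  qed
  have meas [measurable]: "\<Psi> \<in> borel_measurable borel"
  proof -
    have "(\<lambda>t. indicator {0<..} t *\<^sub>R (\<psi> t * of_real (t powr 0))) \<in> borel_measurable borel"
      using int[of 0] unfolding set_integrable_def by (auto dest: borel_measurable_integrable)
    also have "(\<lambda>t. indicator {0<..} t *\<^sub>R (\<psi> t * of_real (t powr 0))) = \<Psi>"
      by (auto simp: \<Psi>_def indicator_def)
    finally show ?thesis .
  qed
  define f where "f = (\<lambda>m t. \<Psi> t * of_real (ln t ^ m / fact m))"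
  have [measurable]: "f m \<in> borel_measurable borel" for m
    unfolding f_def by measurable
  have dom: "(\<Sum>m<K. norm (f m t * z ^ m)) \<le> norm (\<Psi> t) * t powr norm z + norm (\<Psi> t) * t powr (- norm z)"
    for z :: complex and K t
  proof (cases "t > 0")
    case True
    have "(\<Sum>m<K. norm (f m t * z ^ m)) = norm (\<Psi> t) * (\<Sum>m<K. \<bar>norm z * ln t\<bar> ^ m /\<^sub>R fact m)"
      by (simp add: f_def norm_mult norm_power norm_divide sum_distrib_left power_mult_distrib
           abs_mult power_abs field_simps)
    also have "\<dots> \<le> norm (\<Psi> t) * exp \<bar>norm z * ln t\<bar>"
    proof (intro mult_left_mono)
      have "summable (\<lambda>m. \<bar>norm z * ln t\<bar> ^ m /\<^sub>R fact m)"
        using exp_converges sums_iff by blast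
      hence "(\<Sum>m<K. \<bar>norm z * ln t\<bar> ^ m /\<^sub>R fact m) \<le> (\<Sum>m. \<bar>norm z * ln t\<bar> ^ m /\<^sub>R fact m)"
        by (intro sum_le_suminf) auto
      thus "(\<Sum>m<K. \<bar>norm z * ln t\<bar> ^ m /\<^sub>R fact m) \<le> exp \<bar>norm z * ln t\<bar>"
        using exp_converges[of "\<bar>norm z * ln t\<bar>"] by (simp add: sums_iff)
    qed simp
    also have "exp \<bar>norm z * ln t\<bar> \<le> t powr norm z + t powr (- norm z)"
      using True by (auto simp: powr_def abs_if)
    finally show ?thesis by (simp add: distrib_left mult_left_mono)
  qed (simp add: f_def \<Psi>_def)
  have domi: "integrable lborel (\<lambda>t. norm (\<Psi> t) * t powr norm z + norm (\<Psi> t) * t powr (- norm z))" for z :: complex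
    by (intro Bochner_Integration.integrable_add int')
  have fint: "integrable lborel (\<lambda>t. f m t * z ^ m)" for m z
  proof (rule Bochner_Integration.integrable_bound[OF domi[of z]])
    show "AE t in lborel. norm (f m t * z ^ m) \<le> norm (norm (\<Psi> t) * t powr norm z + norm (\<Psi> t) * t powr (- norm z))"
    proof (rule AE_I2)
      fix t
      have "norm (f m t * z ^ m) \<le> (\<Sum>m<Suc m. norm (f m t * z ^ m))"
        by (simp add: sum_nonneg)
      also note dom[of t z "Suc m"]
      finally show "norm (f m t * z ^ m) \<le> norm (norm (\<Psi> t) * t powr norm z + norm (\<Psi> t) * t powr (- norm z))"
        by simp
    qed
  qed measurable
  have fsums: "(\<lambda>m. f m t * z ^ m) sums (indicator {0<..} t *\<^sub>R (\<psi> t * of_real t powr z))" for t z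
  proof (cases "t > 0")
    case True
    have "(\<lambda>m. \<Psi> t * ((z * of_real (ln t)) ^ m /\<^sub>R fact m)) sums (\<Psi> t * exp (z * of_real (ln t)))"
      by (intro sums_mult exp_converges)
    thus ?thesis using True
      by (simp add: f_def powr_of_real_pos \<Psi>_def power_mult_distrib scaleR_conv_of_real field_simps)
  qed (simp add: f_def \<Psi>_def)
  have nsum: "summable (\<lambda>m. norm (f m t * z ^ m))" for t z
    by (rule summableI_nonneg_bounded[OF _ dom]) simp
  have isum: "summable (\<lambda>m. \<integral>t. norm (f m t * z ^ m) \<partial>lborel)" for z
  proof (rule summableI_nonneg_bounded)
    fix K
    have "(\<Sum>m<K. \<integral>t. norm (f m t * z ^ m) \<partial>lborel) = (\<integral>t. (\<Sum>m<K. norm (f m t * z ^ m)) \<partial>lborel)"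
      by (intro Bochner_Integration.integral_sum[symmetric] integrable_norm fint)
    also have "\<dots> \<le> (\<integral>t. norm (\<Psi> t) * t powr norm z + norm (\<Psi> t) * t powr (- norm z) \<partial>lborel)"
      by (intro integral_mono dom domi Bochner_Integration.integrable_sum integrable_norm fint)
    finally show "(\<Sum>m<K. \<integral>t. norm (f m t * z ^ m) \<partial>lborel)
        \<le> (\<integral>t. norm (\<Psi> t) * t powr norm z + norm (\<Psi> t) * t powr (- norm z) \<partial>lborel)" .
  qed simp
  have sums: "(\<lambda>m. (\<integral>t. f m t \<partial>lborel) * z ^ m) sums (LINT t:{0<..}|lborel. \<psi> t * of_real t powr z)" for z
  proof -
    have "(\<lambda>m. \<integral>t. f m t * z ^ m \<partial>lborel) sums (\<integral>t. (\<Sum>m. f m t * z ^ m) \<partial>lborel)"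
      by (intro sums_integral fint AE_I2 nsum isum)
    also have "(\<lambda>t. \<Sum>m. f m t * z ^ m) = (\<lambda>t. indicator {0<..} t *\<^sub>R (\<psi> t * of_real t powr z))"
      using fsums by (simp add: sums_iff)
    finally show ?thesis by (simp add: set_lebesgue_integral_def)
  qed
  show "set_integrable lborel {0<..} (\<lambda>t. \<psi> t * of_real t powr (s - 1))"
  proof -
    have "integrable lborel (\<lambda>t. \<Sum>m. f m t * (s - 1) ^ m)"
      by (intro integrable_suminf fint AE_I2 nsum isum)
    also have "(\<lambda>t. \<Sum>m. f m t * (s - 1) ^ m) = (\<lambda>t. indicator {0<..} t *\<^sub>R (\<psi> t * of_real t powr (s - 1)))"
      using fsums by (simp add: sums_iff)
    finally show ?thesis by (simp add: set_integrable_def)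
  qed
  have "(\<lambda>s. LINT t:{0<..}|lborel. \<psi> t * of_real t powr (s - 1)) holomorphic_on ball 1 R" for R
    by (rule power_series_holomorphic[OF sums])
  hence "(\<lambda>s. LINT t:{0<..}|lborel. \<psi> t * of_real t powr (s - 1)) holomorphic_on (\<Union>R. ball 1 R)"
    by (intro holomorphic_on_UN_open) auto
  also have "(\<Union>R::real. ball (1::complex) R) = UNIV"
    by (auto intro: gt_ex)
  finally show "(\<lambda>s. LINT t:{0<..}|lborel. \<psi> t * of_real t powr (s - 1)) holomorphic_on UNIV" .
qed

text \<open>
  The leading term at each end is removed only on its own side of \<open>1\<close>, so that the rest decays rapidly
  at both ends.
\<close>

definition mellin_kernel :: "(real \<Rightarrow> complex) \<Rightarrow> complex \<Rightarrow> complex \<Rightarrow> nat \<Rightarrow> real \<Rightarrow> complex" where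
  "mellin_kernel \<phi> \<alpha> B k t = (if t > 1 then \<phi> t - \<alpha> else \<phi> t - B / of_real t ^ k)"

text \<open>
  For \<open>Re s > k\<close> this is the Mellin transform of \<open>\<phi> - \<alpha>\<close>: the two fractions are the integrals of
  \<open>B t^(s-k-1)\<close> and of \<open>- \<alpha> t^(s-1)\<close> over \<open>(0, 1]\<close>.
\<close>

definition reg_mellin :: "(real \<Rightarrow> complex) \<Rightarrow> complex \<Rightarrow> complex \<Rightarrow> nat \<Rightarrow> complex \<Rightarrow> complex" where
  "reg_mellin \<phi> \<alpha> B k s =
     (LINT t:{0<..}|lborel. mellin_kernel \<phi> \<alpha> B k t * of_real t powr (s - 1)) + B / (s - of_nat k) - \<alpha> / s"

locale mellin_data =
  fixes \<phi> :: "real \<Rightarrow> complex" and \<alpha> B :: complex and k :: nat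
  assumes cont: "continuous_on {0<..} \<phi>"
    and at_infinity: "\<And>m::nat. \<exists>K. \<forall>t\<ge>1. norm (\<phi> t - \<alpha>) \<le> K / t ^ m"
    and at_zero: "\<And>m::nat. \<exists>K. \<forall>t. 0 < t \<and> t \<le> 1 \<longrightarrow> norm (\<phi> t - B / of_real t ^ k) \<le> K * t ^ m"
begin

lemma kernel_integrable:
  "set_integrable lborel {0<..} (\<lambda>t. mellin_kernel \<phi> \<alpha> B k t * of_real (t powr \<sigma>))"
proof -
  obtain m :: nat where m: "real m \<ge> \<bar>\<sigma>\<bar> + 2" using real_arch_simple by blast
  obtain K1 where K1: "\<And>t. t \<ge> 1 \<Longrightarrow> norm (\<phi> t - \<alpha>) \<le> K1 / t ^ m" using at_infinity[of m] by blast
  obtain K2 where K2: "\<And>t. 0 < t \<Longrightarrow> t \<le> 1 \<Longrightarrow> norm (\<phi> t - B / of_real t ^ k) \<le> K2 * t ^ m"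
    using at_zero[of m] by blast
  have i1: "set_integrable lborel {1<..} (\<lambda>t. (\<phi> t - \<alpha>) * of_real (t powr \<sigma>))"
  proof (rule set_integrable_bound)
    show "set_integrable lborel {1<..} (\<lambda>t. K1 * (1 / t ^ 2))"
      by (intro set_integrable_mult_right set_integrable_inverse_square)
    have "set_borel_measurable borel {1<..} (\<lambda>t. (\<phi> t - \<alpha>) * of_real (t powr \<sigma>))"
      by (rule set_measurable_continuous_on) (auto intro!: continuous_intros continuous_on_subset[OF cont])
    thus "set_borel_measurable lborel {1<..} (\<lambda>t. (\<phi> t - \<alpha>) * of_real (t powr \<sigma>))"
      by (simp add: set_borel_measurable_def)
    have "norm ((\<phi> t - \<alpha>) * of_real (t powr \<sigma>)) \<le> norm (K1 * (1 / t\<^sup>2))" if "t > 1" for t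
    proof -
      have K0: "K1 \<ge> 0" using order.trans[OF norm_ge_zero K1[of 1]] by simp
      have "norm ((\<phi> t - \<alpha>) * of_real (t powr \<sigma>)) \<le> K1 / t ^ m * t powr \<sigma>"
        using that K1[of t] unfolding norm_mult norm_of_real by (intro mult_mono) (use K0 in auto)
      also have "\<dots> = K1 * (t powr \<sigma> / t powr real m)" using that by (simp add: powr_realpow)
      also have "\<dots> = K1 * t powr (\<sigma> - real m)" using that by (simp add: powr_diff)
      also have "\<dots> \<le> K1 * t powr (-2)"
        using that m K0 by (intro mult_left_mono powr_mono) auto
      also have "t powr (-2) = 1 / t ^ 2" using that by (simp add: powr_minus powr_numeral divide_simps)
      finally show ?thesis using K0 by simp
    qed
    thus "AE t in lborel. t \<in> {1<..} \<longrightarrow> norm ((\<phi> t - \<alpha>) * of_real (t powr \<sigma>)) \<le> norm (K1 * (1 / t\<^sup>2))"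
      by auto
  qed
  have i2: "set_integrable lborel {0<..1} (\<lambda>t. (\<phi> t - B / of_real t ^ k) * of_real (t powr \<sigma>))"
  proof (rule set_integrable_bound)
    have "set_integrable lborel {0..1} (\<lambda>t::real. K2)"
      by (intro borel_integrable_atLeastAtMost' continuous_intros)
    thus "set_integrable lborel {0<..1} (\<lambda>t::real. K2)"
      by (rule set_integrable_subset) auto
    have "set_borel_measurable borel {0<..1} (\<lambda>t. (\<phi> t - B / of_real t ^ k) * of_real (t powr \<sigma>))"
      by (rule set_measurable_continuous_on) (auto intro!: continuous_intros continuous_on_subset[OF cont])
    thus "set_borel_measurable lborel {0<..1} (\<lambda>t. (\<phi> t - B / of_real t ^ k) * of_real (t powr \<sigma>))"
      by (simp add: set_borel_measurable_def)
    have "norm ((\<phi> t - B / of_real t ^ k) * of_real (t powr \<sigma>)) \<le> norm K2" if "0 < t" "t \<le> 1" for t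
    proof -
      have K0: "K2 \<ge> 0" using order.trans[OF norm_ge_zero K2[of 1]] by simp
      have "norm ((\<phi> t - B / of_real t ^ k) * of_real (t powr \<sigma>)) \<le> K2 * t ^ m * t powr \<sigma>"
        using that K2[of t] unfolding norm_mult norm_of_real by (intro mult_mono) (use K0 in auto)
      also have "\<dots> = K2 * t powr (real m + \<sigma>)" using that by (simp add: powr_realpow[symmetric] powr_add)
      also have "\<dots> \<le> K2 * 1"
        using that m K0 by (intro mult_left_mono powr_le1) auto
      finally show ?thesis using K0 by simp
    qed
    thus "AE t in lborel. t \<in> {0<..1} \<longrightarrow> norm ((\<phi> t - B / of_real t ^ k) * of_real (t powr \<sigma>)) \<le> norm K2"
      by auto
  qed
  have "set_integrable lborel ({0<..1} \<union> {1<..}) (\<lambda>t. mellin_kernel \<phi> \<alpha> B k t * of_real (t powr \<sigma>))"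
  proof (rule set_integrable_Un)
    show "set_integrable lborel {0<..1} (\<lambda>t. mellin_kernel \<phi> \<alpha> B k t * of_real (t powr \<sigma>))"
      by (rule set_integrable_cong[THEN iffD1, OF refl refl _ i2]) (auto simp: mellin_kernel_def)
    show "set_integrable lborel {1<..} (\<lambda>t. mellin_kernel \<phi> \<alpha> B k t * of_real (t powr \<sigma>))"
      by (rule set_integrable_cong[THEN iffD1, OF refl refl _ i1]) (auto simp: mellin_kernel_def)
  qed auto
  also have "{0<..1} \<union> {1<..} = {0 :: real<..}" by auto
  finally show ?thesis .
qed

lemmas kernel_integrable_complex = mellin_transform_entire(2)[OF kernel_integrable]

lemma reg_mellin_holomorphic: "reg_mellin \<phi> \<alpha> B k holomorphic_on - {0, of_nat k}"
proof -
  have "(\<lambda>s. LINT t:{0<..}|lborel. mellin_kernel \<phi> \<alpha> B k t * of_real t powr (s - 1)) holomorphic_on - {0, of_nat k}"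
    using mellin_transform_entire(1)[OF kernel_integrable] by (rule holomorphic_on_subset) simp
  thus ?thesis unfolding reg_mellin_def by (intro holomorphic_intros) auto
qed

lemma kernel_integral_split:
  "(LINT t:{0<..}|lborel. mellin_kernel \<phi> \<alpha> B k t * of_real t powr (s - 1)) =
   (LINT t:{0<..1}|lborel. (\<phi> t - B / of_real t ^ k) * of_real t powr (s - 1)) +
   (LINT t:{1<..}|lborel. (\<phi> t - \<alpha>) * of_real t powr (s - 1))"
  and kernel_integrable_zero:
  "set_integrable lborel {0<..1} (\<lambda>t. (\<phi> t - B / of_real t ^ k) * of_real t powr (s - 1))"
  and kernel_integrable_infinity:
  "set_integrable lborel {1<..} (\<lambda>t. (\<phi> t - \<alpha>) * of_real t powr (s - 1))"
proof -
  have i1: "set_integrable lborel {0<..1} (\<lambda>t. mellin_kernel \<phi> \<alpha> B k t * of_real t powr (s - 1))"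
    by (rule set_integrable_subset[OF kernel_integrable_complex]) auto
  have i2: "set_integrable lborel {1<..} (\<lambda>t. mellin_kernel \<phi> \<alpha> B k t * of_real t powr (s - 1))"
    by (rule set_integrable_subset[OF kernel_integrable_complex]) auto
  show "set_integrable lborel {0<..1} (\<lambda>t. (\<phi> t - B / of_real t ^ k) * of_real t powr (s - 1))"
    by (rule set_integrable_cong[THEN iffD1, OF refl refl _ i1]) (auto simp: mellin_kernel_def)
  show "set_integrable lborel {1<..} (\<lambda>t. (\<phi> t - \<alpha>) * of_real t powr (s - 1))"
    by (rule set_integrable_cong[THEN iffD1, OF refl refl _ i2]) (auto simp: mellin_kernel_def)
  have "(LINT t:{0<..1} \<union> {1<..}|lborel. mellin_kernel \<phi> \<alpha> B k t * of_real t powr (s - 1)) =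
     (LINT t:{0<..1}|lborel. mellin_kernel \<phi> \<alpha> B k t * of_real t powr (s - 1)) +
     (LINT t:{1<..}|lborel. mellin_kernel \<phi> \<alpha> B k t * of_real t powr (s - 1))"
    by (intro set_integral_Un i1 i2) auto
  also have "{0<..1} \<union> {1<..} = {0 :: real<..}" by auto
  also have "(LINT t:{0<..1}|lborel. mellin_kernel \<phi> \<alpha> B k t * of_real t powr (s - 1)) =
      (LINT t:{0<..1}|lborel. (\<phi> t - B / of_real t ^ k) * of_real t powr (s - 1))"
    by (intro set_lebesgue_integral_cong) (auto simp: mellin_kernel_def)
  also have "(LINT t:{1<..}|lborel. mellin_kernel \<phi> \<alpha> B k t * of_real t powr (s - 1)) =
      (LINT t:{1<..}|lborel. (\<phi> t - \<alpha>) * of_real t powr (s - 1))"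
    by (intro set_lebesgue_integral_cong) (auto simp: mellin_kernel_def)
  finally show "(LINT t:{0<..}|lborel. mellin_kernel \<phi> \<alpha> B k t * of_real t powr (s - 1)) =
   (LINT t:{0<..1}|lborel. (\<phi> t - B / of_real t ^ k) * of_real t powr (s - 1)) +
   (LINT t:{1<..}|lborel. (\<phi> t - \<alpha>) * of_real t powr (s - 1))" .
qed

end

lemma improper_FTC_at_top:
  fixes u h :: "real \<Rightarrow> complex"
  assumes int: "set_integrable lborel {1<..} h" and cont: "continuous_on {1..} h"
    and der: "\<And>t. t \<ge> 1 \<Longrightarrow> (u has_vector_derivative h t) (at t)"
  shows "(u \<longlongrightarrow> u 1 + (LINT t:{1<..}|lborel. h t)) at_top"
proof -
  define F where "F = (\<lambda>t. indicator {1<..} t *\<^sub>R h t)"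
  have F: "integrable lborel F"
    using int by (simp add: F_def set_integrable_def)
  have lim: "((\<lambda>T. \<integral>t. indicator {..T} t *\<^sub>R F t \<partial>lborel) \<longlongrightarrow> (\<integral>t. F t \<partial>lborel)) at_top"
    by (rule tendsto_integral_at_top[OF _ F]) simp
  have "(\<integral>t. indicator {..T} t *\<^sub>R F t \<partial>lborel) = u T - u 1" if "T \<ge> 1" for T
  proof -
    have "(\<integral>t. indicator {1..T} t *\<^sub>R h t \<partial>lborel) = u T - u 1"
      by (rule integral_FTC_atLeastAtMost[OF that])
         (auto intro: has_vector_derivative_at_within[OF der] continuous_on_subset[OF cont])
    moreover have "(\<integral>t. indicator {1..T} t *\<^sub>R h t \<partial>lborel) = (\<integral>t. indicator {..T} t *\<^sub>R F t \<partial>lborel)"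
    proof (rule integral_cong_AE)
      have "set_borel_measurable borel {1..T} h"
        by (rule set_measurable_continuous_on) (auto intro: continuous_on_subset[OF cont])
      thus "(\<lambda>t. indicator {1..T} t *\<^sub>R h t) \<in> borel_measurable lborel"
        by (simp add: set_borel_measurable_def)
      have [measurable]: "F \<in> borel_measurable borel"
        using F by (auto dest: borel_measurable_integrable)
      show "(\<lambda>t. indicator {..T} t *\<^sub>R F t) \<in> borel_measurable lborel" by measurable
      show "AE t in lborel. indicator {1..T} t *\<^sub>R h t = indicator {..T} t *\<^sub>R F t"
        using AE_lborel_singleton[of 1]
        by eventually_elim (auto simp: F_def indicator_def)
    qed
    ultimately show ?thesis by simp
  qed
  hence "\<forall>\<^sub>F T in at_top. u 1 + (\<integral>t. indicator {..T} t *\<^sub>R F t \<partial>lborel) = u T"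
    by (intro eventually_mono[OF eventually_ge_at_top[of "1 :: real"]]) simp
  from Lim_transform_eventually[OF tendsto_add[OF tendsto_const lim] this]
  show ?thesis by (simp add: F_def set_lebesgue_integral_def)
qed

lemma improper_FTC_at_right_0:
  fixes v h :: "real \<Rightarrow> complex"
  assumes int: "set_integrable lborel {0<..1} h" and cont: "continuous_on {0<..} h"
    and der: "\<And>t. t > 0 \<Longrightarrow> (v has_vector_derivative h t) (at t)"
  shows "(v \<longlongrightarrow> v 1 - (LINT t:{0<..1}|lborel. h t)) (at_right 0)"
proof -
  have lim: "((\<lambda>e. LINT t:{e..1}|lborel. h t) \<longlongrightarrow> (LINT t:{0<..1}|lborel. h t)) (at_right 0)"
    by (rule tendsto_set_lebesgue_integral_at_right[OF zero_less_one _ int]) simp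
  have "v 1 - (LINT t:{e..1}|lborel. h t) = v e" if "e > 0" "e < 1" for e
  proof -
    have "(\<integral>t. indicator {e..1} t *\<^sub>R h t \<partial>lborel) = v 1 - v e"
      using that by (intro integral_FTC_atLeastAtMost has_vector_derivative_at_within[OF der]
          continuous_on_subset[OF cont]) auto
    thus ?thesis by (simp add: set_lebesgue_integral_def)
  qed
  hence "\<forall>\<^sub>F e in at_right 0. v 1 - (LINT t:{e..1}|lborel. h t) = v e"
    by (intro eventually_mono[OF eventually_at_right_real[of 0 "1 :: real", OF zero_less_one]]) auto
  from Lim_transform_eventually[OF tendsto_diff[OF tendsto_const lim] this]
  show ?thesis .
qed

context mellin_data
begin

text \<open>
  At an integer \<open>j + 1\<close> strictly between \<open>0\<close> and \<open>k\<close> the regularised integral of \<open>\<phi> t^j\<close> is the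
  difference of the finite parts of a primitive at infinity and at \<open>0\<close>. On each side of \<open>1\<close> this is the
  fundamental theorem of calculus; the values at \<open>1\<close> of the two subtracted powers of \<open>t\<close> are the
  fractions in \<open>reg_mellin\<close>.
\<close>

lemma reg_mellin_eq_boundary_values:
  assumes j: "j + 2 \<le> k"
    and g: "\<And>t. t > 0 \<Longrightarrow> (g has_vector_derivative \<kappa> * \<phi> t * of_real t ^ j) (at t)"
  obtains U V where
    "((\<lambda>t. g t - \<kappa> * \<alpha> * of_real t ^ (j + 1) / of_nat (j + 1)) \<longlongrightarrow> U) at_top"
    "((\<lambda>t. g t + \<kappa> * B / (of_nat (k - 1 - j) * of_real t ^ (k - 1 - j))) \<longlongrightarrow> V) (at_right 0)"
    "\<kappa> * reg_mellin \<phi> \<alpha> B k (of_nat (j + 1)) = U - V"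
proof -
  define u where "u = (\<lambda>t. g t - \<kappa> * \<alpha> * of_real t ^ (j + 1) / of_nat (j + 1))"
  define v where "v = (\<lambda>t. g t + \<kappa> * B / (of_nat (k - 1 - j) * of_real t ^ (k - 1 - j)))"
  define I1 where "I1 = (LINT t:{1<..}|lborel. (\<phi> t - \<alpha>) * of_real t powr (of_nat (j + 1) - 1))"
  define I0 where "I0 = (LINT t:{0<..1}|lborel. (\<phi> t - B / of_real t ^ k) * of_real t powr (of_nat (j + 1) - 1))"
  have pw: "of_real t powr (of_nat (j + 1) - 1) = complex_of_real t ^ j" if "t > 0" for t
    using that by (simp add: powr_nat)
  have u': "(u has_vector_derivative \<kappa> * ((\<phi> t - \<alpha>) * of_real t ^ j)) (at t)" if "t > 0" for t
  proof -
    have "((\<lambda>t. complex_of_real t ^ (j + 1)) has_vector_derivative of_nat (j + 1) * of_real t ^ j) (at t)"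
      using DERIV_power[OF DERIV_ident, of "j + 1"]
      by (intro has_vector_derivative_real_field) (simp del: of_nat_add of_nat_Suc power_Suc)
    hence "((\<lambda>t. g t - \<kappa> * \<alpha> * complex_of_real t ^ (j + 1) / of_nat (j + 1)) has_vector_derivative
        \<kappa> * \<phi> t * of_real t ^ j - \<kappa> * \<alpha> * (of_nat (j + 1) * of_real t ^ j) / of_nat (j + 1)) (at t)"
      by (intro has_vector_derivative_diff g that has_vector_derivative_divide has_vector_derivative_mult_right)
    moreover have "\<kappa> * \<phi> t * of_real t ^ j - \<kappa> * \<alpha> * (of_nat (j + 1) * of_real t ^ j) / of_nat (j + 1)
        = \<kappa> * ((\<phi> t - \<alpha>) * of_real t ^ j)"
    proof -
      have *: "X * (of_nat (j + 1) * Y) / of_nat (j + 1) = X * Y" for X Y :: complex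
        by (simp del: of_nat_add of_nat_Suc)
      show ?thesis unfolding * by (simp only: left_diff_distrib right_diff_distrib mult.assoc)
    qed
    ultimately show ?thesis unfolding u_def by (simp only:)
  qed
  have v': "(v has_vector_derivative \<kappa> * ((\<phi> t - B / of_real t ^ k) * of_real t ^ j)) (at t)" if "t > 0" for t
  proof -
    define n where "n = k - 1 - j"
    have n: "k = n + 1 + j" "n > 0" using j by (auto simp: n_def)
    have "((\<lambda>t. 1 / complex_of_real t ^ n) has_vector_derivative - (of_nat n / of_real t ^ (n + 1))) (at t)"
    proof (rule has_vector_derivative_real_field)
      have "((\<lambda>z::complex. inverse (z ^ n)) has_field_derivative
          - (inverse (of_real t ^ n) * (of_nat n * (1 * of_real t ^ (n - Suc 0))) * inverse (of_real t ^ n)))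
          (at (of_real t))"
        using that by (intro DERIV_inverse' DERIV_power DERIV_ident) simp
      also have "inverse (of_real t ^ n) * (of_nat n * (1 * of_real t ^ (n - Suc 0))) * inverse (complex_of_real t ^ n)
          = of_nat n / of_real t ^ (n + 1)"
      proof -
        have "complex_of_real t ^ n = complex_of_real t ^ (n - Suc 0) * complex_of_real t"
          using n by (cases n) auto
        moreover have "inverse (T * z) * (c * (1 * T)) * inverse (T * z) = c / (T * z * z)"
          if "T \<noteq> 0" for c T z :: complex
          using that by (simp add: divide_simps)
        ultimately show ?thesis using that by (simp only: power_add power_one_right) simp
      qed
      finally show "((\<lambda>z::complex. 1 / z ^ n) has_field_derivative - (of_nat n / of_real t ^ (n + 1))) (at (of_real t))"
        by (simp only: inverse_eq_divide)
    qed
    hence "((\<lambda>t. g t + \<kappa> * B / of_nat n * (1 / complex_of_real t ^ n)) has_vector_derivative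
        \<kappa> * \<phi> t * of_real t ^ j + \<kappa> * B / of_nat n * (- (of_nat n / of_real t ^ (n + 1)))) (at t)"
      by (intro has_vector_derivative_add g that has_vector_derivative_mult_right)
    moreover have "\<kappa> * \<phi> t * of_real t ^ j + \<kappa> * B / of_nat n * (- (of_nat n / of_real t ^ (n + 1)))
        = \<kappa> * ((\<phi> t - B / of_real t ^ k) * of_real t ^ j)"
    proof -
      have "B / of_real t ^ k * of_real t ^ j = B / complex_of_real t ^ (n + 1)"
        using that unfolding n(1) by (simp add: power_add)
      moreover have "\<kappa> * B / of_nat n * (- (of_nat n / complex_of_real t ^ (n + 1))) = - (\<kappa> * (B / complex_of_real t ^ (n + 1)))"
        using n by simp
      ultimately show ?thesis by (simp only: left_diff_distrib right_diff_distrib mult.assoc add_uminus_conv_diff)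
    qed
    ultimately show ?thesis unfolding v_def n_def[symmetric] by simp
  qed
  define h1 where "h1 = (\<lambda>t. \<kappa> * ((\<phi> t - \<alpha>) * of_real t ^ j))"
  define h0 where "h0 = (\<lambda>t. \<kappa> * ((\<phi> t - B / of_real t ^ k) * of_real t ^ j))"
  have h1: "set_integrable lborel {1<..} h1" "(LINT t:{1<..}|lborel. h1 t) = \<kappa> * I1"
  proof -
    have int: "set_integrable lborel {1<..} (\<lambda>t. \<kappa> * ((\<phi> t - \<alpha>) * of_real t powr (of_nat (j + 1) - 1)))"
      by (rule set_integrable_mult_right) (rule kernel_integrable_infinity)
    have eq: "\<kappa> * ((\<phi> t - \<alpha>) * of_real t powr (of_nat (j + 1) - 1)) = h1 t" if "t \<in> {1<..}" for t
      using that unfolding h1_def by (subst pw) auto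
    show "set_integrable lborel {1<..} h1"
      by (rule set_integrable_cong[THEN iffD1, OF refl refl _ int]) (rule eq)
    show "(LINT t:{1<..}|lborel. h1 t) = \<kappa> * I1"
      unfolding I1_def set_integral_mult_right[symmetric]
      by (rule set_lebesgue_integral_cong) (simp, intro allI impI, erule eq[symmetric])
  qed
  have h0: "set_integrable lborel {0<..1} h0" "(LINT t:{0<..1}|lborel. h0 t) = \<kappa> * I0"
  proof -
    have int: "set_integrable lborel {0<..1} (\<lambda>t. \<kappa> * ((\<phi> t - B / of_real t ^ k) * of_real t powr (of_nat (j + 1) - 1)))"
      by (rule set_integrable_mult_right) (rule kernel_integrable_zero)
    have eq: "\<kappa> * ((\<phi> t - B / of_real t ^ k) * of_real t powr (of_nat (j + 1) - 1)) = h0 t" if "t \<in> {0<..1}" for t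
      using that unfolding h0_def by (subst pw) auto
    show "set_integrable lborel {0<..1} h0"
      by (rule set_integrable_cong[THEN iffD1, OF refl refl _ int]) (rule eq)
    show "(LINT t:{0<..1}|lborel. h0 t) = \<kappa> * I0"
      unfolding I0_def set_integral_mult_right[symmetric]
      by (rule set_lebesgue_integral_cong) (simp, intro allI impI, erule eq[symmetric])
  qed
  have lim1: "(u \<longlongrightarrow> u 1 + \<kappa> * I1) at_top"
    unfolding h1(2)[symmetric]
  proof (rule improper_FTC_at_top[OF h1(1)])
    show "continuous_on {1..} h1"
      unfolding h1_def by (intro continuous_intros continuous_on_subset[OF cont]) auto
    show "(u has_vector_derivative h1 t) (at t)" if "t \<ge> 1" for t
      unfolding h1_def using that by (intro u') simp
  qed
  have lim0: "(v \<longlongrightarrow> v 1 - \<kappa> * I0) (at_right 0)"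
    unfolding h0(2)[symmetric]
  proof (rule improper_FTC_at_right_0[OF h0(1)])
    show "continuous_on {0<..} h0"
      unfolding h0_def by (intro continuous_intros continuous_on_subset[OF cont]) auto
    show "(v has_vector_derivative h0 t) (at t)" if "t > 0" for t
      unfolding h0_def using that by (rule v')
  qed
  have u1: "u 1 = g 1 - \<kappa> * (\<alpha> / of_nat (j + 1))"
    unfolding u_def of_real_1 power_one by simp
  have v1: "v 1 = g 1 + \<kappa> * (B / of_nat (k - 1 - j))"
    unfolding v_def of_real_1 power_one by simp
  have diff: "of_nat (j + 1) - of_nat k = - (of_nat (k - 1 - j) :: complex)"
  proof -
    have "k = (k - 1 - j) + (j + 1)" using j by simp
    hence "(of_nat k :: complex) = of_nat (k - 1 - j) + of_nat (j + 1)"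
      by (metis of_nat_add)
    thus ?thesis by (simp only: minus_add_distrib diff_add_eq_diff_diff_swap diff_self diff_0)
  qed
  have alg: "\<kappa> * (I0 + I1 + - X - Y) = (G - \<kappa> * Y + \<kappa> * I1) - (G + \<kappa> * X - \<kappa> * I0)" for X Y G
    by (simp add: algebra_simps)
  have "\<kappa> * reg_mellin \<phi> \<alpha> B k (of_nat (j + 1)) = (u 1 + \<kappa> * I1) - (v 1 - \<kappa> * I0)"
    unfolding reg_mellin_def kernel_integral_split I0_def[symmetric] I1_def[symmetric]
      diff divide_minus_right u1 v1 by (rule alg)
  thus ?thesis by (rule that[folded u_def v_def, OF lim1 lim0])
qed

end

lemma powr_integral_0_1:
  fixes s :: complex
  assumes s: "Re s > 0"
  shows "set_integrable lborel {0<..1} (\<lambda>t. of_real t powr (s - 1))"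
    and "(LINT t:{0<..1}|lborel. of_real t powr (s - 1)) = 1 / s"
proof -
  have meas: "set_borel_measurable borel {0<..1} (\<lambda>t. complex_of_real t powr (s - 1))"
    by (rule set_measurable_continuous_on) (auto intro!: continuous_intros simp: complex_nonpos_Reals_iff)
  have "(\<lambda>t. complex_of_real t powr (s - 1) / of_real (exp t)) absolutely_integrable_on {0<..}"
    by (rule absolutely_integrable_Gamma_integral'[OF s])
  hence "set_integrable lebesgue {0<..1} (\<lambda>t. complex_of_real t powr (s - 1) / of_real (exp t))"
    by (rule set_integrable_subset) auto
  moreover have "set_borel_measurable borel {0<..1} (\<lambda>t. complex_of_real t powr (s - 1) / of_real (exp t))"
    by (rule set_measurable_continuous_on) (auto intro!: continuous_intros simp: complex_nonpos_Reals_iff)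
  ultimately have "set_integrable lborel {0<..1} (\<lambda>t. complex_of_real t powr (s - 1) / of_real (exp t))"
    by (rule set_integrable_lborelI)
  hence "set_integrable lborel {0<..1} (\<lambda>t. of_real (exp 1) * (complex_of_real t powr (s - 1) / of_real (exp t)))"
    by (rule set_integrable_mult_right)
  thus int: "set_integrable lborel {0<..1} (\<lambda>t. complex_of_real t powr (s - 1))"
  proof (rule set_integrable_bound)
    show "set_borel_measurable lborel {0<..1} (\<lambda>t. complex_of_real t powr (s - 1))"
      using meas by (simp add: set_borel_measurable_def)
    have "norm (complex_of_real t powr (s - 1))
       \<le> norm (of_real (exp 1) * (complex_of_real t powr (s - 1) / of_real (exp t)))" if "t \<in> {0<..1}" for t :: real
    proof -
      have "norm (complex_of_real t powr (s - 1)) * exp t \<le> norm (complex_of_real t powr (s - 1)) * exp 1"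
        using that by (intro mult_left_mono) auto
      thus ?thesis by (simp add: norm_mult norm_divide field_simps)
    qed
    thus "AE t in lborel. t \<in> {0<..1} \<longrightarrow> norm (complex_of_real t powr (s - 1))
       \<le> norm (of_real (exp 1) * (complex_of_real t powr (s - 1) / of_real (exp t)))" by auto
  qed
  define v where "v = (\<lambda>t::real. of_real t powr s / s)"
  have "s \<noteq> 0" using s by auto
  have "(v \<longlongrightarrow> v 1 - (LINT t:{0<..1}|lborel. of_real t powr (s - 1))) (at_right 0)"
  proof (rule improper_FTC_at_right_0[OF int])
    show "continuous_on {0<..} (\<lambda>t. complex_of_real t powr (s - 1))"
      by (auto intro!: continuous_intros simp: complex_nonpos_Reals_iff)
    fix t :: real assume t: "t > 0"
    have "((\<lambda>z. z powr s / s) has_field_derivative (s * of_real t powr (s - 1)) / s) (at (of_real t))"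
      using t by (intro DERIV_cdivide has_field_derivative_powr) (simp add: complex_nonpos_Reals_iff)
    thus "(v has_vector_derivative of_real t powr (s - 1)) (at t)"
      unfolding v_def using \<open>s \<noteq> 0\<close> by (intro has_vector_derivative_real_field) simp
  qed
  moreover have "(v \<longlongrightarrow> 0) (at_right 0)"
  proof (rule tendsto_norm_zero_cancel)
    have "((\<lambda>t. t powr Re s / norm s) \<longlongrightarrow> 0 powr Re s / norm s) (at_right 0)"
      using s \<open>s \<noteq> 0\<close>
      by (intro tendsto_divide tendsto_powr' tendsto_const tendsto_ident_at)
         (auto simp: eventually_at_right_less intro: eventually_mono[OF eventually_at_right_less])
    moreover have "\<forall>\<^sub>F t in at_right 0. t powr Re s / norm s = norm (v t)"
      using eventually_at_right_less[of 0]
      by eventually_elim (simp add: v_def norm_divide norm_powr_of_real_pos)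
    ultimately have "((\<lambda>t. norm (v t)) \<longlongrightarrow> 0 powr Re s / norm s) (at_right 0)"
      by (rule Lim_transform_eventually)
    thus "((\<lambda>t. norm (v t)) \<longlongrightarrow> 0) (at_right 0)" using s by simp
  qed
  ultimately have "v 1 - (LINT t:{0<..1}|lborel. of_real t powr (s - 1)) = 0"
    using tendsto_unique trivial_limit_at_right_real by blast
  thus "(LINT t:{0<..1}|lborel. of_real t powr (s - 1)) = 1 / s" by (simp add: v_def)
qed

text \<open>
  The substitution \<open>t \<mapsto> a t\<close> in Euler's integral for the Gamma function.
\<close>

lemma Gamma_integral_scaled:
  fixes s :: complex and a :: real
  assumes s: "Re s > 0" and a: "a > 0"
  shows "set_integrable lborel {0<..} (\<lambda>t. of_real t powr (s - 1) * of_real (exp (- a * t)))"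
    and "(LINT t:{0<..}|lborel. of_real t powr (s - 1) * of_real (exp (- a * t))) = Gamma s / of_real a powr s"
proof -
  have cont: "continuous_on {0<..} (\<lambda>t. complex_of_real t powr (s - 1) * of_real (exp (- a * t)))" for a :: real
    by (auto intro!: continuous_intros simp: complex_nonpos_Reals_iff)
  have meas: "set_borel_measurable borel {0<..} (\<lambda>t. complex_of_real t powr (s - 1) * of_real (exp (- a * t)))" for a :: real
    by (rule set_measurable_continuous_on[OF _ cont]) auto
  have int_lebesgue: "set_integrable lebesgue {0<..} (\<lambda>t. complex_of_real t powr (s - 1) * of_real (exp (- a * t)))"
    if "a > 0" for a
    using absolutely_integrable_Gamma_integral[OF s that] by (simp add: exp_minus divide_inverse)
  show "set_integrable lborel {0<..} (\<lambda>t. of_real t powr (s - 1) * of_real (exp (- a * t)))"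
    by (rule set_integrable_lborelI[OF int_lebesgue[OF a] meas])
  define f where "f = (\<lambda>t. indicator {0<..} t *\<^sub>R (complex_of_real t powr (s - 1) * of_real (exp (- 1 * t))))"
  have "(\<integral>t. f t \<partial>lborel) = (LINT t:{0<..}|lebesgue. of_real t powr (s - 1) * of_real (exp (- 1 * t)))"
    unfolding set_lebesgue_integral_def f_def using meas[of 1]
    by (intro integral_completion[symmetric]) (simp add: set_borel_measurable_def)
  also have "\<dots> = integral {0<..} (\<lambda>t. of_real t powr (s - 1) * of_real (exp (- 1 * t)))"
    by (rule set_lebesgue_integral_eq_integral(2)[OF int_lebesgue]) simp
  also have "\<dots> = Gamma s"
    using integral_unique[OF Gamma_integral_complex'[OF s]] by (simp add: exp_minus divide_inverse)
  finally have "Gamma s = (\<integral>t. f t \<partial>lborel)" by simp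
  also have "\<dots> = a *\<^sub>R (\<integral>t. f (0 + a * t) \<partial>lborel)"
    using a lborel_integral_real_affine[of a f 0] by simp
  also have "(\<integral>t. f (0 + a * t) \<partial>lborel) = (\<integral>t. of_real a powr (s - 1) *
      (indicator {0<..} t *\<^sub>R (complex_of_real t powr (s - 1) * of_real (exp (- a * t)))) \<partial>lborel)"
  proof (rule Bochner_Integration.integral_cong[OF refl])
    fix t
    show "f (0 + a * t) = of_real a powr (s - 1) *
      (indicator {0<..} t *\<^sub>R (complex_of_real t powr (s - 1) * of_real (exp (- a * t))))"
    proof (cases "t > 0")
      case True
      hence "complex_of_real (a * t) powr (s - 1) = of_real a powr (s - 1) * of_real t powr (s - 1)"
        using a by (simp add: powr_times_real)
      thus ?thesis using True a by (simp add: f_def)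
    next
      case False
      hence "\<not> a * t > 0" using a by (simp add: zero_less_mult_iff)
      thus ?thesis using False by (simp add: f_def)
    qed
  qed
  also have "\<dots> = of_real a powr (s - 1) *
      (LINT t:{0<..}|lborel. of_real t powr (s - 1) * of_real (exp (- a * t)))"
    unfolding set_lebesgue_integral_def by (rule integral_mult_right_zero)
  also have "a *\<^sub>R \<dots> = of_real a powr s * (LINT t:{0<..}|lborel. of_real t powr (s - 1) * of_real (exp (- a * t)))"
  proof -
    have "of_real a powr s = of_real a powr (s - 1) * (of_real a :: complex)"
      using a powr_add[of "of_real a" "s - 1" 1] by simp
    thus ?thesis by (simp add: scaleR_conv_of_real mult_ac)
  qed
  finally show "(LINT t:{0<..}|lborel. of_real t powr (s - 1) * of_real (exp (- a * t))) = Gamma s / of_real a powr s"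
    using a by simp
qed

lemma norm_Gamma_integral_scaled:
  fixes s :: complex and a :: real
  assumes s: "Re s > 0" and a: "a > 0"
  shows "(\<integral>t. norm (indicator {0<..} t *\<^sub>R (complex_of_real t powr (s - 1) * of_real (exp (- a * t)))) \<partial>lborel)
         = Gamma (Re s) / a powr Re s"
proof -
  have "complex_of_real (\<integral>t. norm (indicator {0<..} t *\<^sub>R (complex_of_real t powr (s - 1) * of_real (exp (- a * t)))) \<partial>lborel)
    = (\<integral>t. complex_of_real (norm (indicator {0<..} t *\<^sub>R (complex_of_real t powr (s - 1) * of_real (exp (- a * t))))) \<partial>lborel)"
    by (rule integral_complex_of_real[symmetric])
  also have "\<dots> = (LINT t:{0<..}|lborel. of_real t powr (of_real (Re s) - 1) * of_real (exp (- a * t)))"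
    unfolding set_lebesgue_integral_def
  proof (rule Bochner_Integration.integral_cong[OF refl])
    fix t
    show "complex_of_real (norm (indicator {0<..} t *\<^sub>R (complex_of_real t powr (s - 1) * of_real (exp (- a * t))))) =
       indicator {0<..} t *\<^sub>R (of_real t powr (of_real (Re s) - 1) * of_real (exp (- a * t)))"
      by (cases "t > 0") (auto simp: norm_mult norm_powr_of_real_pos powr_def Ln_of_real simp flip: exp_of_real)
  qed
  also have "\<dots> = Gamma (of_real (Re s)) / of_real a powr of_real (Re s)"
    using s a by (intro Gamma_integral_scaled(2)) auto
  also have "\<dots> = of_real (Gamma (Re s) / a powr Re s)"
    using a by (simp add: Gamma_complex_of_real powr_of_real)
  finally show ?thesis unfolding of_real_eq_iff .
qed

text \<open>
  Termwise integration against Euler's integral. The exchange is allowed because the integrals of the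
  absolute values of the terms are proportional to the absolute values of the terms of the Dirichlet
  series.
\<close>

lemma mellin_transform_dirichlet_series:
  fixes s :: complex and l :: real and c :: "nat \<Rightarrow> complex"
  assumes l: "l > 0" and s: "Re s > 0"
    and sums: "\<And>t. t > 0 \<Longrightarrow> (\<lambda>n. c n * of_real (exp (- (l * real (Suc n)) * t))) sums h t"
    and smm: "\<And>t. t > 0 \<Longrightarrow> summable (\<lambda>n. norm (c n) * exp (- (l * real (Suc n)) * t))"
    and dir: "summable (\<lambda>n. norm (c n) / real (Suc n) powr Re s)"
  shows "set_integrable lborel {0<..} (\<lambda>t. h t * of_real t powr (s - 1))"
    and "(LINT t:{0<..}|lborel. h t * of_real t powr (s - 1))
         = Gamma s / of_real l powr s * (\<Sum>n. c n / of_nat (Suc n) powr s)"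
proof -
  define f where "f = (\<lambda>n t. c n * (indicator {0<..} t *\<^sub>R
       (complex_of_real t powr (s - 1) * of_real (exp (- (l * real (Suc n)) * t)))))"
  have pos: "l * real (Suc n) > 0" for n using l by simp
  have int: "integrable lborel (f n)" for n
    unfolding f_def using Gamma_integral_scaled(1)[OF s pos[of n]]
    by (intro integrable_mult_right) (simp add: set_integrable_def)
  have "(\<integral>t. norm (f n t) \<partial>lborel) = norm (c n) * (Gamma (Re s) / (l * real (Suc n)) powr Re s)" for n
    unfolding f_def norm_mult[of "c n"] using norm_Gamma_integral_scaled[OF s pos[of n]] by simp
  also have "\<dots> n = Gamma (Re s) / l powr Re s * (norm (c n) / real (Suc n) powr Re s)" for n
    using l by (simp add: powr_mult)
  finally have smi: "summable (\<lambda>n. \<integral>t. norm (f n t) \<partial>lborel)"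
    by (simp only:) (intro summable_mult dir)
  have fsums: "(\<lambda>n. f n t) sums (indicator {0<..} t *\<^sub>R (h t * of_real t powr (s - 1)))" for t
  proof (cases "t > 0")
    case True
    from sums_mult[OF sums[OF this], of "of_real t powr (s - 1)"] True
    show ?thesis by (simp add: f_def mult_ac)
  qed (simp add: f_def)
  have smn: "summable (\<lambda>n. norm (f n t))" for t
  proof (cases "t > 0")
    case True
    from summable_mult[OF smm[OF this], of "norm (of_real t powr (s - 1))"] True
    show ?thesis by (simp add: f_def norm_mult mult_ac)
  qed (simp add: f_def)
  have eq: "(\<lambda>t. \<Sum>n. f n t) = (\<lambda>t. indicator {0<..} t *\<^sub>R (h t * of_real t powr (s - 1)))"
    using fsums by (simp add: sums_iff)
  have "integrable lborel (\<lambda>t. \<Sum>n. f n t)"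
    by (intro integrable_suminf int AE_I2 smn smi)
  thus "set_integrable lborel {0<..} (\<lambda>t. h t * of_real t powr (s - 1))"
    by (simp add: eq set_integrable_def)
  have "(\<lambda>n. \<integral>t. f n t \<partial>lborel) sums (\<integral>t. (\<Sum>n. f n t) \<partial>lborel)"
    by (intro sums_integral int AE_I2 smn smi)
  also have "(\<lambda>n. \<integral>t. f n t \<partial>lborel) = (\<lambda>n. Gamma s / of_real l powr s * (c n / of_nat (Suc n) powr s))"
  proof
    fix n
    have "(\<integral>t. f n t \<partial>lborel) = c n * (Gamma s / of_real (l * real (Suc n)) powr s)"
      using Gamma_integral_scaled(2)[OF s pos[of n]]
      unfolding f_def set_lebesgue_integral_def by (subst integral_mult_right_zero) simp
    also have "complex_of_real (l * real (Suc n)) powr s = of_real l powr s * of_nat (Suc n) powr s"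
      using l by (subst of_real_mult, subst powr_times_real) auto
    finally show "(\<integral>t. f n t \<partial>lborel) = Gamma s / of_real l powr s * (c n / of_nat (Suc n) powr s)"
      by simp
  qed
  finally have S: "(\<lambda>n. Gamma s / of_real l powr s * (c n / of_nat (Suc n) powr s)) sums
      (LINT t:{0<..}|lborel. h t * of_real t powr (s - 1))"
    by (simp add: eq set_lebesgue_integral_def)
  have "summable (\<lambda>n. norm (c n / of_nat (Suc n) powr s))"
    using dir by (simp add: norm_divide norm_powr_real_powr del: of_nat_Suc)
  hence "summable (\<lambda>n. c n / of_nat (Suc n) powr s)" by (rule summable_norm_cancel)
  from sums_unique[OF S] suminf_mult[OF this, of "Gamma s / of_real l powr s"]
  show "(LINT t:{0<..}|lborel. h t * of_real t powr (s - 1))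
         = Gamma s / of_real l powr s * (\<Sum>n. c n / of_nat (Suc n) powr s)" by simp
qed

text \<open>
  Where the Dirichlet series converges, each piece of the regularised transform converges separately and
  the splitting at \<open>1\<close> can be undone.
\<close>

lemma (in mellin_data) reg_mellin_eq_dirichlet_series:
  fixes s :: complex and l :: real and c :: "nat \<Rightarrow> complex"
  assumes l: "l > 0" and s: "Re s > real k"
    and sums: "\<And>t. t > 0 \<Longrightarrow> (\<lambda>n. c n * of_real (exp (- (l * real (Suc n)) * t))) sums (\<phi> t - \<alpha>)"
    and smm: "\<And>t. t > 0 \<Longrightarrow> summable (\<lambda>n. norm (c n) * exp (- (l * real (Suc n)) * t))"
    and dir: "summable (\<lambda>n. norm (c n) / real (Suc n) powr Re s)"
  shows "reg_mellin \<phi> \<alpha> B k s = Gamma s / of_real l powr s * (\<Sum>n. c n / of_nat (Suc n) powr s)"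
proof -
  have s0: "Re s > 0" using s by (rule le_less_trans[rotated]) simp
  have sk: "Re (s - of_nat k) > 0" using s by simp
  note M = mellin_transform_dirichlet_series[OF l s0 sums smm dir]
  let ?e = "\<lambda>t. complex_of_real t powr (s - 1)"
  have i0: "set_integrable lborel {0<..1} (\<lambda>t. (\<phi> t - \<alpha>) * ?e t)"
    by (rule set_integrable_subset[OF M(1)]) auto
  have i1: "set_integrable lborel {1<..} (\<lambda>t. (\<phi> t - \<alpha>) * ?e t)"
    by (rule set_integrable_subset[OF M(1)]) auto
  have pw: "?e t / of_real t ^ k = complex_of_real t powr (s - of_nat k - 1)" if "t > 0" for t
  proof -
    have "complex_of_real t powr (s - 1 - of_nat k) = ?e t / of_real t powr of_nat k"
      by (rule powr_diff)
    thus ?thesis using that by (simp add: powr_nat algebra_simps)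
  qed
  have "(LINT t:{0<..1}|lborel. (\<phi> t - B / of_real t ^ k) * ?e t) =
        (LINT t:{0<..1}|lborel. ((\<phi> t - \<alpha>) * ?e t + \<alpha> * ?e t) - B * (of_real t powr (s - of_nat k - 1)))"
  proof (rule set_lebesgue_integral_cong)
    show "\<forall>t. t \<in> {0<..1} \<longrightarrow> (\<phi> t - B / of_real t ^ k) * ?e t =
       ((\<phi> t - \<alpha>) * ?e t + \<alpha> * ?e t) - B * (of_real t powr (s - of_nat k - 1))"
      by (intro allI impI, subst pw[symmetric]) (auto simp: algebra_simps)
  qed simp
  also have "\<dots> = (LINT t:{0<..1}|lborel. (\<phi> t - \<alpha>) * ?e t) + \<alpha> * (1 / s) - B * (1 / (s - of_nat k))"
    using i0 powr_integral_0_1[OF s0] powr_integral_0_1[OF sk]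
    by (subst set_integral_diff set_integral_add; simp)+
  finally have A: "(LINT t:{0<..1}|lborel. (\<phi> t - B / of_real t ^ k) * ?e t)
     = (LINT t:{0<..1}|lborel. (\<phi> t - \<alpha>) * ?e t) + \<alpha> * (1 / s) - B * (1 / (s - of_nat k))" .
  have "(LINT t:{0<..1} \<union> {1<..}|lborel. (\<phi> t - \<alpha>) * ?e t) =
     (LINT t:{0<..1}|lborel. (\<phi> t - \<alpha>) * ?e t) + (LINT t:{1<..}|lborel. (\<phi> t - \<alpha>) * ?e t)"
    by (intro set_integral_Un i0 i1) auto
  also have "{0<..1} \<union> {1<..} = {0 :: real<..}" by auto
  finally have "reg_mellin \<phi> \<alpha> B k s = (LINT t:{0<..}|lborel. (\<phi> t - \<alpha>) * ?e t)"
    unfolding reg_mellin_def kernel_integral_split A by simp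
  thus ?thesis using M(2) by simp
qed

section \<open>Growth of the Fourier coefficients\<close>

locale modular_form_level =
  fixes k N :: nat and \<Gamma> :: "(int ^ 2 ^ 2) set" and f :: "complex \<Rightarrow> complex"
  assumes weight: "k \<ge> 2" and \<Gamma>: "congruence_subgroup \<Gamma>" and modular: "modular_form k \<Gamma> f"
    and N: "N \<ge> 1" and level: "principal_subgroup N \<subseteq> \<Gamma>"
begin

lemma Gamma_SL2Z: "A \<in> \<Gamma> \<Longrightarrow> A \<in> carrier SL2Z"
  using \<Gamma> by (auto simp: congruence_subgroup_def dest: subgroup.mem_carrier)

lemma holomorphic: "f holomorphic_on {\<tau>. Im \<tau> > 0}"
  using modular by (simp add: modular_form_def)

lemma transformation:
  assumes "A \<in> \<Gamma>" "Im \<tau> > 0"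
  shows "f (moebius_act A \<tau>) = den A \<tau> ^ k * f \<tau>"
proof -
  have "slash k f A \<tau> = f \<tau>" using modular assms by (simp add: modular_form_def)
  thus ?thesis using den_nonzero[OF Gamma_SL2Z[OF assms(1)] assms(2)] by (auto simp: slash_eq field_simps)
qed

lemma slash_expansion:
  assumes "A \<in> carrier SL2Z"
  obtains M a where "M \<ge> 1" "fourier_expansion M (slash k f A) a"
  using modular assms unfolding modular_form_def by blast

lemma slash_invariant:
  assumes "C \<in> \<Gamma>" "B \<in> carrier SL2Z" "Im \<tau> > 0"
  shows "slash k f (C ** B) \<tau> = slash k f B \<tau>"
proof -
  have "slash k f C (moebius_act B \<tau>) = f (moebius_act B \<tau>)"
    using modular assms(1) Im_moebius_pos[OF assms(2,3)] by (simp add: modular_form_def)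
  thus ?thesis
    by (simp only: slash_mult[OF Gamma_SL2Z[OF assms(1)] assms(2,3)] slash_eq[of k f B])
qed

lemma translation_in_Gamma: "mat2 1 (int N) 0 1 \<in> \<Gamma>"
proof -
  have "mat2 1 (int N) 0 1 \<in> principal_subgroup N"
    by (auto simp: principal_subgroup_def SL2Z_carrier_iff forall_2 mat_def cong_def)
  thus ?thesis using level by blast
qed

lemma periodic:
  assumes "Im \<tau> > 0"
  shows "f (\<tau> + of_nat N) = f \<tau>"
  using transformation[OF translation_in_Gamma assms] by (simp add: moebius_act_def den_def)

lemma expansion: "fourier_expansion N f (fourier_coeff N f)"
proof -
  have "mat 1 \<in> carrier SL2Z" by (simp add: SL2Z_carrier_iff mat_def)
  then obtain M a where "M \<ge> 1" "fourier_expansion M (slash k f (mat 1)) a"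
    by (rule slash_expansion)
  moreover have "slash k f (mat 1) = f" by (simp add: fun_eq_iff slash_def mat_def)
  ultimately obtain b where "fourier_expansion N f b"
    using fourier_expansion_change_period[of M f a N] N periodic by auto
  thus ?thesis using fourier_coeff_eqI[OF _ N] by metis
qed

lemma slash_cong_mod:
  assumes A: "A \<in> carrier SL2Z" and B: "B \<in> carrier SL2Z" and "Im \<tau> > 0"
    and cong: "\<And>i j. [A $ i $ j = B $ i $ j] (mod int N)"
  shows "slash k f A \<tau> = slash k f B \<tau>"
proof -
  define B' where "B' = mat2 (B $ 2 $ 2) (- (B $ 1 $ 2)) (- (B $ 2 $ 1)) (B $ 1 $ 1)"
  note adj = SL2Z_adjugate[OF B, folded B'_def]
  have "[(A ** B') $ i $ j = (B ** B') $ i $ j] (mod int N)" for i j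
    unfolding mult2_nth by (intro cong_add cong_mult cong cong_refl)
  hence "A ** B' \<in> principal_subgroup N"
    using SL2Z_mult[OF A adj(1)] by (simp add: principal_subgroup_def adj(2))
  hence "A ** B' \<in> \<Gamma>" using level by blast
  from slash_invariant[OF this B assms(3)] show ?thesis
    by (simp add: adj(3) flip: matrix_mul_assoc)
qed

text \<open>
  The function \<open>slash k f A\<close> depends only on \<open>A\<close> modulo \<open>N\<close>, so that finitely many Fourier expansions
  bound all of them.
\<close>

lemma slash_uniformly_bounded:
  assumes h: "h > 0"
  obtains C where "C \<ge> 0" "\<And>A \<tau>. A \<in> carrier SL2Z \<Longrightarrow> Im \<tau> \<ge> h \<Longrightarrow> norm (slash k f A \<tau>) \<le> C"
proof -
  have "\<exists>C. \<forall>\<tau>. Im \<tau> \<ge> h \<longrightarrow> norm (slash k f A \<tau>) \<le> C" if A: "A \<in> carrier SL2Z" for A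
  proof -
    obtain M a where "M \<ge> 1" "fourier_expansion M (slash k f A) a" by (rule slash_expansion[OF A])
    thus ?thesis using fourier_expansion_bounded h by metis
  qed
  then obtain C where C: "\<And>A \<tau>. A \<in> carrier SL2Z \<Longrightarrow> Im \<tau> \<ge> h \<Longrightarrow> norm (slash k f A \<tau>) \<le> C A"
    by metis
  define key where "key = (\<lambda>A :: int ^ 2 ^ 2. (A $ 1 $ 1 mod N, A $ 1 $ 2 mod N, A $ 2 $ 1 mod N, A $ 2 $ 2 mod N))"
  define rep where "rep = (\<lambda>q. SOME A. A \<in> carrier SL2Z \<and> key A = q)"
  define D where "D = (\<Sum>q\<in>key ` carrier SL2Z. \<bar>C (rep q)\<bar>)"
  have "key ` carrier SL2Z \<subseteq> {0..<int N} \<times> {0..<int N} \<times> {0..<int N} \<times> {0..<int N}"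
    using N by (auto simp: key_def)
  hence fin: "finite (key ` carrier SL2Z)" by (rule finite_subset) auto
  have "norm (slash k f A \<tau>) \<le> D" if A: "A \<in> carrier SL2Z" and \<tau>: "Im \<tau> \<ge> h" for A \<tau>
  proof -
    have rep: "rep (key A) \<in> carrier SL2Z \<and> key (rep (key A)) = key A"
      unfolding rep_def by (rule someI) (use A in auto)
    hence cong: "[A $ i $ j = rep (key A) $ i $ j] (mod int N)" for i j
      using exhaust_2[of i] exhaust_2[of j] by (auto simp: key_def cong_def)
    have "norm (slash k f A \<tau>) = norm (slash k f (rep (key A)) \<tau>)"
      using slash_cong_mod[OF A _ _ cong] rep \<tau> h by simp
    also have "\<dots> \<le> \<bar>C (rep (key A))\<bar>" using C[of "rep (key A)" \<tau>] rep \<tau> by linarith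
    also have "\<dots> \<le> D" unfolding D_def by (rule member_le_sum) (use A fin in auto)
    finally show ?thesis .
  qed
  moreover have "D \<ge> 0" unfolding D_def by (intro sum_nonneg) auto
  ultimately show ?thesis using that by blast
qed

text \<open>
  Dirichlet's theorem gives a fraction \<open>- d / c\<close> so close to \<open>x\<close> that a matrix which sends it to infinity
  lifts \<open>x + \<i> / Q\<^sup>2\<close> to height at least \<open>1 / 2\<close>. There all \<open>slash k f A\<close> are bounded, and the
  factor of automorphy is all that remains.
\<close>

lemma norm_le_at_height:
  obtains C where "C \<ge> 0"
    "\<And>x Q. Q \<ge> 1 \<Longrightarrow> \<exists>c d :: int. 1 \<le> c \<and> c \<le> int Q \<and> \<bar>of_int c * x + of_int d\<bar> \<le> 1 \<and>
       norm (f (Complex x (1 / real Q ^ 2))) \<le> C / norm (of_int c * Complex x (1 / real Q ^ 2) + of_int d) ^ k"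
proof -
  obtain C where C: "C \<ge> 0" "\<And>A \<tau>. A \<in> carrier SL2Z \<Longrightarrow> Im \<tau> \<ge> 1/2 \<Longrightarrow> norm (slash k f A \<tau>) \<le> C"
    using slash_uniformly_bounded[of "1/2"] by auto
  have "\<exists>c d :: int. 1 \<le> c \<and> c \<le> int Q \<and> \<bar>of_int c * x + of_int d\<bar> \<le> 1 \<and>
       norm (f (Complex x (1 / real Q ^ 2))) \<le> C / norm (of_int c * Complex x (1 / real Q ^ 2) + of_int d) ^ k"
    if Q: "Q \<ge> 1" for x Q
  proof -
    define y where "y = 1 / real Q ^ 2"
    define \<tau> where "\<tau> = Complex x y"
    have y: "y > 0" using Q by (simp add: y_def)
    obtain h c where hc: "coprime h c" "0 < c" "c \<le> int Q" "\<bar>of_int c * x - of_int h\<bar> < 1 / real Q"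
      using Dirichlet_approx_coprime[of Q x] Q by (metis less_le_trans zero_less_one)
    obtain A0 where A0: "A0 \<in> carrier SL2Z" "A0 $ 1 $ 1 = h" "A0 $ 2 $ 1 = c"
      using SL2Z_with_first_column[OF hc(1)] .
    define A where "A = mat2 (A0 $ 2 $ 2) (- (A0 $ 1 $ 2)) (- (A0 $ 2 $ 1)) (A0 $ 1 $ 1)"
    have A: "A \<in> carrier SL2Z" unfolding A_def by (rule SL2Z_adjugate(1)[OF A0(1)])
    have denA: "den A \<tau> = - (of_int c * \<tau> + of_int (- h))" by (simp add: den_def A_def A0)
    have \<tau>: "Im \<tau> > 0" using y by (simp add: \<tau>_def)
    have n2: "norm (den A \<tau>) ^ 2 = (of_int c * x - of_int h) ^ 2 + (of_int c * y) ^ 2"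
      unfolding denA norm_minus_cancel by (simp add: cmod_power2 \<tau>_def)
    have "norm (den A \<tau>) ^ 2 \<le> (1 / real Q) ^ 2 + (real Q * y) ^ 2"
      unfolding n2 using hc y by (intro add_mono power2_le_iff_abs_le[THEN iffD2] power_mono mult_right_mono) (auto simp: abs_le_square_iff power2_abs)
    also have "\<dots> = 2 * y" using Q by (simp add: y_def power2_eq_square field_simps)
    finally have le: "norm (den A \<tau>) ^ 2 \<le> 2 * y" .
    have nz: "den A \<tau> \<noteq> 0" by (rule den_nonzero[OF A \<tau>])
    have "Im (moebius_act A \<tau>) = y / norm (den A \<tau>) ^ 2" using Im_moebius[OF A \<tau>] by (simp add: \<tau>_def)
    also have "\<dots> \<ge> 1 / 2" using le nz by (simp add: field_simps)
    finally have Im: "Im (moebius_act A \<tau>) \<ge> 1 / 2" .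
    have inv: "moebius_act A0 (moebius_act A \<tau>) = \<tau>" "den A0 (moebius_act A \<tau>) * den A \<tau> = 1"
      using moebius_adjugate[OF A0(1) \<tau>] by (simp_all add: A_def)
    have "slash k f A0 (moebius_act A \<tau>) = inverse (den A0 (moebius_act A \<tau>)) ^ k * f \<tau>"
      by (simp add: slash_eq inv power_inverse)
    also have "inverse (den A0 (moebius_act A \<tau>)) = den A \<tau>"
      using inv(2) by (rule inverse_unique)
    finally have "norm (den A \<tau>) ^ k * norm (f \<tau>) \<le> C"
      using C(2)[OF A0(1) Im] by (simp add: norm_mult norm_power)
    hence "norm (f \<tau>) \<le> C / norm (den A \<tau>) ^ k"
      using nz by (simp add: field_simps)
    also have "norm (den A \<tau>) = norm (of_int c * \<tau> + of_int (- h))"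
      unfolding denA by (rule norm_minus_cancel)
    finally have "norm (f \<tau>) \<le> C / norm (of_int c * \<tau> + of_int (- h)) ^ k" .
    moreover have "1 / real Q \<le> 1" using Q by simp
    hence "\<bar>of_int c * x + of_int (- h)\<bar> \<le> 1" using hc(4) by simp
    ultimately show ?thesis using hc(2,3) unfolding \<tau>_def y_def
      by (intro exI[of _ c] exI[of _ "- h"]) auto
  qed
  thus ?thesis using C(1) that by blast
qed

end

lemma has_integral_inverse_quadratic:
  fixes c d y a b :: real
  assumes "c > 0" "y > 0" "a \<le> b"
  shows "((\<lambda>x. 1 / ((c * x + d) ^ 2 + (c * y) ^ 2)) has_integral
     (arctan ((c * b + d) / (c * y)) - arctan ((c * a + d) / (c * y))) / (c ^ 2 * y)) {a..b}"
proof -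
  have "((\<lambda>x. 1 / ((c * x + d) ^ 2 + (c * y) ^ 2)) has_integral
     arctan ((c * b + d) / (c * y)) / (c ^ 2 * y) - arctan ((c * a + d) / (c * y)) / (c ^ 2 * y)) {a..b}"
  proof (rule fundamental_theorem_of_calculus[OF assms(3)])
    fix x
    define z where "z = (c * x + d) / (c * y)"
    have z: "c * x + d = z * (c * y)" using assms by (simp add: z_def)
    have "((\<lambda>x. arctan ((c * x + d) / (c * y)) / (c ^ 2 * y)) has_real_derivative
       (inverse (1 + z ^ 2) * (c / (c * y))) / (c ^ 2 * y)) (at x)"
      unfolding z_def using assms by (auto intro!: derivative_eq_intros)
    also have "(inverse (1 + z ^ 2) * (c / (c * y))) / (c ^ 2 * y) = 1 / ((c * x + d) ^ 2 + (c * y) ^ 2)"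
    proof -
      have "(z * (c * y)) ^ 2 + (c * y) ^ 2 = (1 + z ^ 2) * (c ^ 2 * y * y)"
        by (simp add: power_mult_distrib power2_eq_square algebra_simps)
      thus ?thesis unfolding z using assms by (simp add: divide_inverse)
    qed
    finally show "((\<lambda>x. arctan ((c * x + d) / (c * y)) / (c ^ 2 * y)) has_vector_derivative
        1 / ((c * x + d) ^ 2 + (c * y) ^ 2)) (at x within {a..b})"
      by (intro has_vector_derivative_at_within[OF has_real_derivative_iff_has_vector_derivative[THEN iffD1]])
  qed
  thus ?thesis by (simp add: diff_divide_distrib)
qed

context modular_form_level
begin

abbreviation "fcoeff \<equiv> fourier_coeff N f"

text \<open>
  The estimate \<open>f (x + \<i> y) = O(y^(-k))\<close>, uniform in \<open>x\<close>, only gives \<open>a_n = O(n^k)\<close>, which does not make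
  the Dirichlet series converge on all of \<open>Re s > k\<close>. But \<open>f\<close> is that large only near few fractions:
  in the bound of \<open>norm_le_at_height\<close>, integrated over one period at height \<open>y = 1 / Q\<^sup>2\<close>, the fractions
  with denominator \<open>c\<close> together contribute \<open>O(y^(1-k) / c)\<close>.
\<close>

lemma coeff_bound:
  obtains K where "K \<ge> 0"
    "\<And>n Q. Q \<ge> 1 \<Longrightarrow> n \<le> Q ^ 2 \<Longrightarrow> norm (fcoeff n) \<le> K * real Q ^ (2 * (k - 1)) * (\<Sum>c=1..Q. 1 / real c)"
proof -
  obtain C where C: "C \<ge> 0"
    "\<And>x Q. Q \<ge> 1 \<Longrightarrow> \<exists>c d :: int. 1 \<le> c \<and> c \<le> int Q \<and> \<bar>of_int c * x + of_int d\<bar> \<le> 1 \<and>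
       norm (f (Complex x (1 / real Q ^ 2))) \<le> C / norm (of_int c * Complex x (1 / real Q ^ 2) + of_int d) ^ k"
    using norm_le_at_height by blast
  \<comment> \<open>The factor \<open>exp (2 * pi)\<close> removes the exponential weight in the coefficient integral, \<open>pi\<close> bounds the increment of \<open>arctan\<close>, and at most \<open>(N + 3) c\<close> numerators \<open>d\<close> occur for each \<open>c\<close>.\<close>
  define K where "K = exp (2 * pi) * C * pi * (real N + 3)"
  have K: "K \<ge> 0" using C by (simp add: K_def)
  have "norm (fcoeff n) \<le> K * real Q ^ (2 * (k - 1)) * (\<Sum>c=1..Q. 1 / real c)" if Q: "Q \<ge> 1" and n: "n \<le> Q ^ 2" for n Q
  proof -
    define y where "y = 1 / real Q ^ 2"
    have y: "y > 0" using Q by (simp add: y_def)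
    define D where "D = (\<lambda>c::nat. {- int (c * N) - 1 .. 1})"
    \<comment> \<open>The best fraction varies with \<open>x\<close>; summing over all candidates gives a bound that can be integrated.\<close>
    define S where "S = (\<lambda>x. \<Sum>c=1..Q. \<Sum>d\<in>D c. 1 / ((real c * x + of_int d) ^ 2 + (real c * y) ^ 2))"
    define I where "I = (\<Sum>c=1..Q. \<Sum>d\<in>D c. (arctan ((real c * real N + of_int d) / (real c * y))
        - arctan ((real c * 0 + of_int d) / (real c * y))) / (real c ^ 2 * y))"
    have S: "(S has_integral I) {0..real N}"
      unfolding S_def I_def using y
      by (intro has_integral_sum has_integral_inverse_quadratic) (auto simp: D_def)
    have bound: "norm (f (Complex x y)) \<le> C * real Q ^ (2 * (k - 2)) * S x" if x: "x \<in> {0..real N}" for x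
    proof -
      obtain c d :: int where cd: "1 \<le> c" "c \<le> int Q" "\<bar>of_int c * x + of_int d\<bar> \<le> 1"
         "norm (f (Complex x y)) \<le> C / norm (of_int c * Complex x y + of_int d) ^ k"
        using C(2)[OF Q, of x] unfolding y_def by blast
      define m where "m = nat c"
      have m: "c = int m" "m \<in> {1..Q}" using cd by (auto simp: m_def)
      define w where "w = norm (of_int c * Complex x y + of_int d)"
      have w2: "w ^ 2 = (real m * x + of_int d) ^ 2 + (real m * y) ^ 2"
        by (simp add: w_def cmod_power2 m)
      have "y \<le> real m * y" using m y by simp
      also have "\<dots> \<le> w"
        using abs_Im_le_cmod[of "of_int c * Complex x y + of_int d"] m y by (simp add: w_def)
      finally have wy: "y \<le> w" .
      have d: "d \<in> D m"
      proof -
        have "real_of_int d \<le> 1" using cd(3) cd(1) x by (smt (verit) mult_nonneg_nonneg of_int_nonneg atLeastAtMost_iff)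
        moreover have "real_of_int d \<ge> - (real m * real N) - 1"
        proof -
          have "real m * x \<le> real m * real N" using x by (intro mult_left_mono) auto
          thus ?thesis using cd(3) by (simp add: m)
        qed
        hence "real_of_int d \<ge> real_of_int (- int (m * N) - 1)" by simp
        hence "d \<ge> - int (m * N) - 1" by (simp only: of_int_le_iff)
        ultimately show ?thesis by (simp add: D_def)
      qed
      have "1 / w ^ k \<le> real Q ^ (2 * (k - 2)) * (1 / w ^ 2)"
      proof -
        have "w ^ k = w ^ (k - 2) * w ^ 2"
        proof -
          have "k = k - 2 + 2" using weight by simp
          thus ?thesis by (metis power_add)
        qed
        moreover have "1 / w ^ (k - 2) \<le> 1 / y ^ (k - 2)"
          using wy y by (intro divide_left_mono power_mono mult_pos_pos zero_less_power) auto
        moreover have "1 / y ^ (k - 2) = real Q ^ (2 * (k - 2))"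
          by (simp add: y_def power_divide power_mult)
        ultimately show ?thesis
          using mult_right_mono[of "1 / w ^ (k - 2)" "real Q ^ (2 * (k - 2))" "1 / w ^ 2"] by simp
      qed
      also have "1 / w ^ 2 \<le> S x"
      proof -
        have "1 / w ^ 2 \<le> (\<Sum>d\<in>D m. 1 / ((real m * x + of_int d) ^ 2 + (real m * y) ^ 2))"
          unfolding w2 by (rule member_le_sum[of d]) (use d in \<open>auto simp: D_def\<close>)
        also have "\<dots> \<le> S x"
          unfolding S_def by (rule member_le_sum[of m]) (use m in \<open>auto intro: sum_nonneg\<close>)
        finally show ?thesis .
      qed
      finally have "1 / w ^ k \<le> real Q ^ (2 * (k - 2)) * S x"
        by (simp add: mult_left_mono)
      from mult_left_mono[OF this C(1)] show ?thesis using cd(4) by (simp add: w_def mult_ac)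
    qed
    have I: "I \<le> pi * (real N + 3) * real Q ^ 2 * (\<Sum>c=1..Q. 1 / real c)"
    proof -
      have "I \<le> (\<Sum>c=1..Q. \<Sum>d\<in>D c. pi / (real c ^ 2 * y))"
        unfolding I_def
      proof (intro sum_mono divide_right_mono)
        fix u v :: real
        show "arctan u - arctan v \<le> pi" using arctan_bounded[of u] arctan_bounded[of v] by linarith
      qed (use y in auto)
      also have "\<dots> \<le> (\<Sum>c=1..Q. (real N + 3) * real c * (pi / (real c ^ 2 * y)))"
      proof (rule sum_mono)
        fix c assume c: "c \<in> {1..Q}"
        have "real (card (D c)) = real c * real N + 3" by (simp add: D_def)
        also have "\<dots> \<le> (real N + 3) * real c" using c by (simp add: algebra_simps)
        finally have le: "real (card (D c)) \<le> (real N + 3) * real c" .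
        show "(\<Sum>d\<in>D c. pi / (real c ^ 2 * y)) \<le> (real N + 3) * real c * (pi / (real c ^ 2 * y))"
          unfolding sum_constant using y by (intro mult_right_mono le) auto
      qed
      also have "\<dots> = (\<Sum>c=1..Q. pi * (real N + 3) * real Q ^ 2 * (1 / real c))"
        by (intro sum.cong) (auto simp: y_def power2_eq_square)
      finally show ?thesis by (simp add: sum_distrib_left)
    qed
    have co: "((\<lambda>x. f (Complex x y) * e2pi (- of_nat n * of_real x / of_nat N)) has_integral
           of_nat N * fcoeff n * of_real (exp (- 2 * pi * y / real N) ^ n)) {0..real N}"
      by (rule fourier_coeff_integral[OF expansion N y])
    have "norm (of_nat N * fcoeff n * of_real (exp (- 2 * pi * y / real N) ^ n))
       \<le> integral {0..real N} (\<lambda>x. C * real Q ^ (2 * (k - 2)) * S x)"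
      unfolding integral_unique[OF co, symmetric]
    proof (rule integral_norm_bound_integral)
      show "(\<lambda>x. f (Complex x y) * e2pi (- of_nat n * of_real x / of_nat N)) integrable_on {0..real N}"
        using co by blast
      show "(\<lambda>x. C * real Q ^ (2 * (k - 2)) * S x) integrable_on {0..real N}"
        using has_integral_mult_right[OF S] by blast
      show "norm (f (Complex x y) * e2pi (- of_nat n * of_real x / of_nat N))
         \<le> C * real Q ^ (2 * (k - 2)) * S x" if "x \<in> {0..real N}" for x
        using bound[OF that] by (simp add: norm_mult norm_e2pi)
    qed
    also have "\<dots> = C * real Q ^ (2 * (k - 2)) * I"
      by (rule integral_unique[OF has_integral_mult_right[OF S]])
    also have "\<dots> \<le> C * real Q ^ (2 * (k - 2)) * (pi * (real N + 3) * real Q ^ 2 * (\<Sum>c=1..Q. 1 / real c))"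
      using C(1) by (intro mult_left_mono I) auto
    also have "\<dots> = C * pi * (real N + 3) * (real Q ^ (2 * (k - 2)) * real Q ^ 2) * (\<Sum>c=1..Q. 1 / real c)"
      by simp
    also have "real Q ^ (2 * (k - 2)) * real Q ^ 2 = real Q ^ (2 * (k - 1))"
    proof -
      have "2 * (k - 2) + 2 = 2 * (k - 1)" using weight by simp
      thus ?thesis by (simp only: power_add[symmetric])
    qed
    finally have B: "norm (of_nat N * fcoeff n * of_real (exp (- 2 * pi * y / real N) ^ n))
       \<le> C * pi * (real N + 3) * real Q ^ (2 * (k - 1)) * (\<Sum>c=1..Q. 1 / real c)" .
    have "exp (- (2 * pi)) \<le> exp (- 2 * pi * y / real N) ^ n"
    proof -
      have "real n * y \<le> 1" using n Q y_def by (simp add: y_def divide_simps flip: of_nat_power)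
      also have "1 \<le> real N" using N by simp
      finally have "pi * (real n * y) \<le> pi * real N" by (intro mult_left_mono) auto
      thus ?thesis using N by (simp flip: exp_of_nat_mult) (simp add: field_simps)
    qed
    moreover have "1 \<le> real N" using N by simp
    ultimately have "norm (fcoeff n) * exp (- (2 * pi)) \<le> real N * norm (fcoeff n) * exp (- 2 * pi * y / real N) ^ n"
      by (intro mult_mono) (auto simp: mult_le_cancel_right1)
    also have "\<dots> = norm (of_nat N * fcoeff n * of_real (exp (- 2 * pi * y / real N) ^ n))"
      by (simp add: norm_mult norm_power)
    also note B
    finally have "exp (2 * pi) * (norm (fcoeff n) * exp (- (2 * pi)))
      \<le> exp (2 * pi) * (C * pi * (real N + 3) * real Q ^ (2 * (k - 1)) * (\<Sum>c=1..Q. 1 / real c))"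
      by (rule mult_left_mono) simp
    thus ?thesis by (simp add: K_def exp_minus mult_ac)
  qed
  thus ?thesis using K that by blast
qed

text \<open>
  With \<open>Q\<close> about \<open>sqrt n\<close>, \<open>coeff_bound\<close> gives \<open>a_n = O(n^(k-1+\<delta>/2))\<close> for \<open>\<delta> = \<sigma> - k\<close>, since the harmonic sum
  up to \<open>Q\<close> is \<open>O(Q^\<delta>)\<close>.
\<close>

lemma dirichlet_series_summable:
  assumes \<sigma>: "\<sigma> > real k"
  shows "summable (\<lambda>n. norm (fcoeff (Suc n)) / real (Suc n) powr \<sigma>)"
proof -
  obtain K where K: "K \<ge> 0"
    "\<And>n Q. Q \<ge> 1 \<Longrightarrow> n \<le> Q ^ 2 \<Longrightarrow> norm (fcoeff n) \<le> K * real Q ^ (2 * (k - 1)) * (\<Sum>c=1..Q. 1 / real c)"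
    using coeff_bound by blast
  define \<delta> where "\<delta> = \<sigma> - real k"
  have \<delta>: "\<delta> > 0" using \<sigma> by (simp add: \<delta>_def)
  define Z where "Z = (\<Sum>c. real (Suc c) powr (- 1 - \<delta>))"
  have zs: "summable (\<lambda>c. real (Suc c) powr (- 1 - \<delta>))"
    using \<delta> by (subst summable_Suc_iff[of "\<lambda>c. real c powr (- 1 - \<delta>)"]) (simp add: summable_real_powr_iff)
  have Z: "Z \<ge> 0" unfolding Z_def by (intro suminf_nonneg zs) auto
  have harm: "(\<Sum>c=1..Q. 1 / real c) \<le> Z * real Q powr \<delta>" for Q
  proof -
    have "(\<Sum>c=1..Q. 1 / real c) = (\<Sum>c<Q. 1 / real (Suc c))"
      by (rule sum.reindex_bij_witness[of _ Suc "\<lambda>c. c - 1"]) auto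
    also have "\<dots> \<le> (\<Sum>c<Q. real (Suc c) powr (- 1 - \<delta>) * real Q powr \<delta>)"
    proof (rule sum_mono)
      fix c assume c: "c \<in> {..<Q}"
      have "1 / real (Suc c) = real (Suc c) powr (- 1 - \<delta>) * real (Suc c) powr \<delta>"
        by (simp flip: powr_add add: powr_minus divide_inverse del: of_nat_Suc)
      also have "\<dots> \<le> real (Suc c) powr (- 1 - \<delta>) * real Q powr \<delta>"
        using c \<delta> by (intro mult_left_mono powr_mono2) auto
      finally show "1 / real (Suc c) \<le> real (Suc c) powr (- 1 - \<delta>) * real Q powr \<delta>" .
    qed
    also have "\<dots> = (\<Sum>c<Q. real (Suc c) powr (- 1 - \<delta>)) * real Q powr \<delta>"
      by (rule sum_distrib_right[symmetric])
    also have "\<dots> \<le> Z * real Q powr \<delta>"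
      unfolding Z_def by (intro mult_right_mono sum_le_suminf zs) auto
    finally show ?thesis .
  qed
  define e where "e = real (2 * (k - 1)) + \<delta>"
  have e0: "e \<ge> 0" using \<delta> by (simp add: e_def)
  define L where "L = K * Z * 2 powr e"
  have L: "norm (fcoeff n) / real n powr \<sigma> \<le> L * real n powr (- 1 - \<delta> / 2)" if n: "n \<ge> 1" for n
  proof -
    define Q where "Q = nat \<lceil>sqrt (real n)\<rceil>"
    have s1: "sqrt (real n) \<ge> 1" using n by simp
    have Q1: "real Q \<ge> sqrt (real n)" unfolding Q_def by linarith
    have Q2: "real Q \<le> 2 * sqrt (real n)" unfolding Q_def using s1 by linarith
    have Qge: "Q \<ge> 1" using Q1 s1 by linarith
    have "real n = sqrt (real n) ^ 2" by simp
    also have "\<dots> \<le> real Q ^ 2" using Q1 by (intro power_mono) auto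
    finally have nQ: "n \<le> Q ^ 2" by (simp flip: of_nat_power)
    have "norm (fcoeff n) \<le> K * real Q ^ (2 * (k - 1)) * (\<Sum>c=1..Q. 1 / real c)"
      by (rule K(2)[OF Qge nQ])
    also have "\<dots> \<le> K * real Q ^ (2 * (k - 1)) * (Z * real Q powr \<delta>)"
      using K(1) by (intro mult_left_mono harm) auto
    also have "\<dots> = K * Z * real Q powr e"
      using Qge by (simp add: e_def powr_add powr_realpow[symmetric])
    also have "\<dots> \<le> K * Z * (2 * sqrt (real n)) powr e"
      using K(1) Z e0 Q2 by (intro mult_left_mono powr_mono2) auto
    also have "\<dots> = L * sqrt (real n) powr e"
      by (simp add: L_def powr_mult)
    also have "sqrt (real n) powr e = real n powr (e / 2)"
      using n by (simp add: powr_half_sqrt[symmetric] powr_powr)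
    finally have "norm (fcoeff n) / real n powr \<sigma> \<le> L * real n powr (e / 2) / real n powr \<sigma>"
      by (rule divide_right_mono) simp
    also have "\<dots> = L * real n powr (e / 2 - \<sigma>)" by (simp add: powr_diff)
    also have "e / 2 - \<sigma> = - 1 - \<delta> / 2"
      using weight by (simp add: e_def \<delta>_def of_nat_diff field_simps)
    finally show ?thesis .
  qed
  show ?thesis
  proof (rule summable_comparison_test')
    show "summable (\<lambda>n. L * real (Suc n) powr (- 1 - \<delta> / 2))"
      using \<delta> by (intro summable_mult)
        (subst summable_Suc_iff[of "\<lambda>c. real c powr (- 1 - \<delta> / 2)"], simp add: summable_real_powr_iff)
    show "norm (norm (fcoeff (Suc n)) / real (Suc n) powr \<sigma>) \<le> L * real (Suc n) powr (- 1 - \<delta> / 2)" if "n \<ge> 0" for n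
      using L[of "Suc n"] by simp
  qed
qed

end

section \<open>Behaviour at the cusps and continuation of the L-series\<close>

lemma exp_minus_le:
  fixes x :: real
  assumes "x > 0"
  shows "exp (- x) \<le> fact n / x ^ n"
proof -
  have "(\<Sum>m\<in>{n}. x ^ m /\<^sub>R fact m) \<le> (\<Sum>m. x ^ m /\<^sub>R fact m)"
    using exp_converges[of x] assms by (intro sum_le_suminf) (auto simp: sums_iff)
  hence "x ^ n / fact n \<le> exp x"
    using exp_converges[of x] by (simp add: sums_iff divide_inverse mult.commute)
  thus ?thesis using assms by (simp add: exp_minus field_simps)
qed

text \<open>
  The vertical line over the cusp \<open>A\<infinity>\<close> is the image of a vertical line, traversed in the opposite
  direction.
\<close>

lemma moebius_vertical_line:
  assumes A: "A \<in> carrier SL2Z" and p: "p = A $ 2 $ 1" "p \<noteq> 0" and v: "v > 0"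
  defines "z \<equiv> Complex (- of_int (A $ 2 $ 2) / of_int p) v"
  shows "den A z = \<i> * of_int p * of_real v"
    and "moebius_act A z = Complex (of_int (A $ 1 $ 1) / of_int p) (1 / (of_int p ^ 2 * v))"
proof -
  show den: "den A z = \<i> * of_int p * of_real v"
    using p by (simp add: den_def z_def complex_eq_iff)
  have "complex_of_int (A $ 1 $ 1) * z + of_int (A $ 1 $ 2) =
        Complex (of_int (A $ 1 $ 1) / of_int p) (1 / (of_int p ^ 2 * v)) * den A z"
  proof -
    have det: "real_of_int (A $ 1 $ 1) * of_int (A $ 2 $ 2) - of_int (A $ 1 $ 2) * of_int p = 1"
      using SL2Z_det[OF A, where 'a=real] by (simp add: p)
    have "- (real_of_int (A $ 1 $ 1) * of_int (A $ 2 $ 2) / of_int p) + of_int (A $ 1 $ 2) = - (1 / of_int p)"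
      using det p(2) by (simp add: field_simps)
    thus ?thesis using p(2) v
      unfolding den by (simp add: z_def complex_eq_iff power2_eq_square)
  qed
  moreover have "den A z \<noteq> 0" using den p(2) v by simp
  ultimately show "moebius_act A z = Complex (of_int (A $ 1 $ 1) / of_int p) (1 / (of_int p ^ 2 * v))"
    by (simp add: moebius_act_def)
qed

lemma tendsto_e2pi_at_cusp:
  assumes "M \<ge> 1"
  shows "((\<lambda>\<tau>. e2pi (\<tau> / of_nat M)) \<longlongrightarrow> 0) (filtercomap Im at_top)"
proof (rule tendsto_norm_zero_cancel)
  have "filterlim (\<lambda>y. (- 2 * pi / real M) * y) at_bot at_top"
    using assms by (intro filterlim_tendsto_neg_mult_at_bot[OF tendsto_const _ filterlim_ident]) auto
  hence "((\<lambda>y. exp (- 2 * pi * (y / real M))) \<longlongrightarrow> 0) at_top"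
    using filterlim_compose[OF exp_at_bot] by simp
  hence "((\<lambda>\<tau>. exp (- 2 * pi * (Im \<tau> / real M))) \<longlongrightarrow> 0) (filtercomap Im at_top)"
    by (rule filterlim_compose) (rule filterlim_filtercomap)
  thus "((\<lambda>\<tau>. norm (e2pi (\<tau> / of_nat M))) \<longlongrightarrow> 0) (filtercomap Im at_top)"
    by (simp add: norm_e2pi)
qed

lemma filtercomap_Im_at_top_neq_bot: "filtercomap Im at_top \<noteq> bot"
  by (rule filtercomap_neq_bot_surj) (auto simp: surj_def intro: exI[of _ "Complex 0 y" for y])

lemma fourier_expansion_bigo:
  assumes "fourier_expansion M g a" "M \<ge> 1"
  shows "(\<lambda>\<tau>. g \<tau> - a 0) \<in> O[filtercomap Im at_top](\<lambda>\<tau>. e2pi (\<tau> / of_nat M))"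
proof -
  obtain C where C: "\<And>\<tau>. Im \<tau> \<ge> 1 \<Longrightarrow> norm (g \<tau> - a 0) \<le> C * exp (- 2 * pi * Im \<tau> / real M)"
    using fourier_expansion_decay[OF assms zero_less_one] by metis
  show ?thesis
  proof (rule bigoI)
    have "\<forall>\<^sub>F \<tau> in filtercomap Im at_top. Im \<tau> \<ge> 1"
      by (rule eventually_filtercomapI) (rule eventually_ge_at_top)
    thus "\<forall>\<^sub>F \<tau> in filtercomap Im at_top. norm (g \<tau> - a 0) \<le> C * norm (e2pi (\<tau> / of_nat M))"
      by eventually_elim (use C in \<open>simp add: norm_e2pi\<close>)
  qed
qed

lemma cusp_limit:
  assumes "(\<lambda>\<tau>. g \<tau> - a0) \<in> O[filtercomap Im at_top](\<lambda>\<tau>. e2pi (\<tau> / of_nat M))" "M \<ge> 1"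
  shows "(g \<longlongrightarrow> a0) (filtercomap Im at_top)"
proof -
  obtain c where "\<forall>\<^sub>F \<tau> in filtercomap Im at_top. norm (g \<tau> - a0) \<le> c * norm (e2pi (\<tau> / of_nat M))"
    using landau_o.bigE[OF assms(1)] by blast
  moreover have "((\<lambda>\<tau>. c * norm (e2pi (\<tau> / of_nat M))) \<longlongrightarrow> 0) (filtercomap Im at_top)"
    using tendsto_mult_left[OF tendsto_norm_zero[OF tendsto_e2pi_at_cusp[OF assms(2)]], of c] by simp
  ultimately have "((\<lambda>\<tau>. g \<tau> - a0) \<longlongrightarrow> 0) (filtercomap Im at_top)"
    by (rule Lim_null_comparison)
  thus ?thesis by (rule LIM_zero_cancel)
qed

context modular_form_level
begin

text \<open>
  Two matrices with the same first column differ by a translation on the right, which does not affect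
  the limit at infinity.
\<close>

lemma cusp_const_eq:
  assumes A: "A \<in> carrier SL2Z" "A $ 1 $ 1 = r" "A $ 2 $ 1 = p" and M: "M \<ge> 1"
    and exp: "fourier_expansion M (slash k f A) a"
  shows "cusp_const k f r p = a 0"
  unfolding cusp_const_def
proof (rule the_equality)
  show "\<exists>A\<in>carrier SL2Z. \<exists>M\<ge>1. A $ 1 $ 1 = r \<and> A $ 2 $ 1 = p \<and>
     (\<lambda>\<tau>. slash k f A \<tau> - a 0) \<in> O[filtercomap Im at_top](\<lambda>\<tau>. e2pi (\<tau> / of_nat M))"
    using A M fourier_expansion_bigo[OF exp M] by blast
next
  fix b
  assume "\<exists>A\<in>carrier SL2Z. \<exists>M\<ge>1. A $ 1 $ 1 = r \<and> A $ 2 $ 1 = p \<and>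
     (\<lambda>\<tau>. slash k f A \<tau> - b) \<in> O[filtercomap Im at_top](\<lambda>\<tau>. e2pi (\<tau> / of_nat M))"
  then obtain A' M' where A': "A' \<in> carrier SL2Z" "A' $ 1 $ 1 = r" "A' $ 2 $ 1 = p" "M' \<ge> 1"
     "(\<lambda>\<tau>. slash k f A' \<tau> - b) \<in> O[filtercomap Im at_top](\<lambda>\<tau>. e2pi (\<tau> / of_nat M'))" by blast
  define n where "n = A $ 2 $ 2 * A' $ 1 $ 2 - A $ 1 $ 2 * A' $ 2 $ 2"
  have T: "mat2 1 n 0 1 \<in> carrier SL2Z" by (simp add: SL2Z_carrier_iff)
  have eqA: "A' = A ** mat2 1 n 0 1"
  proof (rule mat2_eqI)
    have d1: "r * A $ 2 $ 2 - A $ 1 $ 2 * p = 1" and d2: "r * A' $ 2 $ 2 - A' $ 1 $ 2 * p = 1"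
      using A A' by (auto simp: SL2Z_carrier_iff)
    have "r * n = A' $ 1 $ 2 * (r * A $ 2 $ 2) - A $ 1 $ 2 * (r * A' $ 2 $ 2)"
      by (simp add: n_def algebra_simps)
    also have "r * A $ 2 $ 2 = 1 + A $ 1 $ 2 * p" using d1 by simp
    also have "r * A' $ 2 $ 2 = 1 + A' $ 1 $ 2 * p" using d2 by simp
    finally show "A' $ 1 $ 2 = (A ** mat2 1 n 0 1) $ 1 $ 2"
      using A by (simp add: mult2_nth algebra_simps)
    have "p * n = A $ 2 $ 2 * (A' $ 1 $ 2 * p) - A' $ 2 $ 2 * (A $ 1 $ 2 * p)"
      by (simp add: n_def algebra_simps)
    also have "A $ 1 $ 2 * p = r * A $ 2 $ 2 - 1" using d1 by simp
    also have "A' $ 1 $ 2 * p = r * A' $ 2 $ 2 - 1" using d2 by simp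
    finally show "A' $ 2 $ 2 = (A ** mat2 1 n 0 1) $ 2 $ 2"
      using A by (simp add: mult2_nth algebra_simps)
  qed (use A A' in \<open>simp_all add: mult2_nth\<close>)
  have lim: "(slash k f A \<longlongrightarrow> a 0) (filtercomap Im at_top)"
    by (rule cusp_limit[OF fourier_expansion_bigo[OF exp M] M])
  have "filterlim (\<lambda>\<tau>. \<tau> + of_int n) (filtercomap Im at_top) (filtercomap Im at_top)"
    by (simp add: filterlim_filtercomap_iff o_def filterlim_filtercomap)
  from filterlim_compose[OF lim this]
  have "((\<lambda>\<tau>. slash k f A (\<tau> + of_int n)) \<longlongrightarrow> a 0) (filtercomap Im at_top)" .
  moreover have "\<forall>\<^sub>F \<tau> in filtercomap Im at_top. slash k f A (\<tau> + of_int n) = slash k f A' \<tau>"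
  proof -
    have "\<forall>\<^sub>F \<tau> in filtercomap Im at_top. Im \<tau> > 0"
      by (rule eventually_filtercomapI) (rule eventually_gt_at_top)
    thus ?thesis
      by eventually_elim (simp add: eqA slash_mult[OF A(1) T] den_def moebius_act_def)
  qed
  ultimately have "(slash k f A' \<longlongrightarrow> a 0) (filtercomap Im at_top)"
    by (rule Lim_transform_eventually)
  moreover have "(slash k f A' \<longlongrightarrow> b) (filtercomap Im at_top)"
    by (rule cusp_limit[OF A'(5,4)])
  ultimately show "b = a 0"
    using tendsto_unique[OF filtercomap_Im_at_top_neq_bot] by blast
qed

lemma cusp_decay:
  assumes A: "A \<in> carrier SL2Z" and h: "h > 0"
  obtains C e where "C \<ge> 0" "e > 0"
    "\<And>\<tau>. Im \<tau> \<ge> h \<Longrightarrow> norm (slash k f A \<tau> - cusp_const k f (A $ 1 $ 1) (A $ 2 $ 1)) \<le> C * exp (- e * Im \<tau>)"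
proof -
  obtain M a where M: "M \<ge> 1" "fourier_expansion M (slash k f A) a" by (rule slash_expansion[OF A])
  obtain C where "C \<ge> 0" "\<And>\<tau>. Im \<tau> \<ge> h \<Longrightarrow> norm (slash k f A \<tau> - a 0) \<le> C * exp (- 2 * pi * Im \<tau> / real M)"
    using fourier_expansion_decay[OF M(2,1) h] by metis
  thus ?thesis using M(1) cusp_const_eq[OF A refl refl M]
    by (intro that[of C "2 * pi / real M"]) auto
qed

lemma f_decay:
  assumes h: "h > 0"
  obtains C e where "C \<ge> 0" "e > 0" "\<And>\<tau>. Im \<tau> \<ge> h \<Longrightarrow> norm (f \<tau> - fcoeff 0) \<le> C * exp (- e * Im \<tau>)"
proof -
  obtain C where "C \<ge> 0" "\<And>\<tau>. Im \<tau> \<ge> h \<Longrightarrow> norm (f \<tau> - fcoeff 0) \<le> C * exp (- 2 * pi * Im \<tau> / real N)"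
    using fourier_expansion_decay[OF expansion N h] by metis
  thus ?thesis using N by (intro that[of C "2 * pi / real N"]) auto
qed

end

text \<open>
  The sign of \<open>p\<close> is left open so that a matrix can be applied to the column \<open>(r, p)\<close> without
  normalising the result.
\<close>

locale modular_form_cusp = modular_form_level +
  fixes r p :: int
  assumes coprime: "coprime r p" and p: "p \<noteq> 0"
begin

text \<open>
  The leading coefficient at the cusp: \<open>f(\<tau>)\<close> is asymptotic to \<open>cc * (r/p - \<tau>)^(-k)\<close>.
\<close>

definition "cc = cusp_const k f r p / of_int p ^ k"

abbreviation "vert t \<equiv> Complex (of_int r / of_int p) t"

lemma f_near_cusp:
  assumes A: "A \<in> carrier SL2Z" "A $ 1 $ 1 = r" "A $ 2 $ 1 = p" and t: "t > 0"
  shows "f (vert t) = (\<i> / (of_int p * of_real t)) ^ k * slash k f A (Complex (- of_int (A $ 2 $ 2) / of_int p) (1 / (of_int p ^ 2 * t)))"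
proof -
  define v where "v = 1 / (of_int p ^ 2 * t)"
  have v: "v > 0" using t p by (simp add: v_def)
  note V = moebius_vertical_line[OF A(1) A(3)[symmetric] p v]
  have tv: "1 / (of_int p ^ 2 * v) = t" using t p by (simp add: v_def)
  have "\<i> * of_int p * of_real v = \<i> / (of_int p * of_real t)"
    using t p by (simp add: v_def power2_eq_square)
  thus ?thesis using V t p unfolding A tv v_def[symmetric] by (simp add: slash_eq)
qed

text \<open>
  Decay at the top of the vertical line is that of the Fourier expansion of \<open>f\<close>; at the bottom it is that
  of \<open>slash k f A\<close>, transported by \<open>f_near_cusp\<close>. On this line \<open>r/p - \<tau> = - \<i> t\<close>, which produces
  the factor \<open>\<i>^k\<close>.
\<close>

lemma mellin_data_vertical:
  "mellin_data (\<lambda>t. f (vert t)) (fcoeff 0) (\<i> ^ k * cc) k"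
proof
  have "continuous_on {0<..} (f \<circ> (\<lambda>t. vert t))"
  proof (rule continuous_on_compose)
    show "continuous_on {0<..} (\<lambda>t. vert t)"
      unfolding Complex_eq by (intro continuous_intros)
    show "continuous_on ((\<lambda>t. vert t) ` {0<..}) f"
      by (rule continuous_on_subset[OF holomorphic_on_imp_continuous_on[OF holomorphic]]) auto
  qed
  thus "continuous_on {0<..} (\<lambda>t. f (vert t))" by (simp add: o_def)
next
  fix m :: nat
  obtain C e where C: "C \<ge> 0" "e > 0" "\<And>\<tau>. Im \<tau> \<ge> 1 \<Longrightarrow> norm (f \<tau> - fcoeff 0) \<le> C * exp (- e * Im \<tau>)"
    using f_decay[OF zero_less_one] by blast
  have "norm (f (vert t) - fcoeff 0) \<le> (C * (fact m / e ^ m)) / t ^ m" if "t \<ge> 1" for t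
  proof -
    have "norm (f (vert t) - fcoeff 0) \<le> C * exp (- (e * t))" using C(3)[of "vert t"] that by simp
    also have "\<dots> \<le> C * (fact m / (e * t) ^ m)"
      using C that by (intro mult_left_mono exp_minus_le) auto
    finally show ?thesis by (simp add: power_mult_distrib)
  qed
  thus "\<exists>K. \<forall>t\<ge>1. norm (f (vert t) - fcoeff 0) \<le> K / t ^ m" by blast
next
  fix m :: nat
  obtain A where A: "A \<in> carrier SL2Z" "A $ 1 $ 1 = r" "A $ 2 $ 1 = p"
    using SL2Z_with_first_column[OF coprime] .
  have h: "1 / real_of_int p ^ 2 > 0" using p by simp
  obtain C e where C: "C \<ge> 0" "e > 0"
    "\<And>\<tau>. Im \<tau> \<ge> 1 / real_of_int p ^ 2 \<Longrightarrow> norm (slash k f A \<tau> - cusp_const k f r p) \<le> C * exp (- e * Im \<tau>)"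
    using cusp_decay[OF A(1) h] unfolding A by blast
  define K where "K = C * (fact (m + k) / (e / of_int p ^ 2) ^ (m + k)) / \<bar>of_int p\<bar> ^ k"
  have "norm (f (vert t) - \<i> ^ k * cc / of_real t ^ k) \<le> K * t ^ m" if t: "t > 0" "t \<le> 1" for t
  proof -
    define z where "z = Complex (- of_int (A $ 2 $ 2) / of_int p) (1 / (of_int p ^ 2 * t))"
    have "f (vert t) - \<i> ^ k * cc / of_real t ^ k
        = (\<i> / (of_int p * of_real t)) ^ k * (slash k f A z - cusp_const k f r p)"
      unfolding f_near_cusp[OF A t(1)] z_def[symmetric] cc_def
      by (simp add: power_divide power_mult_distrib right_diff_distrib diff_divide_distrib)
    hence "norm (f (vert t) - \<i> ^ k * cc / of_real t ^ k)
        = (1 / (\<bar>of_int p\<bar> * t)) ^ k * norm (slash k f A z - cusp_const k f r p)"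
      using t p by (simp add: norm_mult norm_power norm_divide)
    also have "\<dots> \<le> (1 / (\<bar>of_int p\<bar> * t)) ^ k * (C * (fact (m + k) / (e / (of_int p ^ 2 * t)) ^ (m + k)))"
    proof (rule mult_left_mono)
      have "1 / real_of_int p ^ 2 \<le> Im z" using t p by (simp add: z_def field_simps)
      hence "norm (slash k f A z - cusp_const k f r p) \<le> C * exp (- (e / (of_int p ^ 2 * t)))"
        using C(3)[of z] by (simp add: z_def)
      also have "\<dots> \<le> C * (fact (m + k) / (e / (of_int p ^ 2 * t)) ^ (m + k))"
        using C t p by (intro mult_left_mono exp_minus_le) auto
      finally show "norm (slash k f A z - cusp_const k f r p) \<le> C * (fact (m + k) / (e / (of_int p ^ 2 * t)) ^ (m + k))" .
    qed (use t p in auto)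
    also have "\<dots> = K * t ^ m"
      using t p by (simp add: K_def power_divide power_mult_distrib power_add field_simps)
    finally show ?thesis .
  qed
  thus "\<exists>K. \<forall>t. 0 < t \<and> t \<le> 1 \<longrightarrow> norm (f (vert t) - \<i> ^ k * cc / of_real t ^ k) \<le> K * t ^ m"
    by blast
qed

sublocale mellin_data "\<lambda>t. f (vert t)" "fcoeff 0" "\<i> ^ k * cc" k
  by (rule mellin_data_vertical)

abbreviation "cusp_mellin \<equiv> reg_mellin (\<lambda>t. f (vert t)) (fcoeff 0) (\<i> ^ k * cc) k"

lemma hatL_series_eq:
  assumes s: "Re s > real k"
  shows "hatL_series N f (of_int r / of_int p) s = - (e2pi (- s / 4) * cusp_mellin s)"
proof -
  define x where "x = real_of_int r / of_int p"
  define c where "c = (\<lambda>n. fcoeff (Suc n) * e2pi (of_nat (Suc n) * of_real x / of_nat N))"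
  define l where "l = 2 * pi / real N"
  have l: "l > 0" using N by (simp add: l_def)
  have split: "e2pi (of_nat n * vert t / of_nat N) = e2pi (of_nat n * of_real x / of_nat N) * of_real (exp (- (l * real n) * t))" for n t
  proof -
    have arg: "of_nat n * vert t / of_nat N = of_nat n * of_real x / of_nat N + \<i> * of_real (real n * t / real N)"
      by (simp add: Complex_eq x_def algebra_simps add_divide_distrib)
    have im: "e2pi (\<i> * of_real u) = of_real (exp (- (2 * pi * u)))" for u
      by (simp add: e2pi_def exp_of_real[symmetric] algebra_simps)
    show ?thesis unfolding arg e2pi_add im by (simp add: l_def mult_ac)
  qed
  have sums: "(\<lambda>n. c n * of_real (exp (- (l * real (Suc n)) * t))) sums (f (vert t) - fcoeff 0)" if t: "t > 0" for t
  proof -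
    have "(\<lambda>n. fcoeff n * e2pi (of_nat n * vert t / of_nat N)) sums f (vert t)"
      using expansion t by (simp add: fourier_expansion_def)
    hence "(\<lambda>n. fcoeff (Suc n) * e2pi (of_nat (Suc n) * vert t / of_nat N)) sums (f (vert t) - fcoeff 0)"
      by (subst sums_Suc_iff) simp
    thus ?thesis unfolding split c_def by (simp only: mult.assoc)
  qed
  have nc: "norm (c n) = norm (fcoeff (Suc n))" for n
    by (simp add: c_def norm_mult norm_e2pi)
  have smm: "summable (\<lambda>n. norm (c n) * exp (- (l * real (Suc n)) * t))" if t: "t > 0" for t
  proof -
    have "summable (\<lambda>n. norm (fcoeff n) * exp (- 2 * pi * t / real N) ^ n)"
      by (rule fourier_expansion_norm_summable[OF expansion N t])
    hence "summable (\<lambda>n. norm (fcoeff (Suc n)) * exp (- 2 * pi * t / real N) ^ Suc n)"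
      by (subst summable_Suc_iff)
    moreover have "exp (- 2 * pi * t / real N) ^ n = exp (- (l * real n) * t)" for n
      by (simp add: l_def flip: exp_of_nat_mult)
    ultimately show ?thesis by (simp only: nc)
  qed
  have dir: "summable (\<lambda>n. norm (c n) / real (Suc n) powr Re s)"
    unfolding nc by (rule dirichlet_series_summable[OF s])
  have "cusp_mellin s = Gamma s / of_real l powr s * (\<Sum>n. c n / of_nat (Suc n) powr s)"
    by (rule reg_mellin_eq_dirichlet_series[OF l s sums smm dir])
  moreover have "of_real (real N / (2 * pi)) powr s = 1 / of_real l powr s"
  proof -
    have "of_real (real N / (2 * pi)) powr s * of_real l powr s = of_real (real N / (2 * pi) * l) powr s"
      using l by (subst powr_times_real[symmetric]) auto
    also have "real N / (2 * pi) * l = 1" using N by (simp add: l_def)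
    finally show ?thesis using l by (simp add: field_simps)
  qed
  moreover have "(\<Sum>m. let n = Suc m in fcoeff n / of_nat n powr s * e2pi (of_nat n * of_rat (of_int r / of_int p) / of_nat N))
     = (\<Sum>n. c n / of_nat (Suc n) powr s)"
    by (simp add: c_def Let_def x_def of_rat_divide)
  ultimately show ?thesis unfolding hatL_series_def by (simp add: mult_ac)
qed

text \<open>
  By the identity theorem on the connected set \<open>- {0, k}\<close> every continuation agrees with the
  regularised Mellin transform.
\<close>

lemma hatL_eq:
  assumes s: "s \<noteq> 0" "s \<noteq> of_nat k"
  shows "hatL k N f (of_int r / of_int p) s = - (e2pi (- s / 4) * cusp_mellin s)"
proof -
  define F where "F = (\<lambda>s. - (e2pi (- s / 4) * cusp_mellin s))"
  define P where "P = (\<lambda>F. F holomorphic_on (- {0, of_nat k}) \<and>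
              (\<forall>s. Re s > real k \<longrightarrow> F s = hatL_series N f (of_int r / of_int p) s))"
  have "F holomorphic_on (- {0, of_nat k})"
    unfolding F_def e2pi_def by (intro holomorphic_intros reg_mellin_holomorphic) auto
  hence PF: "P F" by (simp add: P_def F_def hatL_series_eq)
  have PH: "P (hatL k N f (of_int r / of_int p))"
    unfolding hatL_def P_def[symmetric] by (rule someI[of P, OF PF])
  have "hatL k N f (of_int r / of_int p) s = F s"
  proof (rule analytic_continuation_open[of "{s. Re s > real k}" "- {0, of_nat k}" "hatL k N f (of_int r / of_int p)" F s])
    show "open {s. Re s > real k}" by (rule open_halfspace_Re_gt)
    have "of_nat (Suc k) \<in> {s. Re s > real k}" by simp
    thus "{s. Re s > real k} \<noteq> {}" by blast
    show "connected (- {0, of_nat k :: complex})"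
      using connected_open_diff_countable[of "UNIV :: complex set" "{0, of_nat k}"]
      by (simp add: Compl_eq_Diff_UNIV connected_UNIV)
    show "open (- {0, of_nat k :: complex})" by (intro open_Compl finite_imp_closed) auto
    show "hatL k N f (of_int r / of_int p) z = F z" if "z \<in> {s. Re s > real k}" for z
      using PF PH that by (simp add: P_def)
    show "hatL k N f (of_int r / of_int p) holomorphic_on (- {0, of_nat k})" "F holomorphic_on (- {0, of_nat k})"
      using PF PH by (simp_all add: P_def)
  qed (use s in auto)
  thus ?thesis by (simp add: F_def)
qed

text \<open>
  The rigorous form of the statement that \<open>hatL\<close> at \<open>j + 1\<close> is the integral of \<open>f(\<tau>) (x - \<tau>)^j d\<tau>\<close> from
  \<open>x\<close> to \<open>\<i>\<infinity>\<close>: it is the difference of the finite parts of a primitive at the two ends.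
\<close>

lemma hatL_boundary_values:
  fixes x :: complex
  assumes j: "j + 2 \<le> k" and x: "x = of_int r / of_int p"
    and G: "\<And>\<tau>. Im \<tau> > 0 \<Longrightarrow> (G has_field_derivative f \<tau> * (x - \<tau>) ^ j) (at \<tau>)"
  obtains U V where
    "((\<lambda>t. G (vert t) + fcoeff 0 * (x - vert t) ^ (j + 1) / of_nat (j + 1)) \<longlongrightarrow> U) at_top"
    "((\<lambda>t. G (vert t) - cc / (of_nat (k - 1 - j) * (x - vert t) ^ (k - 1 - j))) \<longlongrightarrow> V) (at_right 0)"
    "hatL k N f (of_int r / of_int p) (of_nat (j + 1)) = U - V"
proof -
  \<comment> \<open>On the line \<open>d\<tau> = \<i> dt\<close> and \<open>x - \<tau> = - \<i> t\<close>, whence \<open>\<kappa> = \<i> (- \<i>)^j\<close>; it is also the value of \<open>- e2pi (- s / 4)\<close> at \<open>s = j + 1\<close>.\<close>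
  define \<kappa> where "\<kappa> = - ((- \<i>) ^ (j + 1))"
  have xv: "x - vert t = - \<i> * of_real t" for t
    by (simp add: x Complex_eq)
  have g: "((\<lambda>t. G (vert t)) has_vector_derivative \<kappa> * f (vert t) * of_real t ^ j) (at t)" if t: "t > 0" for t
  proof -
    have "((\<lambda>t. vert t) has_vector_derivative \<i>) (at t)"
      unfolding Complex_eq by (auto intro!: derivative_eq_intros)
    from field_vector_diff_chain_at[OF this G] t
    have "(G \<circ> (\<lambda>t. vert t) has_vector_derivative \<i> * (f (vert t) * (x - vert t) ^ j)) (at t)" by simp
    moreover have "\<i> * (f (vert t) * (x - vert t) ^ j) = \<kappa> * f (vert t) * of_real t ^ j"
      unfolding xv \<kappa>_def power_mult_distrib power_add power_one_right by (simp add: mult_ac)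
    ultimately show ?thesis by (simp only: o_def)
  qed
  obtain U V where UV:
    "((\<lambda>t. G (vert t) - \<kappa> * fcoeff 0 * of_real t ^ (j + 1) / of_nat (j + 1)) \<longlongrightarrow> U) at_top"
    "((\<lambda>t. G (vert t) + \<kappa> * (\<i> ^ k * cc) / (of_nat (k - 1 - j) * of_real t ^ (k - 1 - j))) \<longlongrightarrow> V) (at_right 0)"
    "\<kappa> * cusp_mellin (of_nat (j + 1)) = U - V"
    using reg_mellin_eq_boundary_values[OF j g] by blast
  show ?thesis
  proof (rule that)
    have e: "- (\<kappa> * a * of_real t ^ (j + 1) / b) = a * (x - vert t) ^ (j + 1) / b" for t a b
      unfolding xv \<kappa>_def power_mult_distrib by simp
    show "((\<lambda>t. G (vert t) + fcoeff 0 * (x - vert t) ^ (j + 1) / of_nat (j + 1)) \<longlongrightarrow> U) at_top"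
      using UV(1) by (simp only: e[symmetric] add_uminus_conv_diff)
    have "\<kappa> * (\<i> ^ k * cc) / (b * of_real t ^ (k - 1 - j)) = - (cc / (b * (x - vert t) ^ (k - 1 - j)))" for t b
    proof -
      define n where "n = k - 1 - j"
      have n: "k = n + (j + 1)" using j by (simp add: n_def)
      have "(- \<i>) ^ (j + 1) * \<i> ^ k = \<i> ^ n"
        unfolding n power_add[of \<i>] by (simp add: mult_ac flip: power_mult_distrib)
      moreover have "\<i> ^ n * (- \<i>) ^ n = 1" by (simp flip: power_mult_distrib)
      hence "1 / (- \<i>) ^ n = \<i> ^ n" by (simp add: field_simps)
      ultimately have i: "(- \<i>) ^ (j + 1) * \<i> ^ k = 1 / (- \<i>) ^ n" by simp
      have "\<kappa> * (\<i> ^ k * cc) / (b * of_real t ^ n) = - (((- \<i>) ^ (j + 1) * \<i> ^ k) * (cc / (b * of_real t ^ n)))"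
        by (simp add: \<kappa>_def)
      also have "\<dots> = - (cc / (b * (x - vert t) ^ n))"
        unfolding i xv power_mult_distrib by simp
      finally show ?thesis by (simp add: n_def)
    qed
    hence e': "G (vert t) + \<kappa> * (\<i> ^ k * cc) / (b * of_real t ^ (k - 1 - j))
        = G (vert t) - cc / (b * (x - vert t) ^ (k - 1 - j))" for t b by simp
    show "((\<lambda>t. G (vert t) - cc / (of_nat (k - 1 - j) * (x - vert t) ^ (k - 1 - j))) \<longlongrightarrow> V) (at_right 0)"
      using UV(2) unfolding e' .
    have "e2pi (- of_nat (j + 1) / 4) = (- \<i>) ^ (j + 1)"
    proof -
      have "2 * of_real pi * \<i> * (- 1 / 4) = \<i> * of_real (- (pi / 2))" by simp
      hence quarter: "e2pi (- 1 / 4) = - \<i>"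
        by (simp only: e2pi_def cis_conv_exp[symmetric]) (simp add: complex_eq_iff)
      have neg: "- c / 4 = c * (- 1 / 4)" for c :: complex by simp
      show ?thesis unfolding neg[of "of_nat (j + 1)"] e2pi_of_nat_mult quarter ..
    qed
    moreover have "of_nat (j + 1) \<noteq> (0 :: complex)" "of_nat (j + 1) \<noteq> (of_nat k :: complex)"
      using j unfolding of_nat_eq_iff of_nat_eq_0_iff by auto
    ultimately show "hatL k N f (of_int r / of_int p) (of_nat (j + 1)) = U - V"
      using hatL_eq[of "of_nat (j + 1)"] UV(3) by (simp add: \<kappa>_def)
  qed
qed

end

section \<open>Boundary values of primitives\<close>

text \<open>
  By the mean value inequality on the horizontal segment between the two lines.
\<close>

lemma vertical_limit_independent_of_line:
  fixes E E' :: "complex \<Rightarrow> complex"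
  assumes der: "\<And>\<tau>. Im \<tau> > 0 \<Longrightarrow> (E has_field_derivative E' \<tau>) (at \<tau>)"
    and bound: "\<And>u t. t \<ge> 1 \<Longrightarrow> u \<in> closed_segment a b \<Longrightarrow> norm (E' (Complex u t)) \<le> K / t"
    and lim: "((\<lambda>t. E (Complex a t)) \<longlongrightarrow> L) at_top"
  shows "((\<lambda>t. E (Complex b t)) \<longlongrightarrow> L) at_top"
proof -
  have le: "norm (E (Complex b t) - E (Complex a t)) \<le> K * \<bar>b - a\<bar> / t" if t: "t \<ge> 1" for t
  proof -
    define S where "S = closed_segment (Complex a t) (Complex b t)"
    have S: "Im z = t \<and> Re z \<in> closed_segment a b" if z: "z \<in> S" for z
    proof -
      obtain u where u: "0 \<le> u" "u \<le> 1" "z = (1 - u) *\<^sub>R Complex a t + u *\<^sub>R Complex b t"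
        using z by (auto simp: S_def in_segment)
      hence "Im z = t" by (simp add: left_diff_distrib)
      moreover have "Re z = (1 - u) *\<^sub>R a + u *\<^sub>R b" using u by simp
      hence "Re z \<in> closed_segment a b" using u(1,2) unfolding in_segment by blast
      ultimately show ?thesis by simp
    qed
    have "norm (E (Complex b t) - E (Complex a t)) \<le> K / t * norm (Complex b t - Complex a t)"
    proof (rule field_differentiable_bound[of S E E'])
      fix z assume z: "z \<in> S"
      have z': "z = Complex (Re z) t" using S[OF z] by (simp add: complex_eq_iff)
      show "(E has_field_derivative E' z) (at z within S)"
        using S[OF z] t by (intro has_field_derivative_at_within[OF der]) auto
      show "norm (E' z) \<le> K / t"
        by (subst z') (use S[OF z] t in \<open>auto intro: bound\<close>)
    qed (auto simp: S_def)
    also have "norm (Complex b t - Complex a t) = \<bar>b - a\<bar>"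
      by (simp add: cmod_def)
    finally show ?thesis by simp
  qed
  have "((\<lambda>t. K * \<bar>b - a\<bar> / t) \<longlongrightarrow> 0) at_top"
    by (intro tendsto_divide_0[OF tendsto_const] filterlim_at_top_imp_at_infinity filterlim_ident)
  moreover have "\<forall>\<^sub>F t in at_top. norm (E (Complex b t) - E (Complex a t)) \<le> K * \<bar>b - a\<bar> / t"
    using eventually_ge_at_top[of "1 :: real"] by eventually_elim (rule le)
  ultimately have "((\<lambda>t. E (Complex b t) - E (Complex a t)) \<longlongrightarrow> 0) at_top"
    by (rule Lim_null_comparison[rotated])
  from tendsto_add[OF this lim] show ?thesis by simp
qed

lemma filterlim_inverse_at_right_0:
  assumes "q > (0 :: real)"
  shows "filterlim (\<lambda>t. 1 / (q * t)) at_top (at_right 0)"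
    and "filterlim (\<lambda>t. 1 / (q * t)) (at_right 0) at_top"
proof -
  have "filterlim (\<lambda>t. inverse q * inverse t) at_top (at_right 0)"
    using assms by (intro filterlim_tendsto_pos_mult_at_top[OF tendsto_const] filterlim_inverse_at_top_right) auto
  thus "filterlim (\<lambda>t. 1 / (q * t)) at_top (at_right 0)" by (simp add: field_simps)
  have "filterlim (\<lambda>t. q * t) at_top at_top"
    using assms by (intro filterlim_tendsto_pos_mult_at_top[OF tendsto_const _ filterlim_ident])
  from filterlim_compose[OF filterlim_inverse_at_right_top this]
  show "filterlim (\<lambda>t. 1 / (q * t)) (at_right 0) at_top" by (simp add: inverse_eq_divide)
qed

text \<open>
  Both sides are the primitive in \<open>z\<close> of \<open>(X + z)^n\<close> that vanishes at \<open>z = 0\<close>.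
\<close>

lemma sum_binomial_antiderivative:
  fixes X z :: complex
  shows "(\<Sum>j=0..n. of_nat (n choose j) * X ^ (n - j) * z ^ (j + 1) / of_nat (j + 1))
         = ((X + z) ^ (n + 1) - X ^ (n + 1)) / of_nat (n + 1)"
proof -
  have "of_nat (n + 1) * (\<Sum>j=0..n. of_nat (n choose j) * X ^ (n - j) * z ^ (j + 1) / of_nat (j + 1))
      = (\<Sum>j=0..n. of_nat (Suc n choose Suc j) * z ^ Suc j * X ^ (Suc n - Suc j))"
    unfolding sum_distrib_left
  proof (rule sum.cong[OF refl])
    fix j
    have "Suc j * (Suc n choose Suc j) = Suc n * (n choose j)"
      by (rule Suc_times_binomial)
    hence "(of_nat (Suc j) :: complex) * of_nat (Suc n choose Suc j) = of_nat (Suc n) * of_nat (n choose j)"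
      by (metis of_nat_mult)
    hence "(of_nat (Suc n choose Suc j) :: complex) = of_nat (Suc n) * of_nat (n choose j) / of_nat (Suc j)"
      by (simp add: eq_divide_eq mult.commute del: of_nat_Suc binomial_Suc_Suc)
    thus "of_nat (n + 1) * (of_nat (n choose j) * X ^ (n - j) * z ^ (j + 1) / of_nat (j + 1))
       = of_nat (Suc n choose Suc j) * z ^ Suc j * X ^ (Suc n - Suc j)"
      by (simp del: of_nat_Suc binomial_Suc_Suc)
  qed
  also have "\<dots> = (z + X) ^ Suc n - X ^ Suc n"
  proof -
    have "(z + X) ^ Suc n = (\<Sum>j\<le>Suc n. of_nat (Suc n choose j) * z ^ j * X ^ (Suc n - j))"
      by (rule binomial_ring)
    also have "\<dots> = X ^ Suc n + (\<Sum>j\<le>n. of_nat (Suc n choose Suc j) * z ^ Suc j * X ^ (Suc n - Suc j))"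
      by (subst sum.atMost_Suc_shift) simp
    finally show ?thesis by (simp add: atLeast0AtMost)
  qed
  finally show ?thesis
    by (simp add: eq_divide_eq mult.commute add.commute del: of_nat_Suc)
qed

text \<open>
  Both sides are the primitive in \<open>z\<close> of \<open>- (X + z)^n / z^(n+2)\<close> that vanishes at infinity. The proof
  substitutes \<open>X / z\<close> in the previous identity.
\<close>

lemma sum_binomial_pole_antiderivative:
  fixes X z :: complex
  assumes "X \<noteq> 0" "z \<noteq> 0"
  shows "(\<Sum>j=0..n. of_nat (n choose j) * X ^ (n - j) / (of_nat (n + 1 - j) * z ^ (n + 1 - j)))
         = (((X + z) / z) ^ (n + 1) - 1) / (of_nat (n + 1) * X)"
proof -
  have "(\<Sum>j=0..n. of_nat (n choose j) * X ^ (n - j) / (of_nat (n + 1 - j) * z ^ (n + 1 - j)))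
     = (\<Sum>i=0..n. of_nat (n choose i) * X ^ i / (of_nat (i + 1) * z ^ (i + 1)))"
    by (rule sum.reindex_bij_witness[of _ "\<lambda>i. n - i" "\<lambda>j. n - j"]) (auto simp: binomial_symmetric[symmetric] Suc_diff_le)
  also have "\<dots> = (\<Sum>i=0..n. of_nat (n choose i) * 1 ^ (n - i) * (X / z) ^ (i + 1) / of_nat (i + 1)) / X"
    unfolding sum_divide_distrib using assms by (intro sum.cong) (auto simp: power_divide)
  also have "\<dots> = ((1 + X / z) ^ (n + 1) - 1 ^ (n + 1)) / of_nat (n + 1) / X"
    by (subst sum_binomial_antiderivative) (rule refl)
  also have "1 + X / z = (X + z) / z" using assms by (simp add: field_simps)
  finally show ?thesis by simp
qed

context modular_form_level
begin

lemma primitive_exists: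
  obtains g where "\<And>\<tau>. Im \<tau> > 0 \<Longrightarrow> (g has_field_derivative f \<tau> * (x - \<tau>) ^ j) (at \<tau>)"
proof -
  have op: "open {\<tau>. Im \<tau> > 0}" by (rule open_halfspace_Im_gt)
  have "(\<lambda>\<tau>. f \<tau> * (x - \<tau>) ^ j) holomorphic_on {\<tau>. Im \<tau> > 0}"
    by (intro holomorphic_intros holomorphic)
  then obtain g where "\<And>\<tau>. \<tau> \<in> {\<tau>. Im \<tau> > 0} \<Longrightarrow>
      (g has_field_derivative f \<tau> * (x - \<tau>) ^ j) (at \<tau> within {\<tau>. Im \<tau> > 0})"
    using holomorphic_convex_primitive'[OF convex_halfspace_Im_gt op] by blast
  thus ?thesis using that at_within_open[OF _ op] by auto
qed

lemma f_minus_constant_term_decay: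
  obtains K where "\<And>u t. t \<ge> 1 \<Longrightarrow> u \<in> closed_segment a b \<Longrightarrow>
     norm ((f (Complex u t) - fcoeff 0) * (x - Complex u t) ^ n) \<le> K / t"
proof -
  obtain C e where C: "C \<ge> 0" "e > 0" "\<And>\<tau>. Im \<tau> \<ge> 1 \<Longrightarrow> norm (f \<tau> - fcoeff 0) \<le> C * exp (- e * Im \<tau>)"
    using f_decay[OF zero_less_one] by blast
  define R where "R = norm x + \<bar>a\<bar> + \<bar>b\<bar> + 1"
  have R: "R \<ge> 0" by (simp add: R_def)
  have "norm ((f (Complex u t) - fcoeff 0) * (x - Complex u t) ^ n) \<le> (C * (fact (n + 1) / e ^ (n + 1)) * R ^ n) / t"
    if t: "t \<ge> 1" and u: "u \<in> closed_segment a b" for u t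
  proof -
    have "\<bar>u\<bar> \<le> \<bar>a\<bar> + \<bar>b\<bar>" using u by (auto simp: closed_segment_eq_real_ivl split: if_splits)
    moreover have "norm (x - Complex u t) \<le> norm x + (\<bar>u\<bar> + \<bar>t\<bar>)"
      using norm_triangle_ineq4[of x "Complex u t"] cmod_le[of "Complex u t"] by simp
    ultimately have "norm (x - Complex u t) \<le> (R - 1) * 1 + 1 * t" using t by (simp add: R_def)
    also have "\<dots> \<le> (R - 1) * t + 1 * t"
      using t by (intro add_mono mult_left_mono) (auto simp: R_def)
    finally have le: "norm (x - Complex u t) \<le> R * t" by (simp add: algebra_simps)
    have "norm (f (Complex u t) - fcoeff 0) \<le> C * exp (- (e * t))" using C(3)[of "Complex u t"] t by simp
    also have "\<dots> \<le> C * (fact (n + 1) / (e * t) ^ (n + 1))"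
      using C t by (intro mult_left_mono exp_minus_le) auto
    finally have "norm (f (Complex u t) - fcoeff 0) * norm (x - Complex u t) ^ n
        \<le> C * (fact (n + 1) / (e * t) ^ (n + 1)) * (R * t) ^ n"
      using le C t by (intro mult_mono power_mono) auto
    also have "\<dots> = (C * (fact (n + 1) / e ^ (n + 1)) * R ^ n) / t"
      using t C by (simp add: power_mult_distrib field_simps)
    finally show ?thesis by (simp add: norm_mult norm_power)
  qed
  thus ?thesis using that by blast
qed

lemma regularised_primitive_derivative:
  assumes "(G has_field_derivative f \<tau> * (x - \<tau>) ^ n) (at \<tau>)"
  shows "((\<lambda>\<tau>. G \<tau> + fcoeff 0 * (x - \<tau>) ^ (n + 1) / of_nat (n + 1)) has_field_derivative
           (f \<tau> - fcoeff 0) * (x - \<tau>) ^ n) (at \<tau>)"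
proof -
  have "((\<lambda>\<tau>. (x - \<tau>) ^ (n + 1)) has_field_derivative of_nat (n + 1) * ((0 - 1) * (x - \<tau>) ^ (n + 1 - Suc 0))) (at \<tau>)"
    by (intro DERIV_power DERIV_diff DERIV_const DERIV_ident)
  from DERIV_add[OF assms DERIV_cdivide[OF DERIV_cmult[OF this, of "fcoeff 0"], of "of_nat (n + 1)"]]
  show ?thesis by (rule DERIV_cong) (simp add: algebra_simps del: of_nat_Suc of_nat_add)
qed

lemma limit_at_infinity_independent_of_line:
  assumes G: "\<And>\<tau>. Im \<tau> > 0 \<Longrightarrow> (G has_field_derivative f \<tau> * (x - \<tau>) ^ n) (at \<tau>)"
    and lim: "((\<lambda>t. G (Complex a t) + fcoeff 0 * (x - Complex a t) ^ (n + 1) / of_nat (n + 1)) \<longlongrightarrow> L) at_top"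
  shows "((\<lambda>t. G (Complex b t) + fcoeff 0 * (x - Complex b t) ^ (n + 1) / of_nat (n + 1)) \<longlongrightarrow> L) at_top"
proof -
  obtain K where "\<And>u t. t \<ge> 1 \<Longrightarrow> u \<in> closed_segment a b \<Longrightarrow>
     norm ((f (Complex u t) - fcoeff 0) * (x - Complex u t) ^ n) \<le> K / t"
    using f_minus_constant_term_decay[of a b x n] by blast
  thus ?thesis
    using vertical_limit_independent_of_line[OF regularised_primitive_derivative[OF G] _ lim, of b K] by simp
qed

lemma cusp_const_Gamma:
  assumes "g \<in> \<Gamma>" "A \<in> carrier SL2Z"
  shows "cusp_const k f ((g ** A) $ 1 $ 1) ((g ** A) $ 2 $ 1) = cusp_const k f (A $ 1 $ 1) (A $ 2 $ 1)"
proof -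
  obtain M a where M: "M \<ge> 1" "fourier_expansion M (slash k f A) a" by (rule slash_expansion[OF assms(2)])
  have "fourier_expansion M (slash k f (g ** A)) a"
    using M(2) by (simp add: fourier_expansion_def slash_invariant[OF assms])
  from cusp_const_eq[OF SL2Z_mult[OF Gamma_SL2Z[OF assms(1)] assms(2)] refl refl M(1) this]
    cusp_const_eq[OF assms(2) refl refl M] show ?thesis by simp
qed

text \<open>
  The inverse of \<open>g\<close> has this first column and leaves \<open>f\<close> invariant, so its constant term is that of
  \<open>f\<close> at infinity.
\<close>

lemma cusp_const_infinity:
  assumes "g \<in> \<Gamma>"
  shows "cusp_const k f (g $ 2 $ 2) (- (g $ 2 $ 1)) = fcoeff 0"
proof -
  define g' where "g' = mat2 (g $ 2 $ 2) (- (g $ 1 $ 2)) (- (g $ 2 $ 1)) (g $ 1 $ 1)"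
  note adj = SL2Z_adjugate[OF Gamma_SL2Z[OF assms], folded g'_def]
  have one: "mat 1 \<in> carrier SL2Z" by (simp add: SL2Z_carrier_iff mat_def)
  have sl: "slash k f (mat 1) = f" by (simp add: fun_eq_iff slash_def mat_def)
  have "slash k f g' \<tau> = f \<tau>" if "Im \<tau> > 0" for \<tau>
    using slash_invariant[OF assms adj(1) that] by (simp add: adj sl)
  hence "fourier_expansion N (slash k f g') fcoeff"
    using expansion by (simp add: fourier_expansion_def)
  from cusp_const_eq[OF adj(1) refl refl N this] show ?thesis by (simp add: g'_def)
qed

end

section \<open>The cocycle relation\<close>

text \<open>
  Three cusps occur: the source \<open>x = r/p\<close>, its image under \<open>\<gamma>\<close>, and the pole \<open>y0 = - d / c\<close> of \<open>\<gamma>\<close>. The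
  exponent \<open>k - 2\<close> is a variable \<open>n\<close> of its own to keep truncated subtraction out of the algebra.
\<close>

locale reciprocity_data = modular_form_level +
  fixes r p :: int and \<gamma> :: "int ^ 2 ^ 2" and a b c d :: int and n :: nat
  assumes coprime: "coprime r p" and p: "p \<noteq> 0" and \<gamma>: "\<gamma> \<in> \<Gamma>"
    and entries: "a = \<gamma> $ 1 $ 1" "b = \<gamma> $ 1 $ 2" "c = \<gamma> $ 2 $ 1" "d = \<gamma> $ 2 $ 2"
    and c: "c \<noteq> 0" and crdp: "c * r + d * p \<noteq> 0" and k_eq: "k = n + 2"
begin

lemma \<gamma>_SL2Z: "\<gamma> \<in> carrier SL2Z"
  by (rule Gamma_SL2Z[OF \<gamma>])

lemma det: "a * d - b * c = 1"
  using \<gamma>_SL2Z by (simp add: SL2Z_carrier_iff entries)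

lemma coprime_image: "coprime (a * r + b * p) (c * r + d * p)"
proof (rule coprimeI)
  fix q assume q: "q dvd a * r + b * p" "q dvd c * r + d * p"
  have "d * (a * r + b * p) - b * (c * r + d * p) = r * (a * d - b * c)"
    "a * (c * r + d * p) - c * (a * r + b * p) = p * (a * d - b * c)"
    by (simp_all add: algebra_simps)
  hence "q dvd r" "q dvd p"
    using q unfolding det mult_1_right by (metis dvd_diff dvd_mult)+
  thus "is_unit q" by (rule coprime_common_divisor[OF coprime])
qed

lemma coprime_pole: "coprime d (- c)"
proof (rule coprimeI)
  fix q assume "q dvd d" "q dvd - c"
  hence "q dvd a * d - b * c" by (intro dvd_diff dvd_mult) auto
  thus "is_unit q" by (simp add: det)
qed

sublocale src: modular_form_cusp k N \<Gamma> f r p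
  by unfold_locales (fact coprime p)+

sublocale img: modular_form_cusp k N \<Gamma> f "a * r + b * p" "c * r + d * p"
  by unfold_locales (fact coprime_image crdp)+

sublocale pole: modular_form_cusp k N \<Gamma> f d "- c"
  by unfold_locales (use coprime_pole c in auto)

definition "x = complex_of_int r / of_int p"
definition "w0 = of_int c * x + of_int d"
definition "y0 = complex_of_int d / of_int (- c)"
lemma w0_eq: "w0 = of_int (c * r + d * p) / of_int p"
  using p by (simp add: w0_def x_def field_simps)

lemma w0_nonzero: "w0 \<noteq> 0"
  using crdp p unfolding w0_eq by (simp del: of_int_add of_int_mult)

lemma x_minus_y0: "x - y0 = w0 / of_int c"
  using c by (simp add: w0_def y0_def field_simps)

lemma den_eq: "den \<gamma> w = of_int c * w + of_int d"
  by (simp add: den_def entries)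

lemma den_x: "den \<gamma> x = w0"
  by (simp add: den_eq w0_def)

lemma den_eq_y0: "den \<gamma> w = - of_int c * (y0 - w)"
  using c by (simp add: den_eq y0_def right_diff_distrib)

lemma den_eq_x: "den \<gamma> w = w0 - of_int c * (x - w)"
  by (simp add: den_eq w0_def algebra_simps)

definition "gx = moebius_act \<gamma> x"

lemma gx_eq: "gx = of_int (a * r + b * p) / of_int (c * r + d * p)"
proof -
  have "gx = (of_int a * x + of_int b) / w0"
    by (simp add: gx_def moebius_act_def den_x entries)
  also have "of_int a * x + of_int b = of_int (a * r + b * p) / of_int p"
    using p by (simp add: x_def field_simps)
  finally show ?thesis using p by (simp add: w0_eq del: of_int_add of_int_mult)
qed

lemma gx_diff:
  assumes "Im w > 0"
  shows "gx - moebius_act \<gamma> w = (x - w) / (w0 * den \<gamma> w)"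
  unfolding gx_def using moebius_diff[OF \<gamma>_SL2Z, of x w] den_nonzero[OF \<gamma>_SL2Z assms] w0_nonzero
  by (simp add: den_x)

lemma src_cc: "src.cc = cusp_const k f r p / of_int p ^ k"
  by (rule src.cc_def)

lemma pole_cc: "pole.cc = fcoeff 0 / (- of_int c) ^ k"
  unfolding pole.cc_def using cusp_const_infinity[OF \<gamma>] by (simp flip: entries)

lemma img_cc: "img.cc = src.cc / w0 ^ k"
proof -
  obtain A where A: "A \<in> carrier SL2Z" "A $ 1 $ 1 = r" "A $ 2 $ 1 = p"
    using SL2Z_with_first_column[OF coprime] .
  have "cusp_const k f (a * r + b * p) (c * r + d * p) = cusp_const k f r p"
    using cusp_const_Gamma[OF \<gamma> A(1)] by (simp add: mult2_nth A entries)
  thus ?thesis using p by (simp add: img.cc_def src.cc_def w0_eq power_divide del: of_int_add of_int_mult)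
qed

text \<open>
  The primitives whose finite parts are the values of \<open>hatL\<close> at the pole.
\<close>

definition prim :: "nat \<Rightarrow> complex \<Rightarrow> complex" where
  "prim j = (SOME g. \<forall>\<tau>. Im \<tau> > 0 \<longrightarrow> (g has_field_derivative f \<tau> * (y0 - \<tau>) ^ j) (at \<tau>))"

lemma prim: "Im \<tau> > 0 \<Longrightarrow> (prim j has_field_derivative f \<tau> * (y0 - \<tau>) ^ j) (at \<tau>)"
proof -
  have "\<exists>g. \<forall>\<tau>. Im \<tau> > 0 \<longrightarrow> (g has_field_derivative f \<tau> * (y0 - \<tau>) ^ j) (at \<tau>)"
    using primitive_exists[of y0 j] by metis
  from someI_ex[OF this] show "Im \<tau> > 0 \<Longrightarrow> (prim j has_field_derivative f \<tau> * (y0 - \<tau>) ^ j) (at \<tau>)"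
    unfolding prim_def by blast
qed

definition "bc j = of_nat (n choose j) * (x - y0) ^ (n - j)"

text \<open>
  Taking the combination of the functions \<open>prim j\<close> as the primitive of \<open>f(\<tau>) (x - \<tau>)^n\<close> leaves no
  constant of integration to be compared.
\<close>

definition "G \<tau> = (\<Sum>j=0..n. bc j * prim j \<tau>)"

lemma G:
  assumes "Im \<tau> > 0"
  shows "(G has_field_derivative f \<tau> * (x - \<tau>) ^ n) (at \<tau>)"
proof -
  have "((\<lambda>\<tau>. \<Sum>j=0..n. bc j * prim j \<tau>) has_field_derivative (\<Sum>j=0..n. bc j * (f \<tau> * (y0 - \<tau>) ^ j))) (at \<tau>)"
    by (intro DERIV_sum DERIV_cmult prim assms)
  also have "(\<Sum>j=0..n. bc j * (f \<tau> * (y0 - \<tau>) ^ j))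
      = f \<tau> * (\<Sum>j\<le>n. of_nat (n choose j) * (y0 - \<tau>) ^ j * (x - y0) ^ (n - j))"
    by (simp add: sum_distrib_left bc_def atLeast0AtMost mult_ac)
  also have "\<dots> = f \<tau> * ((y0 - \<tau>) + (x - y0)) ^ n"
    by (subst binomial_ring) (rule refl)
  finally show ?thesis by (simp add: G_def [abs_def])
qed

abbreviation "\<gamma>inv \<equiv> mat2 (\<gamma> $ 2 $ 2) (- (\<gamma> $ 1 $ 2)) (- (\<gamma> $ 2 $ 1)) (\<gamma> $ 1 $ 1)"

definition "H \<tau> = G (moebius_act \<gamma>inv \<tau>) / w0 ^ n"

lemma H_image: "Im w > 0 \<Longrightarrow> H (moebius_act \<gamma> w) = G w / w0 ^ n"
  using moebius_adjugate(2)[OF \<gamma>_SL2Z] by (simp add: H_def)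

text \<open>
  With \<open>\<tau> = \<gamma>w\<close>, the factor \<open>(c w + d)^k\<close> of \<open>f(\<gamma>w)\<close> cancels against \<open>(c w + d)^(-n)\<close> from
  \<open>(\<gamma>x - \<gamma>w)^n\<close> and \<open>(c w + d)^(-2)\<close> from \<open>d\<tau>\<close>.
\<close>

lemma H:
  assumes "Im \<tau> > 0"
  shows "(H has_field_derivative f \<tau> * (gx - \<tau>) ^ n) (at \<tau>)"
proof -
  define w where "w = moebius_act \<gamma>inv \<tau>"
  have inv: "\<gamma>inv \<in> carrier SL2Z" by (rule SL2Z_adjugate(1)[OF \<gamma>_SL2Z])
  have w: "Im w > 0" unfolding w_def by (rule Im_moebius_pos[OF inv assms])
  have gw: "moebius_act \<gamma> w = \<tau>" and dw: "den \<gamma> w * den \<gamma>inv \<tau> = 1"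
    using moebius_adjugate(1,3)[OF \<gamma>_SL2Z assms] by (simp_all add: w_def)
  have nz: "den \<gamma> w \<noteq> 0" "den \<gamma>inv \<tau> \<noteq> 0" using dw by auto
  have "((\<lambda>\<tau>. G (moebius_act \<gamma>inv \<tau>) / w0 ^ n) has_field_derivative
      (f w * (x - w) ^ n) * (1 / den \<gamma>inv \<tau> ^ 2) / w0 ^ n) (at \<tau>)"
    unfolding w_def
    by (intro DERIV_cdivide DERIV_chain2[OF G] moebius_has_field_derivative inv assms w[unfolded w_def])
  also have "1 / den \<gamma>inv \<tau> ^ 2 = den \<gamma> w ^ 2"
  proof -
    have "1 / den \<gamma>inv \<tau> = den \<gamma> w" using dw nz by (simp add: divide_eq_eq)
    thus ?thesis by (simp only: power_one_over[symmetric])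
  qed
  also have "(f w * (x - w) ^ n) * den \<gamma> w ^ 2 / w0 ^ n = f \<tau> * (gx - \<tau>) ^ n"
  proof -
    have "f \<tau> = den \<gamma> w ^ n * den \<gamma> w ^ 2 * f w"
      using transformation[OF \<gamma> w] by (simp only: gw k_eq power_add)
    moreover have "gx - \<tau> = (x - w) / (w0 * den \<gamma> w)"
      using gx_diff[OF w] by (simp add: gw)
    ultimately show ?thesis using nz w0_nonzero by (simp add: power_divide power_mult_distrib)
  qed
  finally show ?thesis by (simp add: H_def [abs_def])
qed

text \<open>
  The subtracted primitives of \<open>(y0 - \<tau>)^j\<close> vanish at \<open>y0\<close>, whereas that of \<open>(x - \<tau>)^n\<close> vanishes at
  \<open>x\<close>. The finite parts therefore differ by \<open>a\<^sub>0\<close> times the value of \<open>(x - \<tau>)^(n+1) / (n+1)\<close> at \<open>y0\<close>.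
\<close>

lemma pole_value_at_infinity:
  assumes "\<And>j. j \<le> n \<Longrightarrow> ((\<lambda>t. prim j (pole.vert t) + fcoeff 0 * (y0 - pole.vert t) ^ (j + 1) / of_nat (j + 1)) \<longlongrightarrow> U j) at_top"
    and "((\<lambda>t. G (src.vert t) + fcoeff 0 * (x - src.vert t) ^ (n + 1) / of_nat (n + 1)) \<longlongrightarrow> U1) at_top"
  shows "U1 = (\<Sum>j=0..n. bc j * U j) + fcoeff 0 * (x - y0) ^ (n + 1) / of_nat (n + 1)"
proof -
  let ?w = "\<lambda>t. pole.vert t"
  have "((\<lambda>t. \<Sum>j=0..n. bc j * (prim j (?w t) + fcoeff 0 * (y0 - ?w t) ^ (j + 1) / of_nat (j + 1)))
      \<longlongrightarrow> (\<Sum>j=0..n. bc j * U j)) at_top"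
    by (intro tendsto_sum tendsto_mult_left assms(1)) auto
  moreover have "(\<Sum>j=0..n. bc j * (prim j w + fcoeff 0 * (y0 - w) ^ (j + 1) / of_nat (j + 1)))
     = G w + fcoeff 0 * (x - w) ^ (n + 1) / of_nat (n + 1) - fcoeff 0 * (x - y0) ^ (n + 1) / of_nat (n + 1)" for w
  proof -
    have "(\<Sum>j=0..n. bc j * (prim j w + fcoeff 0 * (y0 - w) ^ (j + 1) / of_nat (j + 1)))
       = G w + fcoeff 0 * (\<Sum>j=0..n. of_nat (n choose j) * (x - y0) ^ (n - j) * (y0 - w) ^ (j + 1) / of_nat (j + 1))"
      by (simp add: G_def distrib_left sum.distrib sum_distrib_left bc_def mult_ac del: of_nat_Suc)
    also have "(\<Sum>j=0..n. of_nat (n choose j) * (x - y0) ^ (n - j) * (y0 - w) ^ (j + 1) / of_nat (j + 1))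
       = ((x - w) ^ (n + 1) - (x - y0) ^ (n + 1)) / of_nat (n + 1)"
      by (subst sum_binomial_antiderivative) simp
    finally show ?thesis by (simp add: diff_divide_distrib right_diff_distrib del: of_nat_Suc)
  qed
  ultimately have "((\<lambda>t. G (?w t) + fcoeff 0 * (x - ?w t) ^ (n + 1) / of_nat (n + 1)
       - fcoeff 0 * (x - y0) ^ (n + 1) / of_nat (n + 1)) \<longlongrightarrow> (\<Sum>j=0..n. bc j * U j)) at_top"
    by (simp only:)
  moreover have "((\<lambda>t. G (?w t) + fcoeff 0 * (x - ?w t) ^ (n + 1) / of_nat (n + 1)
       - fcoeff 0 * (x - y0) ^ (n + 1) / of_nat (n + 1)) \<longlongrightarrow> U1 - fcoeff 0 * (x - y0) ^ (n + 1) / of_nat (n + 1)) at_top"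
    by (intro tendsto_diff tendsto_const limit_at_infinity_independent_of_line[OF G assms(2)])
  ultimately have "(\<Sum>j=0..n. bc j * U j) = U1 - fcoeff 0 * (x - y0) ^ (n + 1) / of_nat (n + 1)"
    by (rule tendsto_unique[OF trivial_limit_at_top_linorder])
  thus ?thesis by (simp add: algebra_simps)
qed

lemma vert_moebius:
  assumes A: "A \<in> carrier SL2Z" "A $ 2 $ 1 \<noteq> 0" and v: "v > 0"
  shows "moebius_act A (Complex (- of_int (A $ 2 $ 2) / of_int (A $ 2 $ 1)) v)
         = Complex (of_int (A $ 1 $ 1) / of_int (A $ 2 $ 1)) (1 / (of_int (A $ 2 $ 1) ^ 2 * v))"
  by (rule moebius_vertical_line(2)[OF A(1) refl A(2) v])

text \<open>
  Since \<open>\<gamma>\<close> maps the vertical line over \<open>y0\<close> to the one over \<open>a / c\<close> and its lower end to infinity, the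
  finite part of \<open>H\<close> at infinity can be read off from \<open>G\<close> at \<open>y0\<close>. Both subtracted functions are
  multiples of \<open>((x - w) / (y0 - w))^(n+1)\<close> up to a constant, and that constant, the \<open>- 1\<close> in
  \<open>sum_binomial_pole_antiderivative\<close>, is the second term with \<open>a\<^sub>0\<close> in the period polynomial.
\<close>

lemma pole_value_at_pole:
  assumes lim: "\<And>j. j \<le> n \<Longrightarrow> ((\<lambda>t. prim j (pole.vert t) - pole.cc / (of_nat (k - 1 - j) * (y0 - pole.vert t) ^ (k - 1 - j))) \<longlongrightarrow> V j) (at_right 0)"
    and limU: "((\<lambda>t. H (img.vert t) + fcoeff 0 * (gx - img.vert t) ^ (n + 1) / of_nat (n + 1)) \<longlongrightarrow> U2) at_top"
  shows "(\<Sum>j=0..n. bc j * V j) = w0 ^ n * U2 - fcoeff 0 / (of_nat (n + 1) * (- of_int c) ^ (n + 1) * w0)"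
proof -
  let ?w = "\<lambda>t. pole.vert t"
  let ?a0 = "fcoeff 0" and ?m = "of_nat (n + 1) :: complex"
  have X: "x - y0 \<noteq> 0" using w0_nonzero c by (simp add: x_minus_y0)
  have "((\<lambda>t. \<Sum>j=0..n. bc j * (prim j (?w t) - pole.cc / (of_nat (k - 1 - j) * (y0 - ?w t) ^ (k - 1 - j))))
      \<longlongrightarrow> (\<Sum>j=0..n. bc j * V j)) (at_right 0)"
    by (intro tendsto_sum tendsto_mult_left lim) auto
  moreover have ev0: "\<forall>\<^sub>F t :: real in at_right 0. t > 0" by (rule eventually_at_right_less)
  hence "\<forall>\<^sub>F t in at_right 0. (\<Sum>j=0..n. bc j * (prim j (?w t) - pole.cc / (of_nat (k - 1 - j) * (y0 - ?w t) ^ (k - 1 - j))))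
     = w0 ^ n * (H (moebius_act \<gamma> (?w t)) + ?a0 * (gx - moebius_act \<gamma> (?w t)) ^ (n + 1) / ?m)
       - ?a0 / (?m * (- of_int c) ^ (n + 1) * w0)"
  proof eventually_elim
    case (elim t)
    define w where "w = ?w t"
    have w: "Im w > 0" using elim by (simp add: w_def)
    define z where "z = y0 - w"
    have dz: "den \<gamma> w = - of_int c * z" by (simp add: den_eq_y0 z_def)
    have z: "z \<noteq> 0" using den_nonzero[OF \<gamma>_SL2Z w] dz by auto
    have "(\<Sum>j=0..n. bc j * (prim j w - pole.cc / (of_nat (k - 1 - j) * z ^ (k - 1 - j))))
       = G w - pole.cc * (\<Sum>j=0..n. of_nat (n choose j) * (x - y0) ^ (n - j) / (of_nat (n + 1 - j) * z ^ (n + 1 - j)))"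
      by (simp add: G_def right_diff_distrib sum_subtractf sum_distrib_left bc_def k_eq mult_ac del: of_nat_Suc)
    also have "(\<Sum>j=0..n. of_nat (n choose j) * (x - y0) ^ (n - j) / (of_nat (n + 1 - j) * z ^ (n + 1 - j)))
       = (((x - y0 + z) / z) ^ (n + 1) - 1) / (?m * (x - y0))"
      by (rule sum_binomial_pole_antiderivative[OF X z])
    also have "x - y0 + z = x - w" by (simp add: z_def)
    also have "pole.cc * ((((x - w) / z) ^ (n + 1) - 1) / (?m * (x - y0)))
        = - (?a0 / (?m * (- of_int c) ^ (n + 1) * w0)) * (((x - w) / z) ^ (n + 1) - 1)"
    proof -
      have "pole.cc / (?m * (x - y0)) = - (?a0 / (?m * (- of_int c) ^ (n + 1) * w0))"
      proof -
        have "(- of_int c :: complex) ^ k = (- of_int c) ^ (n + 1) * - of_int c"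
          by (simp add: k_eq)
        moreover have "h / (Q * - C) / (m * (w / C)) = - (h / (m * Q * w))" if "C \<noteq> 0" for h Q C m w :: complex
          using that by simp
        ultimately show ?thesis unfolding pole_cc x_minus_y0 using c by (simp only: of_int_eq_0_iff not_False_eq_True)
      qed
      moreover have "pole.cc * (Y / (?m * (x - y0))) = pole.cc / (?m * (x - y0)) * Y" for Y by simp
      ultimately show ?thesis by (simp only:)
    qed
    also have "G w - - (?a0 / (?m * (- of_int c) ^ (n + 1) * w0)) * (((x - w) / z) ^ (n + 1) - 1)
        = G w + ?a0 / (?m * (- of_int c) ^ (n + 1) * w0) * ((x - w) / z) ^ (n + 1) - ?a0 / (?m * (- of_int c) ^ (n + 1) * w0)"
    proof -
      have "h - (- P) * (Q - 1) = h + P * Q - P" for h P Q :: complex by (simp add: algebra_simps)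
      thus ?thesis .
    qed
    also have "G w + ?a0 / (?m * (- of_int c) ^ (n + 1) * w0) * ((x - w) / z) ^ (n + 1)
        = w0 ^ n * (H (moebius_act \<gamma> w) + ?a0 * (gx - moebius_act \<gamma> w) ^ (n + 1) / ?m)"
    proof -
      have "w0 ^ n * (H (moebius_act \<gamma> w)) = G w"
        using w0_nonzero by (simp add: H_image[OF w])
      moreover have "w0 ^ n * (?a0 * (gx - moebius_act \<gamma> w) ^ (n + 1) / ?m)
          = ?a0 / (?m * (- of_int c) ^ (n + 1) * w0) * ((x - w) / z) ^ (n + 1)"
      proof -
        have "(gx - moebius_act \<gamma> w) ^ (n + 1) = (x - w) ^ (n + 1) / (w0 ^ n * w0 * ((- of_int c) ^ (n + 1) * z ^ (n + 1)))"
          unfolding gx_diff[OF w] dz power_divide power_mult_distrib by (simp only: power_add power_one_right)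
        moreover have "w0 ^ n * (?a0 * (P / (w0 ^ n * w0 * (Q * Z))) / ?m) = ?a0 / (?m * Q * w0) * (P / Z)" for P Q Z
          using w0_nonzero by simp
        ultimately show ?thesis by (simp only: power_divide)
      qed
      ultimately show ?thesis by (simp only: distrib_left)
    qed
    finally show ?case by (simp only: w_def z_def)
  qed
  ultimately have "((\<lambda>t. w0 ^ n * (H (moebius_act \<gamma> (?w t)) + ?a0 * (gx - moebius_act \<gamma> (?w t)) ^ (n + 1) / ?m)
       - ?a0 / (?m * (- of_int c) ^ (n + 1) * w0)) \<longlongrightarrow> (\<Sum>j=0..n. bc j * V j)) (at_right 0)"
    by (rule Lim_transform_eventually)
  moreover have "((\<lambda>t. w0 ^ n * (H (moebius_act \<gamma> (?w t)) + ?a0 * (gx - moebius_act \<gamma> (?w t)) ^ (n + 1) / ?m)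
       - ?a0 / (?m * (- of_int c) ^ (n + 1) * w0)) \<longlongrightarrow> w0 ^ n * U2 - ?a0 / (?m * (- of_int c) ^ (n + 1) * w0)) (at_right 0)"
  proof (intro tendsto_diff tendsto_const tendsto_mult_left)
    let ?E = "\<lambda>\<tau>. H \<tau> + ?a0 * (gx - \<tau>) ^ (n + 1) / ?m"
    have "((\<lambda>s. ?E (Complex (of_int a / of_int c) s)) \<longlongrightarrow> U2) at_top"
      by (rule limit_at_infinity_independent_of_line[OF H limU])
    moreover have "filterlim (\<lambda>t. 1 / (real_of_int c ^ 2 * t)) at_top (at_right 0)"
      using c by (intro filterlim_inverse_at_right_0) simp
    ultimately have "((\<lambda>t. ?E (Complex (of_int a / of_int c) (1 / (real_of_int c ^ 2 * t)))) \<longlongrightarrow> U2) (at_right 0)"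
      by (rule filterlim_compose)
    moreover have "\<forall>\<^sub>F t in at_right 0. ?E (Complex (of_int a / of_int c) (1 / (real_of_int c ^ 2 * t))) = ?E (moebius_act \<gamma> (?w t))"
      using ev0
    proof eventually_elim
      case (elim t)
      have "moebius_act \<gamma> (?w t) = Complex (of_int a / of_int c) (1 / (real_of_int c ^ 2 * t))"
        using vert_moebius[OF \<gamma>_SL2Z _ elim] c by (simp add: entries)
      thus ?case by (simp only:)
    qed
    ultimately show "((\<lambda>t. ?E (moebius_act \<gamma> (?w t))) \<longlongrightarrow> U2) (at_right 0)"
      by (rule Lim_transform_eventually)
  qed
  ultimately show ?thesis by (rule tendsto_unique[OF trivial_limit_at_right_real])
qed

text \<open>
  In the coordinate \<open>z\<close> with \<open>w = Az\<close> and \<open>A\<infinity> = x\<close>, the regularised primitive \<open>E\<close> has the derivative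
  \<open>p^(2-k) (slash k f A z - const)\<close>, which decays as \<open>z\<close> goes to infinity. The vertical lines over \<open>x\<close> and
  over \<open>\<gamma>x\<close> are vertical lines in \<open>z\<close>, because \<open>\<gamma>A\<close> serves for the image cusp; so \<open>E\<close> has the same
  limit along both. The term that regularises \<open>H\<close> at \<open>\<gamma>x\<close>, times \<open>w0^n\<close>, pulls
  back to \<open>cc / (x - w) - cc c / w0\<close>, and its constant part is the last term of the reciprocity law.
\<close>

lemma source_image_values:
  assumes limV1: "((\<lambda>t. G (src.vert t) - src.cc / (x - src.vert t)) \<longlongrightarrow> V1) (at_right 0)"
    and limV2: "((\<lambda>t. H (img.vert t) - img.cc / (gx - img.vert t)) \<longlongrightarrow> V2) (at_right 0)"
  shows "V1 = w0 ^ n * V2 - src.cc * of_int c / w0"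
proof -
  obtain A where A: "A \<in> carrier SL2Z" "A $ 1 $ 1 = r" "A $ 2 $ 1 = p"
    using SL2Z_with_first_column[OF coprime] .
  define gA where "gA = \<gamma> ** A"
  have gA: "gA \<in> carrier SL2Z" "gA $ 1 $ 1 = a * r + b * p" "gA $ 2 $ 1 = c * r + d * p"
    using SL2Z_mult[OF \<gamma>_SL2Z A(1)] by (simp_all add: gA_def mult2_nth A entries)
  define u1 where "u1 = - real_of_int (A $ 2 $ 2) / of_int p"
  define u2 where "u2 = - real_of_int (gA $ 2 $ 2) / of_int (c * r + d * p)"
  define E where "E = (\<lambda>z. G (moebius_act A z) - src.cc / (x - moebius_act A z))"
  define E' where "E' = (\<lambda>z. of_int p ^ 2 / of_int p ^ k * (slash k f A z - cusp_const k f r p))"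
  have xA: "x - moebius_act A z = 1 / (of_int p * den A z)" if "Im z > 0" for z
  proof -
    have det: "complex_of_int r * of_int (A $ 2 $ 2) - of_int (A $ 1 $ 2) * of_int p = 1"
      using SL2Z_det[OF A(1), where 'a=complex] by (simp add: A)
    have nz: "den A z \<noteq> 0" by (rule den_nonzero[OF A(1) that])
    have "x - moebius_act A z = (of_int r * den A z - of_int p * (of_int r * z + of_int (A $ 1 $ 2))) / (of_int p * den A z)"
      using p nz by (simp add: x_def moebius_act_def A field_simps)
    also have "of_int r * den A z - of_int p * (of_int r * z + of_int (A $ 1 $ 2)) = (1 :: complex)"
      using det by (simp add: den_def A algebra_simps)
    finally show ?thesis .
  qed
  have E_der: "(E has_field_derivative E' z) (at z)" if z: "Im z > 0" for z
  proof -
    let ?w = "moebius_act A z"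
    have w: "Im ?w > 0" by (rule Im_moebius_pos[OF A(1) z])
    have nz: "den A z \<noteq> 0" by (rule den_nonzero[OF A(1) z])
    have xw: "x - ?w \<noteq> 0" using xA[OF z] nz p by simp
    have "(E has_field_derivative (f ?w * (x - ?w) ^ n) * (1 / den A z ^ 2)
        - src.cc * ((1 / den A z ^ 2) / (x - ?w) ^ 2)) (at z)"
    proof -
      have "((\<lambda>z. G (moebius_act A z)) has_field_derivative (f ?w * (x - ?w) ^ n) * (1 / den A z ^ 2)) (at z)"
        by (intro DERIV_chain2[OF G] moebius_has_field_derivative A(1) z w)
      moreover have "((\<lambda>z. inverse (x - moebius_act A z)) has_field_derivative
         - (inverse (x - ?w) * (0 - 1 / den A z ^ 2) * inverse (x - ?w))) (at z)"
        by (intro DERIV_inverse' DERIV_diff DERIV_const moebius_has_field_derivative A(1) z xw)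
      hence "((\<lambda>z. src.cc * inverse (x - moebius_act A z)) has_field_derivative
         src.cc * - (inverse (x - ?w) * (0 - 1 / den A z ^ 2) * inverse (x - ?w))) (at z)"
        by (rule DERIV_cmult)
      ultimately have "(E has_field_derivative (f ?w * (x - ?w) ^ n) * (1 / den A z ^ 2) -
         src.cc * - (inverse (x - ?w) * (0 - 1 / den A z ^ 2) * inverse (x - ?w))) (at z)"
        unfolding E_def divide_inverse[of src.cc] by (rule DERIV_diff)
      moreover have "- (inverse y * (0 - q) * inverse y) = q / y ^ 2" for y q :: complex
        by (simp add: power2_eq_square divide_inverse)
      ultimately show ?thesis by (simp only:)
    qed
    also have "(f ?w * (x - ?w) ^ n) * (1 / den A z ^ 2) - src.cc * ((1 / den A z ^ 2) / (x - ?w) ^ 2) = E' z"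
    proof -
      have den_k: "den A z ^ k = den A z ^ n * den A z ^ 2"
        by (simp only: k_eq power_add)
      have p_k: "complex_of_int p ^ k = of_int p ^ n * of_int p ^ 2"
        by (simp only: k_eq power_add)
      have "f ?w = den A z ^ k * slash k f A z"
        using nz by (simp add: slash_eq)
      hence "f ?w = den A z ^ n * den A z ^ 2 * slash k f A z"
        by (simp only: den_k)
      hence "(f ?w * (x - ?w) ^ n) * (1 / den A z ^ 2) = slash k f A z / of_int p ^ n"
        unfolding xA[OF z] using nz p by (simp add: power_divide power_mult_distrib)
      also have "\<dots> = of_int p ^ 2 / of_int p ^ k * slash k f A z"
        unfolding p_k using p by simp
      finally have 1: "(f ?w * (x - ?w) ^ n) * (1 / den A z ^ 2) = of_int p ^ 2 / of_int p ^ k * slash k f A z" .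
      have 2: "src.cc * ((1 / den A z ^ 2) / (x - ?w) ^ 2) = of_int p ^ 2 / of_int p ^ k * cusp_const k f r p"
        unfolding xA[OF z] src_cc using nz p by (simp add: power_divide power_mult_distrib)
      show ?thesis unfolding 1 2 E'_def by (simp only: right_diff_distrib)
    qed
    finally show ?thesis .
  qed
  obtain C e where C: "C \<ge> 0" "e > 0"
    "\<And>\<tau>. Im \<tau> \<ge> 1 \<Longrightarrow> norm (slash k f A \<tau> - cusp_const k f r p) \<le> C * exp (- e * Im \<tau>)"
    using cusp_decay[OF A(1) zero_less_one] unfolding A by blast
  define K where "K = norm (complex_of_int p ^ 2 / of_int p ^ k) * (C / e)"
  have E_bound: "norm (E' (Complex u t)) \<le> K / t" if t: "t \<ge> 1" for u t
  proof -
    have "norm (slash k f A (Complex u t) - cusp_const k f r p) \<le> C * exp (- (e * t))"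
      using C(3)[of "Complex u t"] t by simp
    also have "\<dots> \<le> C * (fact 1 / (e * t) ^ 1)"
      using C t by (intro mult_left_mono exp_minus_le) auto
    finally have "norm (slash k f A (Complex u t) - cusp_const k f r p) \<le> C / (e * t)" by simp
    from mult_left_mono[OF this norm_ge_zero[of "complex_of_int p ^ 2 / of_int p ^ k"]]
    show ?thesis unfolding E'_def K_def norm_mult by (simp only: times_divide_eq_right divide_divide_eq_left)
  qed
  have lim1: "((\<lambda>v. E (Complex u1 v)) \<longlongrightarrow> V1) at_top"
  proof -
    have "filterlim (\<lambda>v. 1 / (real_of_int p ^ 2 * v)) (at_right 0) at_top"
      using p by (intro filterlim_inverse_at_right_0) simp
    from filterlim_compose[OF limV1 this]
    have "((\<lambda>v. G (src.vert (1 / (real_of_int p ^ 2 * v))) - src.cc / (x - src.vert (1 / (real_of_int p ^ 2 * v)))) \<longlongrightarrow> V1) at_top" .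
    moreover have "\<forall>\<^sub>F v in at_top. G (src.vert (1 / (real_of_int p ^ 2 * v))) - src.cc / (x - src.vert (1 / (real_of_int p ^ 2 * v))) = E (Complex u1 v)"
      using eventually_gt_at_top[of "0 :: real"]
    proof eventually_elim
      case (elim v)
      have "moebius_act A (Complex u1 v) = src.vert (1 / (real_of_int p ^ 2 * v))"
        using vert_moebius[OF A(1) _ elim] p by (simp add: u1_def A)
      thus ?case by (simp only: E_def)
    qed
    ultimately show ?thesis by (rule Lim_transform_eventually)
  qed
  have lim2: "((\<lambda>v. E (Complex u2 v)) \<longlongrightarrow> w0 ^ n * V2 - src.cc * of_int c / w0) at_top"
  proof -
    let ?q = "real_of_int (c * r + d * p)"
    have "filterlim (\<lambda>v. 1 / (?q ^ 2 * v)) (at_right 0) at_top"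
      using crdp by (intro filterlim_inverse_at_right_0) (simp del: of_int_add of_int_mult)
    from filterlim_compose[OF limV2 this]
    have "((\<lambda>v. w0 ^ n * (H (img.vert (1 / (?q ^ 2 * v))) - img.cc / (gx - img.vert (1 / (?q ^ 2 * v)))) - src.cc * of_int c / w0)
        \<longlongrightarrow> w0 ^ n * V2 - src.cc * of_int c / w0) at_top"
      by (intro tendsto_diff tendsto_const tendsto_mult_left)
    moreover have "\<forall>\<^sub>F v in at_top. w0 ^ n * (H (img.vert (1 / (?q ^ 2 * v))) - img.cc / (gx - img.vert (1 / (?q ^ 2 * v)))) - src.cc * of_int c / w0
        = E (Complex u2 v)"
      using eventually_gt_at_top[of "0 :: real"]
    proof eventually_elim
      case (elim v)
      define z where "z = Complex u2 v"
      define w where "w = moebius_act A z"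
      have z: "Im z > 0" using elim by (simp add: z_def)
      have w: "Im w > 0" unfolding w_def by (rule Im_moebius_pos[OF A(1) z])
      have xw: "x - w \<noteq> 0" using xA[OF z] den_nonzero[OF A(1) z] p by (simp add: w_def)
      have "moebius_act gA z = img.vert (1 / (?q ^ 2 * v))"
      proof -
        have "gA $ 2 $ 1 \<noteq> 0" using crdp by (simp only: gA(3) not_False_eq_True)
        from vert_moebius[OF gA(1) this elim] show ?thesis by (simp only: gA(2,3) u2_def z_def)
      qed
      hence gw: "img.vert (1 / (?q ^ 2 * v)) = moebius_act \<gamma> w"
        unfolding gA_def w_def by (simp only: moebius_mult[OF \<gamma>_SL2Z A(1) z])
      have "w0 ^ n * (H (moebius_act \<gamma> w) - img.cc / (gx - moebius_act \<gamma> w)) = G w - src.cc * (den \<gamma> w / (w0 * (x - w)))"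
      proof -
        have w0_k: "w0 ^ k = w0 ^ n * w0 * w0"
          by (simp add: k_eq mult_ac)
        have "W * (h / W - s / (W * q * q) / (y / (q * D))) = h - s * (D / (q * y))"
          if "W \<noteq> 0" "q \<noteq> 0" for W q h s y D :: complex
          using that by (simp add: right_diff_distrib)
        thus ?thesis unfolding H_image[OF w] gx_diff[OF w] img_cc w0_k
          using w0_nonzero by simp
      qed
      also have "den \<gamma> w / (w0 * (x - w)) = 1 / (x - w) - of_int c / w0"
        unfolding den_eq_x using w0_nonzero xw by (simp add: diff_divide_distrib)
      finally have "w0 ^ n * (H (moebius_act \<gamma> w) - img.cc / (gx - moebius_act \<gamma> w)) - src.cc * of_int c / w0
          = G w - src.cc / (x - w)"
        by (simp add: right_diff_distrib)
      thus ?case unfolding gw E_def w_def z_def .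
    qed
    ultimately show ?thesis by (rule Lim_transform_eventually)
  qed
  have "((\<lambda>v. E (Complex u2 v)) \<longlongrightarrow> V1) at_top"
    by (rule vertical_limit_independent_of_line[OF E_der E_bound lim1])
  from tendsto_unique[OF trivial_limit_at_top_linorder this lim2] show ?thesis .
qed

theorem reciprocity:
  "w0 ^ n * hatL k N f (of_int (a * r + b * p) / of_int (c * r + d * p)) (of_nat (n + 1))
     - hatL k N f (of_int r / of_int p) (of_nat (n + 1))
   = - (\<Sum>j=0..n. bc j * hatL k N f (of_int d / of_int (- c)) (of_nat (j + 1)))
     - fcoeff 0 / of_nat (n + 1) * ((x - y0) ^ (n + 1) - 1 / ((- of_int c) ^ (n + 1) * w0))
     - src.cc * of_int c / w0"
proof -
  have n1: "k - 1 - n = 1" by (simp add: k_eq)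
  have nk: "n + 2 \<le> k" by (simp add: k_eq)
  obtain U1 V1 where 1:
    "((\<lambda>t. G (src.vert t) + fcoeff 0 * (x - src.vert t) ^ (n + 1) / of_nat (n + 1)) \<longlongrightarrow> U1) at_top"
    "((\<lambda>t. G (src.vert t) - src.cc / (of_nat (k - 1 - n) * (x - src.vert t) ^ (k - 1 - n))) \<longlongrightarrow> V1) (at_right 0)"
    "hatL k N f (of_int r / of_int p) (of_nat (n + 1)) = U1 - V1"
    by (rule src.hatL_boundary_values[OF nk x_def G])
  obtain U2 V2 where 2:
    "((\<lambda>t. H (img.vert t) + fcoeff 0 * (gx - img.vert t) ^ (n + 1) / of_nat (n + 1)) \<longlongrightarrow> U2) at_top"
    "((\<lambda>t. H (img.vert t) - img.cc / (of_nat (k - 1 - n) * (gx - img.vert t) ^ (k - 1 - n))) \<longlongrightarrow> V2) (at_right 0)"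
    "hatL k N f (of_int (a * r + b * p) / of_int (c * r + d * p)) (of_nat (n + 1)) = U2 - V2"
    by (rule img.hatL_boundary_values[OF nk gx_eq H])
  define P where "P = (\<lambda>j U V.
    ((\<lambda>t. prim j (pole.vert t) + fcoeff 0 * (y0 - pole.vert t) ^ (j + 1) / of_nat (j + 1)) \<longlongrightarrow> U) at_top \<and>
    ((\<lambda>t. prim j (pole.vert t) - pole.cc / (of_nat (k - 1 - j) * (y0 - pole.vert t) ^ (k - 1 - j))) \<longlongrightarrow> V) (at_right 0) \<and>
    hatL k N f (of_int d / of_int (- c)) (of_nat (j + 1)) = U - V)"
  have "\<exists>U V. P j U V" if "j \<le> n" for j
  proof -
    have "j + 2 \<le> k" using that by (simp add: k_eq)
    from pole.hatL_boundary_values[OF this y0_def prim] obtain U V where "P j U V"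
      unfolding P_def by blast
    thus ?thesis by blast
  qed
  then obtain U V where "\<And>j. j \<le> n \<Longrightarrow> P j (U j) (V j)"
    by metis
  note 3 = this[unfolded P_def, THEN conjunct1] this[unfolded P_def, THEN conjunct2, THEN conjunct1]
    this[unfolded P_def, THEN conjunct2, THEN conjunct2]
  have S: "(\<Sum>j=0..n. bc j * hatL k N f (of_int d / of_int (- c)) (of_nat (j + 1)))
      = (\<Sum>j=0..n. bc j * U j) - (\<Sum>j=0..n. bc j * V j)"
    unfolding sum_subtractf[symmetric]
  proof (rule sum.cong[OF refl])
    fix j assume "j \<in> {0..n}"
    hence "j \<le> n" by simp
    show "bc j * hatL k N f (of_int d / of_int (- c)) (of_nat (j + 1)) = bc j * U j - bc j * V j"
      unfolding 3(3)[OF \<open>j \<le> n\<close>] by (rule right_diff_distrib)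
  qed
  have e1: "U1 = (\<Sum>j=0..n. bc j * U j) + fcoeff 0 * (x - y0) ^ (n + 1) / of_nat (n + 1)"
    by (rule pole_value_at_infinity[OF 3(1) 1(1)])
  have e2: "(\<Sum>j=0..n. bc j * V j) = w0 ^ n * U2 - fcoeff 0 / (of_nat (n + 1) * (- of_int c) ^ (n + 1) * w0)"
    by (rule pole_value_at_pole[OF 3(2) 2(1)])
  have e3: "V1 = w0 ^ n * V2 - src.cc * of_int c / w0"
    by (rule source_image_values) (use 1(2) 2(2) in \<open>simp_all only: n1 of_nat_1 mult_1 power_one_right\<close>)
  have "W * (U - V) - ((Z + h * P / m) - (W * V - B))
      = - (Z - (W * U - h / (m * Q * q))) - h / m * (P - 1 / (Q * q)) - B" for W U V Z h P m B Q q :: complex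
    by (simp add: right_diff_distrib)
  thus ?thesis unfolding S e2 1(3) 2(3) e1 e3 .
qed

end

section \<open>The reciprocity law for generalized Dedekind sums\<close>

theorem theorem1p4:
  fixes k N :: nat and \<Gamma> :: "(int ^ 2 ^ 2) set" and f :: "complex \<Rightarrow> complex"
    and r p a b c d :: int and x :: rat and \<gamma> :: "int ^ 2 ^ 2"
  assumes "k \<ge> 2"
    and "congruence_subgroup \<Gamma>"
    and "modular_form k \<Gamma> f"
    and "N \<ge> 1" and "principal_subgroup N \<subseteq> \<Gamma>"
    and "coprime r p" and "p > 0" and "x = of_int r / of_int p"
    and "\<gamma> \<in> \<Gamma>"
    and "a = \<gamma> $ 1 $ 1" and "b = \<gamma> $ 1 $ 2" and "c = \<gamma> $ 2 $ 1" and "d = \<gamma> $ 2 $ 2"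
    and "c \<noteq> 0" and "of_int c * x + of_int d \<noteq> 0"
  shows "of_rat (of_int c * x + of_int d) ^ (k - 2) *
           dedekind_sum k N f ((of_int a * x + of_int b) / (of_int c * x + of_int d))
           - dedekind_sum k N f x
         = period_poly k N f \<gamma> (of_rat x)
           - cusp_const k f r p / of_int p ^ k * (of_int c / of_rat (of_int c * x + of_int d))"
proof -
  interpret L: modular_form_level k N \<Gamma> f
    by unfold_locales (fact assms)+
  have entries: "c = \<gamma> $ 2 $ 1" "d = \<gamma> $ 2 $ 2"
    by fact+
  have w: "of_int c * x + of_int d = (of_int (c * r + d * p) / of_int p :: rat)"
    using \<open>p > 0\<close> by (simp add: \<open>x = of_int r / of_int p\<close> field_simps)
  have nz: "c * r + d * p \<noteq> 0"
  proof
    assume "c * r + d * p = 0"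
    hence "of_int c * x + of_int d = 0" unfolding w by (simp only: of_int_0 div_0)
    with \<open>of_int c * x + of_int d \<noteq> 0\<close> show False by blast
  qed
  interpret R: reciprocity_data k N \<Gamma> f r p \<gamma> a b c d "k - 2"
    by unfold_locales (use assms nz in auto)
  have x: "of_rat x = R.x" by (simp add: R.x_def \<open>x = of_int r / of_int p\<close> of_rat_divide)
  have w0: "of_rat (of_int c * x + of_int d) = R.w0"
    by (simp add: R.w0_def of_rat_add of_rat_mult x)
  have img: "(of_int a * x + of_int b) / (of_int c * x + of_int d)
      = (of_int (a * r + b * p) / of_int (c * r + d * p) :: rat)"
  proof -
    have "of_int a * x + of_int b = (of_int (a * r + b * p) / of_int p :: rat)"
      using \<open>p > 0\<close> by (simp add: \<open>x = of_int r / of_int p\<close> field_simps)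
    thus ?thesis unfolding w using \<open>p > 0\<close> by (simp del: of_int_add of_int_mult)
  qed
  have pole: "- of_int d / of_int c = (of_int d / of_int (- c) :: rat)" by simp
  have k1: "k - 1 = k - 2 + 1" using \<open>k \<ge> 2\<close> by simp
  have "period_poly k N f \<gamma> (of_rat x) =
      - (\<Sum>j=0..k-2. R.bc j * hatL k N f (of_int d / of_int (- c)) (of_nat (j + 1)))
     - fourier_coeff N f 0 / of_nat (k - 2 + 1) *
         ((R.x - R.y0) ^ (k - 2 + 1) - 1 / ((- of_int c) ^ (k - 2 + 1) * R.w0))"
  proof -
    have "(\<Sum>j=0..k-2. of_nat ((k - 2) choose j) * hatL k N f (of_int d / of_int (- c)) (of_nat (j + 1))
            * (R.w0 / of_int c) ^ (k - j - 2))
        = (\<Sum>j=0..k-2. R.bc j * hatL k N f (of_int d / of_int (- c)) (of_nat (j + 1)))"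
    proof (rule sum.cong[OF refl])
      fix j
      have "k - j - 2 = k - 2 - j" by simp
      thus "of_nat ((k - 2) choose j) * hatL k N f (of_int d / of_int (- c)) (of_nat (j + 1))
              * (R.w0 / of_int c) ^ (k - j - 2)
          = R.bc j * hatL k N f (of_int d / of_int (- c)) (of_nat (j + 1))"
        by (simp only: R.bc_def R.x_minus_y0 mult_ac)
    qed
    thus ?thesis
      unfolding period_poly_def Let_def x entries[symmetric] pole k1 R.x_minus_y0 R.w0_def[symmetric]
      by (simp only:)
  qed
  moreover have "dedekind_sum k N f x = hatL k N f (of_int r / of_int p) (of_nat (k - 2 + 1))"
    by (simp only: dedekind_sum_def k1 \<open>x = of_int r / of_int p\<close>)
  moreover have "dedekind_sum k N f ((of_int a * x + of_int b) / (of_int c * x + of_int d))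
      = hatL k N f (of_int (a * r + b * p) / of_int (c * r + d * p)) (of_nat (k - 2 + 1))"
    by (simp only: dedekind_sum_def k1 img)
  ultimately show ?thesis
    using R.reciprocity by (simp only: w0 R.src_cc times_divide_eq_right)
qed

end
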